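(* Let $T$ be a tree, let $H\leqslant\operatorname{Aut}(T)$ be a subgroup, and let $\Gamma_1,\Gamma_2\leqslant H$ be free uniform lattices in $\operatorname{Aut}(T)$. Then for all integers $R\geq 1$ there exists $g\in\mathscr{S}_R(H)$ such that $\Gamma_1^g$ is commensurable to $\Gamma_2$ in $\operatorname{Aut}(T)$ and, furthermore, $$|\Gamma_1^g:\Gamma_1^g\cap\Gamma_2|\leq (d!)^{4d^{R-1}}\,V^2\exp\bigl(2\sqrt{V\log V}\bigr),$$ where $V:=|V(T/\Gamma_1)\sqcup V(T/\Gamma_2)|$ and $d$ is the maximum degree of vertices in $T$.
   Context: A graph $G$ consists of a vertex set $V(G)$, an edge set $E(G)$ (of oriented edges), maps $\partial_0,\partial_1:E(G)\to V(G)$ (initial and terminal vertex), and an involution $e\mapsto\overline{e}$ on $E(G)$ with $e\neq\overline{e}$, $\partial_0 e=\partial_1\overline{e}$ and $\partial_0\overline{e}=\partial_1 e$ for all $e$. Graph morphisms preserve $\partial_0,\partial_1$ and edge inversion; an automorphism of a graph is a morphism from the graph to itself that is bijective on vertices and on edges, and $\operatorname{Aut}(G)$ denotes the group of automorphisms. The degree of a vertex $v$ is the number of edges $e$ with $\partial_0e=v$. For a tree $T$, a subgroup $\Gamma\leqslant\operatorname{Aut}(T)$ is a free uniform lattice in $\operatorname{Aut}(T)$ (with the compact-open topology) if it acts freely and cocompactly on $T$ (freely on the topological realisation, so no non-trivial element fixes a vertex or inverts an edge); equivalently, $\Gamma$ is the group of deck transformations of a covering $T\to G$ of a finite graph $G$;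 the quotient graph is denoted $T/\Gamma$. For $v\in V(T)$, $B_R(v)$ denotes the $R$-ball in $T$ centred at $v$, and for $g\in\operatorname{Aut}(T)$, $g_v:B_R(v)\to B_R(gv)$ denotes the restriction of $g$ to $B_R(v)$. The $R$-symmetry-restricted closure of $H\leqslant\operatorname{Aut}(T)$ is $$\mathscr{S}_R(H):=\{g\in\operatorname{Aut}(T)\mid \forall v\in V(T),\ \exists h\in H \text{ such that } h_v=g_v:B_R(v)\to B_R(gv)\}.$$ $\Gamma_1^g=g\Gamma_1g^{-1}$. Two subgroups of a group are commensurable in that group if their intersection has finite index in each of them. *)

theory Defs
  imports
    Complex_Main
    "HOL-Algebra.Coset"
    "HOL-Algebra.Bij"
    "HOL-Algebra.Group_Action"
    "Graph_Theory.Graph_Theory"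
begin

text \<open>
  A graph with oriented edges and a fixed-point free edge inversion is a
  \<^locale>\<open>bidirected_digraph\<close>: a digraph \<open>T\<close> (\<open>tail\<close> and \<open>head\<close> are the initial and the terminal
  vertex map) together with the inversion \<open>arev\<close>, which that locale requires to be the identity
  outside the arcs. The degree of a vertex is its \<^const>\<open>out_degree\<close>.
\<close>

text \<open>
  The library's \<^const>\<open>tree\<close> forbids directed cycles, and so excludes every bidirected graph with an
  edge, since \<open>[e, arev e]\<close> is a \<open>cycle\<close>. A circuit has to be free of backtracking as well; for a
  \<open>cycle\<close> of length at least 3 this is automatic, for length 2 it says that the two arcs are not
  inverse to each other, and loops are circuits of length 1.
\<close>

definition no_backtracking :: "('e \<Rightarrow> 'e) \<Rightarrow> 'e list \<Rightarrow> bool" where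
  "no_backtracking arev p \<longleftrightarrow> (\<forall>i. Suc i < length p \<longrightarrow> p ! Suc i \<noteq> arev (p ! i))"

definition bidirected_tree :: "('v, 'e) pre_digraph \<Rightarrow> ('e \<Rightarrow> 'e) \<Rightarrow> bool" where
  "bidirected_tree T arev \<longleftrightarrow>
     bidirected_digraph T arev \<and> connected T \<and>
     \<not> (\<exists>p. pre_digraph.cycle T p \<and> no_backtracking arev p)"

text \<open>
  An automorphism is a pair of a vertex map and an arc map; as in \<^const>\<open>BijGroup\<close>, both are
  \<^const>\<open>undefined\<close> outside the graph, so that equality of pairs is equality of automorphisms.
\<close>

type_synonym ('v, 'e) graph_map = "('v \<Rightarrow> 'v) \<times> ('e \<Rightarrow> 'e)"

definition automorphisms :: "('v, 'e) pre_digraph \<Rightarrow> ('e \<Rightarrow> 'e) \<Rightarrow> ('v, 'e) graph_map set" where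
  "automorphisms T arev =
     {g \<in> Bij (verts T) \<times> Bij (arcs T).
        \<forall>e \<in> arcs T. tail T (snd g e) = fst g (tail T e) \<and>
                    head T (snd g e) = fst g (head T e) \<and>
                    snd g (arev e) = arev (snd g e)}"

definition Aut :: "('v, 'e) pre_digraph \<Rightarrow> ('e \<Rightarrow> 'e) \<Rightarrow> ('v, 'e) graph_map monoid" where
  "Aut T arev = (BijGroup (verts T) \<times>\<times> BijGroup (arcs T)) \<lparr>carrier := automorphisms T arev\<rparr>"

text \<open>
  Vertices and arcs of \<open>T/\<Gamma>\<close> are \<open>\<Gamma>\<close>-orbits. The image under \<open>tail\<close> of an orbit of arcs is the orbit
  of the tail of any of its members, and likewise for \<open>head\<close>.
\<close>

definition quotient_graph ::
    "('v, 'e) pre_digraph \<Rightarrow> ('e \<Rightarrow> 'e) \<Rightarrow> ('v, 'e) graph_map set \<Rightarrow> ('v set, 'e set) pre_digraph" where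
  "quotient_graph T arev \<Gamma> =
     \<lparr>verts = orbits (Aut T arev \<lparr>carrier := \<Gamma>\<rparr>) (verts T) fst,
      arcs = orbits (Aut T arev \<lparr>carrier := \<Gamma>\<rparr>) (arcs T) snd,
      tail = (\<lambda>A. tail T ` A),
      head = (\<lambda>A. head T ` A)\<rparr>"

definition acts_freely ::
    "('v, 'e) pre_digraph \<Rightarrow> ('e \<Rightarrow> 'e) \<Rightarrow> ('v, 'e) graph_map set \<Rightarrow> bool" where
  "acts_freely T arev \<Gamma> \<longleftrightarrow>
     (\<forall>g \<in> \<Gamma>. g \<noteq> \<one>\<^bsub>Aut T arev\<^esub> \<longrightarrow>
        (\<forall>v \<in> verts T. fst g v \<noteq> v) \<and> (\<forall>e \<in> arcs T. snd g e \<noteq> arev e))"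

text \<open>
  Cocompactness: as no edge is inverted, the topological quotient is the realisation of \<open>T/\<Gamma>\<close>,
  which is compact iff \<open>T/\<Gamma>\<close> is finite.
\<close>

definition free_uniform_lattice ::
    "('v, 'e) pre_digraph \<Rightarrow> ('e \<Rightarrow> 'e) \<Rightarrow> ('v, 'e) graph_map set \<Rightarrow> bool" where
  "free_uniform_lattice T arev \<Gamma> \<longleftrightarrow>
     subgroup \<Gamma> (Aut T arev) \<and> acts_freely T arev \<Gamma> \<and> fin_digraph (quotient_graph T arev \<Gamma>)"

definition graph_ball :: "('v, 'e) pre_digraph \<Rightarrow> nat \<Rightarrow> 'v \<Rightarrow> ('v, 'e) pre_digraph" where
  "graph_ball T R v = T \<restriction> {u. \<exists>p. pre_digraph.awalk T v p u \<and> length p \<le> R}"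

definition symmetry_restricted_closure ::
    "('v, 'e) pre_digraph \<Rightarrow> ('e \<Rightarrow> 'e) \<Rightarrow> nat \<Rightarrow> ('v, 'e) graph_map set \<Rightarrow> ('v, 'e) graph_map set" where
  "symmetry_restricted_closure T arev R H =
     {g \<in> carrier (Aut T arev). \<forall>v \<in> verts T. \<exists>h \<in> H.
        (\<forall>u \<in> verts (graph_ball T R v). fst h u = fst g u) \<and>
        (\<forall>e \<in> arcs (graph_ball T R v). snd h e = snd g e)}"

definition conjugate_subgroup :: "('g, 'm) monoid_scheme \<Rightarrow> 'g \<Rightarrow> 'g set \<Rightarrow> 'g set" where
  "conjugate_subgroup G g K = g <#\<^bsub>G\<^esub> K #>\<^bsub>G\<^esub> inv\<^bsub>G\<^esub> g"

text \<open>\<open>subgroup_index\<close> is 0 for an infinite index.\<close>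

definition subgroup_index :: "('g, 'm) monoid_scheme \<Rightarrow> 'g set \<Rightarrow> 'g set \<Rightarrow> nat" where
  "subgroup_index G K L = card (rcosets\<^bsub>G\<lparr>carrier := K\<rparr>\<^esub> L)"

definition commensurable :: "('g, 'm) monoid_scheme \<Rightarrow> 'g set \<Rightarrow> 'g set \<Rightarrow> bool" where
  "commensurable G K L \<longleftrightarrow>
     finite (rcosets\<^bsub>G\<lparr>carrier := K\<rparr>\<^esub> (K \<inter> L)) \<and> finite (rcosets\<^bsub>G\<lparr>carrier := L\<rparr>\<^esub> (K \<inter> L))"

end

theory Submission
  imports Defs
begin

text \<open>
  The idea is that of Leighton's theorem that finite graphs with the same universal cover have a common
  finite cover, carried out directly on the tree \<open>T\<close> and keeping track of \<open>R\<close>-balls.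

  Consider the states \<open>(v, f, i)\<close>, where \<open>v\<close> is a vertex, \<open>f\<close> is the restriction of an element of \<open>H\<close> to the
  \<open>R\<close>-ball around \<open>v\<close>, and \<open>i < w v\<close> numbers \<open>w v\<close> copies of it. The group \<open>\<Gamma>\<^sub>1 \<times> \<Gamma>\<^sub>2\<close> acts freely on them, \<open>\<Gamma>\<^sub>1\<close> by
  moving \<open>v\<close> (and precomposing), \<open>\<Gamma>\<^sub>2\<close> by postcomposing, with finitely many orbits. Suppose that for each arc
  \<open>e\<close> every partial map on the intersection of the balls around its ends is continued by equally many
  states at the tail as at the head. Then these states can be matched in pairs, equivariantly and
  compatibly with the inversion of arcs (\<open>equivariant_matching\<close>). The states so glued form a covering
  of \<open>T\<close>, and because \<open>T\<close> is a tree there is a section: a state for each vertex, such that the states at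
  adjacent vertices are matched (\<open>ex_local_section\<close>). The partial maps of a section fit together to a map
  \<open>g\<close> that coincides with an element of \<open>H\<close> on each \<open>R\<close>-ball; it is locally bijective, hence an automorphism
  of \<open>T\<close>, and it lies in the symmetry-restricted closure.

  If the states of the section at \<open>v\<close> and at \<open>\<gamma> v\<close>, with \<open>\<gamma> \<in> \<Gamma>\<^sub>1\<close>, are in the same orbit, then they are related
  by some \<open>(\<gamma>, \<delta>)\<close>. As the matching is equivariant, the whole section is then invariant under \<open>(\<gamma>, \<delta>)\<close>, that
  is, \<open>g\<close> conjugates \<open>\<gamma>\<close> to \<open>\<delta>\<close> (\<open>same_state_class\<close>). So the index in question is at most the number of
  orbits of states over the \<open>\<Gamma>\<^sub>1\<close>-orbit of a single vertex \<open>v\<close>.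

  It remains to choose the weights \<open>w\<close>. Let \<open>\<Gamma>\<close> be \<open>\<Gamma>\<^sub>1\<close> or \<open>\<Gamma>\<^sub>2\<close>, and for a set \<open>U\<close> of vertices let \<open>N(U)\<close> be
  the number of \<open>\<Gamma>\<close>-orbits of restrictions of elements of \<open>H\<close> to \<open>U\<close>. Since \<open>\<Gamma>\<close> acts freely, \<open>N(U')\<close> for a larger
  set \<open>U'\<close> is \<open>N(U)\<close> times the number of extensions of a partial map from \<open>U\<close> to \<open>U'\<close> (\<open>num_classes_mult\<close>).
  Hence the weights \<open>w v = L / N(ball around v)\<close> satisfy the condition above for every common multiple \<open>L\<close> of
  the denominators. Now \<open>N(ball around v)\<close> is the product of the number \<open>a v\<close> of \<open>\<Gamma>\<close>-orbits in the \<open>H\<close>-orbit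
  of \<open>v\<close> and of the number of restrictions to the ball of elements fixing \<open>v\<close>. The latter divides
  \<open>(d!) ^ (1 + d + ... + d ^ (R - 1))\<close> by Lagrange's theorem, one vertex at a time (\<open>num_ext_ball_dvd\<close>). The
  numbers \<open>a v\<close>, one for each \<open>H\<close>-orbit, have the number of vertices of \<open>T/\<Gamma>\<close> as their sum, and for the group
  with the smaller quotient this is at most \<open>V/2\<close>. The least common multiple of numbers with that sum is
  at most \<open>exp (2 sqrt (V ln V))\<close> (\<open>Lcm_le_exp_sqrt\<close>). With these weights the orbits of states over the
  \<open>\<Gamma>\<^sub>1\<close>-orbit of a vertex are at most \<open>V L\<close> in number (\<open>ex_gluing_weight\<close>).
\<close>

section \<open>The least common multiple of numbers with bounded sum\<close>

text \<open>
  The reciprocals \<open>l m r = 1 / (r * (m choose r))\<close> are the entries of the Leibniz harmonic triangle: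
  \<open>l m 1 = 1 / m\<close> and \<open>l m (r + 1) = l (m - 1) r - l m r\<close>. So each entry is an integer combination of
  \<open>1/1, ..., 1/m\<close>, and a common multiple of \<open>1, ..., m\<close> clears its denominator. In the proof \<open>x\<close> and \<open>y\<close>
  are the numerators of \<open>l (m - 1) r\<close> and \<open>l m r\<close> over \<open>L\<close>.
\<close>

lemma index_mult_binomial_dvd_common_multiple:
  fixes m r L :: nat
  assumes "1 \<le> r" "r \<le> m" and "\<And>i. 1 \<le> i \<Longrightarrow> i \<le> m \<Longrightarrow> i dvd L"
  shows "r * (m choose r) dvd L"
  using assms
proof (induction r arbitrary: m rule: nat_induct_at_least)
  case base
  then show ?case by auto
next
  case (Suc r)
  have r: "r < m" using Suc by simp
  have d1: "r * ((m - 1) choose r) dvd L" using Suc by (intro Suc.IH) auto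
  have d2: "r * (m choose r) dvd L" using Suc by (intro Suc.IH) auto
  obtain x where x: "L = r * ((m - 1) choose r) * x" using d1 by blast
  obtain y where y: "L = r * (m choose r) * y" using d2 by blast
  have c1: "m * ((m - 1) choose r) = (m - r) * (m choose r)"
    using binomial_absorb_comp[of m r] by simp
  have c2: "Suc r * (m choose Suc r) = (m - r) * (m choose r)"
    using binomial_absorption[of r "m"] c1 binomial_absorption[of r "m - 1"] r
    by (metis Suc_diff_1 binomial_absorption gr_zeroI less_nat_zero_code)
  have pos: "m choose r > 0" using r by simp
  have "r * (m choose r) * (m - r) * x = m * L"
    using x c1 by (metis mult.assoc mult.commute)
  also have "\<dots> = r * (m choose r) * (m * y)" by (simp add: y)
  finally have "(m - r) * x = m * y" using pos Suc(1) by simp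
  then have "(m - r) * x = (m - r) * y + r * y"
    using r by (metis add_mult_distrib le_add_diff_inverse2 less_imp_le)
  then have "(m - r) * (x - y) = r * y" by (simp add: diff_mult_distrib2)
  then have "L = (m - r) * (m choose r) * (x - y)"
    using y by (simp add: mult_ac)
  then show ?case using c2 by simp
qed

text \<open>
  Count the pairs of a \<open>j\<close>-subset of an \<open>N\<close>-set and an \<open>a\<close>-subset of it in two ways. Since
  \<open>(j choose a) * (j - a) = j * ((j - 1) choose a)\<close>, this exhibits \<open>j\<close> as a divisor of
  \<open>(N choose a) * ((j - a) * ((N - a) choose (j - a)))\<close>, and the second factor divides \<open>L\<close>.
\<close>

lemma dvd_binomial_mult_common_multiple:
  fixes N a j L :: nat
  assumes "a < j" "j \<le> N" "N \<le> 2 * a" and L: "\<And>i. 1 \<le> i \<Longrightarrow> i \<le> a \<Longrightarrow> i dvd L"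
  shows "j dvd (N choose a) * L"
proof -
  have "(j - a) * ((N - a) choose (j - a)) dvd L"
    using assms by (intro index_mult_binomial_dvd_common_multiple) auto
  then have "(N choose a) * ((j - a) * ((N - a) choose (j - a))) dvd (N choose a) * L"
    by (rule mult_dvd_mono[OF dvd_refl])
  moreover have "(N choose a) * ((j - a) * ((N - a) choose (j - a))) = (N choose j) * (j choose a) * (j - a)"
    using choose_mult[of a j N] assms by (simp add: mult_ac)
  moreover have "(j choose a) * (j - a) = j * ((j - 1) choose a)"
    using binomial_absorb_comp[of j a] by (simp add: mult_ac)
  ultimately show ?thesis by (metis dvd_def dvd_trans mult.assoc mult.left_commute)
qed

lemma Lcm_le_binomial_mult:
  fixes N a :: nat
  assumes "a \<le> N" "N \<le> 2 * a"
  shows "Lcm {1..N} \<le> (N choose a) * Lcm {1..a}"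
proof (rule dvd_imp_le)
  have "j dvd (N choose a) * Lcm {1..a}" if "j \<in> {1..N}" for j
  proof (cases "j \<le> a")
    case True
    then have "j dvd Lcm {1..a}" using that by (intro dvd_Lcm) auto
    then show ?thesis by simp
  next
    case False
    then show ?thesis using that assms
      by (intro dvd_binomial_mult_common_multiple) (auto intro!: dvd_Lcm)
  qed
  then show "Lcm {1..N} dvd (N choose a) * Lcm {1..a}" by (intro Lcm_least)
  show "0 < (N choose a) * Lcm {1..a}"
    using assms by (auto simp: Lcm_0_iff_nat intro!: Nat.gr0I)
qed

lemma central_binomial_odd_le: "(Suc (2 * m) choose Suc m) \<le> 4 ^ m"
proof -
  have "(Suc (2 * m) choose m) + (Suc (2 * m) choose Suc m) = (\<Sum>k\<in>{m, Suc m}. Suc (2 * m) choose k)"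
    by simp
  also have "\<dots> \<le> (\<Sum>k\<le>Suc (2 * m). Suc (2 * m) choose k)"
    by (intro sum_mono2) auto
  also have "\<dots> = 2 * 4 ^ m" by (simp only: choose_row_sum) (simp add: power_mult)
  finally show ?thesis using binomial_symmetric[of m "Suc (2 * m)"] by simp
qed

text \<open>
  Halving, as in Erdos' bound for the product of the primes up to \<open>n\<close>, but with least common
  multiples in place of primorials.
\<close>

lemma Lcm_le_power_4: "Lcm {1..n::nat} \<le> 4 ^ n"
proof (induction n rule: less_induct)
  case (less n)
  consider "n = 0" | "n = 1" | m where "n = 2 * m" "m > 0" | m where "n = Suc (2 * m)" "m > 0"
    by (metis One_nat_def gr0I mult_0_right oddE evenE Suc_eq_plus1)
  then show ?case
  proof cases
    case (3 m)
    have "Lcm {1..n} \<le> (n choose m) * Lcm {1..m}"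
      using 3 by (intro Lcm_le_binomial_mult) auto
    also have "\<dots> \<le> 2 ^ n * 4 ^ m"
      using less[of m] 3 by (intro mult_mono binomial_le_pow2) auto
    also have "\<dots> = 4 ^ n" using 3 by (simp add: power_mult power_mult_distrib mult_2 power_add flip: power_mult_distrib)
    finally show ?thesis .
  next
    case (4 m)
    have "Lcm {1..n} \<le> (n choose Suc m) * Lcm {1..Suc m}"
      using 4 by (intro Lcm_le_binomial_mult) auto
    also have "\<dots> \<le> 4 ^ m * 4 ^ Suc m"
      using less[of "Suc m"] 4 central_binomial_odd_le[of m] by (intro mult_mono) auto
    also have "\<dots> = 4 ^ n" using 4 by (simp add: mult_2 power_add)
    finally show ?thesis .
  qed auto
qed

lemma prod_le_exp_sum_div:
  fixes a :: "'i \<Rightarrow> nat" and t V :: real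
  assumes "finite I" and "t > 0" and "V \<ge> 1"
    and "\<And>i. i \<in> I \<Longrightarrow> t < a i" and "\<And>i. i \<in> I \<Longrightarrow> a i \<le> V"
  shows "(\<Prod>i\<in>I. real (a i)) \<le> exp ((\<Sum>i\<in>I. real (a i)) / t * ln V)"
proof -
  have "real (a i) \<le> exp (real (a i) / t * ln V)" if "i \<in> I" for i
  proof -
    have "1 * ln V \<le> real (a i) / t * ln V"
      using assms that by (intro mult_right_mono) (auto simp: less_imp_le)
    then have "V \<le> exp (real (a i) / t * ln V)"
      using assms(3) by (metis exp_le_cancel_iff exp_ln less_le_trans mult_1 zero_less_one)
    then show ?thesis using assms(5)[OF that] by linarith
  qed
  then have "(\<Prod>i\<in>I. real (a i)) \<le> (\<Prod>i\<in>I. exp (real (a i) / t * ln V))"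
    by (intro prod_mono) auto
  also have "\<dots> = exp ((\<Sum>i\<in>I. real (a i)) / t * ln V)"
    using assms(1) by (simp add: exp_sum sum_divide_distrib sum_distrib_right)
  finally show ?thesis .
qed

text \<open>
  Split at \<open>t = sqrt (V ln V)\<close>. The numbers up to \<open>t\<close> contribute at most \<open>lcm(1, ..., t) \<le> 4 ^ t \<le> exp (3/2 t)\<close>.
  At most \<open>V / (2 t)\<close> of the numbers exceed \<open>t\<close>, and each is at most \<open>V\<close>, so they contribute at most
  \<open>exp (V / (2 t) * ln V) = exp (t / 2)\<close>.
\<close>

lemma Lcm_le_exp_sqrt:
  fixes a :: "'i \<Rightarrow> nat" and V :: nat
  assumes fin: "finite I" and pos: "\<And>i. i \<in> I \<Longrightarrow> a i > 0"
    and sum: "2 * (\<Sum>i\<in>I. a i) \<le> V" and V: "V \<ge> 2"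
  shows "real (Lcm (a ` I)) \<le> exp (2 * sqrt (real V * ln (real V)))"
proof -
  define t where "t = sqrt (real V * ln (real V))"
  have t: "t > 0" using V by (simp add: t_def)
  define m where "m = nat \<lfloor>t\<rfloor>"
  define J where "J = {i\<in>I. t < a i}"
  have "Lcm (a ` I) dvd Lcm {1..m} * (\<Prod>i\<in>J. a i)"
  proof (rule Lcm_least, clarify)
    fix i assume i: "i \<in> I"
    show "a i dvd Lcm {1..m} * (\<Prod>i\<in>J. a i)"
    proof (cases "i \<in> J")
      case True
      then show ?thesis using fin by (intro dvd_mult dvd_prodI) (auto simp: J_def)
    next
      case False
      then have "a i \<le> m" using i t by (auto simp: J_def m_def le_nat_floor)
      then show ?thesis using pos[OF i] by (intro dvd_mult2 dvd_Lcm) auto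
    qed
  qed
  moreover have "Lcm {1..m} * (\<Prod>i\<in>J. a i) > 0"
    using pos fin by (auto simp: J_def Lcm_0_iff_nat intro!: Nat.gr0I)
  ultimately have "Lcm (a ` I) \<le> Lcm {1..m} * (\<Prod>i\<in>J. a i)" by (rule dvd_imp_le)
  then have "real (Lcm (a ` I)) \<le> real (Lcm {1..m}) * (\<Prod>i\<in>J. real (a i))"
    by (metis of_nat_le_iff of_nat_mult of_nat_prod)
  also have "\<dots> \<le> exp (3 / 2 * t) * exp (1 / 2 * t)"
  proof (rule mult_mono)
    have "real (Lcm {1..m}) \<le> 4 ^ m"
      using Lcm_le_power_4[of m] by (metis of_nat_le_iff of_nat_numeral of_nat_power)
    also have "(4::real) \<le> exp (3 / 2)"
    proof -
      have "(1 + (3/4) + (3/4)^2 / 2 :: real) \<le> exp (3 / 4)" using exp_lower_Taylor_quadratic[of "3/4"] by simp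
      then have "(1 + (3/4) + (3/4)^2 / 2 :: real)^2 \<le> exp (3 / 4)^2" by (intro power_mono) auto
      then show ?thesis by (simp add: power2_eq_square flip: exp_add)
    qed
    then have "(4::real) ^ m \<le> exp (3 / 2) ^ m" by (intro power_mono) auto
    also have "\<dots> = exp (3 / 2 * real m)" by (rule exp_of_nat2_mult[symmetric])
    also have "\<dots> \<le> exp (3 / 2 * t)" using t by (simp add: m_def)
    finally show "real (Lcm {1..m}) \<le> exp (3 / 2 * t)" .
    have le: "(\<Sum>i\<in>J. real (a i)) \<le> real V / 2"
    proof -
      have "(\<Sum>i\<in>J. a i) \<le> (\<Sum>i\<in>I. a i)" using fin by (intro sum_mono2) (auto simp: J_def)
      then have "2 * (\<Sum>i\<in>J. a i) \<le> V" using sum by simp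
      then have "real (2 * (\<Sum>i\<in>J. a i)) \<le> real V" by (simp only: of_nat_le_iff)
      then show ?thesis by simp
    qed
    have "(\<Prod>i\<in>J. real (a i)) \<le> exp ((\<Sum>i\<in>J. real (a i)) / t * ln V)"
    proof (rule prod_le_exp_sum_div)
      fix i assume i: "i \<in> J"
      have "a i \<le> (\<Sum>i\<in>I. a i)" using fin i by (intro member_le_sum) (auto simp: J_def)
      then show "real (a i) \<le> real V" using sum by linarith
    qed (use fin t V in \<open>auto simp: J_def\<close>)
    also have "\<dots> \<le> exp (real V / 2 / t * ln V)"
      unfolding exp_le_cancel_iff using le t V by (intro mult_right_mono divide_right_mono) auto
    also have "real V / 2 / t * ln V = 1 / 2 * t"
    proof -
      have "real V * ln V = t * t" using V by (simp add: t_def)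
      then show ?thesis using t by (simp add: field_simps)
    qed
    finally show "(\<Prod>i\<in>J. real (a i)) \<le> exp (1 / 2 * t)" .
  qed (auto intro: prod_nonneg)
  also have "\<dots> = exp (2 * t)" by (simp flip: exp_add)
  finally show ?thesis by (simp add: t_def)
qed

section \<open>Counting restrictions of group elements\<close>

text \<open>
  Orbits, cosets and double cosets are all counted below as images of maps on one and the same group;
  two such images are compared through the equivalence relations that the maps induce.
\<close>

lemma card_image_eq_if_same_kernel:
  assumes "\<And>x y. x \<in> S \<Longrightarrow> y \<in> S \<Longrightarrow> f x = f y \<longleftrightarrow> g x = g y"
  shows "card (f ` S) = card (g ` S)"
proof (rule bij_betw_same_card[of "\<lambda>z. g (inv_into S f z)"], rule bij_betwI')
  have inv: "inv_into S f z \<in> S" "f (inv_into S f z) = z" if "z \<in> f ` S" for z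
    using that by (auto simp: inv_into_into f_inv_into_f)
  show "g (inv_into S f x) = g (inv_into S f y) \<longleftrightarrow> x = y" if "x \<in> f ` S" "y \<in> f ` S" for x y
    using assms[OF inv(1)[OF that(1)] inv(1)[OF that(2)]] inv(2) that by simp
  show "g (inv_into S f x) \<in> g ` S" if "x \<in> f ` S" for x using inv that by blast
  show "\<exists>x\<in>f ` S. y = g (inv_into S f x)" if "y \<in> g ` S" for y
  proof -
    obtain x where x: "x \<in> S" "y = g x" using \<open>y \<in> g ` S\<close> by blast
    then have "g (inv_into S f (f x)) = y" using assms[OF inv(1)[of "f x"], of x] inv(2) by simp
    then show ?thesis using x by (intro bexI[of _ "f x"]) auto
  qed
qed

lemma card_image_fibres:
  assumes "finite (g ` S)" and "m > 0"
    and refines: "\<And>x y. x \<in> S \<Longrightarrow> y \<in> S \<Longrightarrow> f x = f y \<Longrightarrow> g x = g y"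
    and fibre: "\<And>x. x \<in> S \<Longrightarrow> card (f ` {y \<in> S. g y = g x}) = m"
  shows "finite (f ` S)" "card (f ` S) = m * card (g ` S)"
proof -
  have eq: "f ` S = (\<Union>z\<in>g ` S. f ` {y \<in> S. g y = z})" by auto
  have fin: "finite (f ` {y \<in> S. g y = z})" if "z \<in> g ` S" for z
  proof -
    obtain x where "x \<in> S" "g x = z" using \<open>z \<in> g ` S\<close> by blast
    then show ?thesis using fibre[of x] assms(2) by (intro card_ge_0_finite) simp
  qed
  show "finite (f ` S)" unfolding eq using assms(1) fin by (rule finite_UN_I)
  have "card (f ` S) = (\<Sum>z\<in>g ` S. card (f ` {y \<in> S. g y = z}))"
    unfolding eq
  proof (rule card_UN_disjoint)
    show "\<forall>z\<in>g ` S. \<forall>z'\<in>g ` S. z \<noteq> z' \<longrightarrow> f ` {y \<in> S. g y = z} \<inter> f ` {y \<in> S. g y = z'} = {}"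
    proof (intro ballI impI equals0I)
      fix z z' c assume "z \<noteq> z'" "c \<in> f ` {y \<in> S. g y = z} \<inter> f ` {y \<in> S. g y = z'}"
      then obtain x y where "x \<in> S" "y \<in> S" "f x = f y" "g x = z" "g y = z'"
        by auto
      then show False using refines[of x y] \<open>z \<noteq> z'\<close> by simp
    qed
  qed (use assms(1) fin in auto)
  also have "\<dots> = (\<Sum>z\<in>g ` S. m)" by (rule sum.cong) (use fibre in auto)
  finally show "card (f ` S) = m * card (g ` S)" by simp
qed

lemma restrict_eq_iff: "restrict f U = restrict g U \<longleftrightarrow> (\<forall>u\<in>U. f u = g u)"
  by (auto simp: restrict_def fun_eq_iff)

lemma order_BijGroup:
  assumes "finite M" shows "order (BijGroup M) = fact (card M)"
proof -
  have "bij_betw (\<lambda>p. restrict p M) {p. p permutes M} (Bij M)"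
  proof (rule bij_betwI')
    fix p q assume pq: "p \<in> {p. p permutes M}" "q \<in> {p. p permutes M}"
    show "restrict p M = restrict q M \<longleftrightarrow> p = q"
    proof -
      have "p x = q x" if "\<forall>x\<in>M. p x = q x" for x
        using that pq by (cases "x \<in> M") (auto simp: permutes_not_in)
      then show ?thesis by (auto simp: restrict_eq_iff)
    qed
    show "restrict p M \<in> Bij M"
      using pq by (simp add: Bij_def permutes_imp_bij)
  next
    fix f assume f: "f \<in> Bij M"
    let ?p = "\<lambda>x. if x \<in> M then f x else x"
    have "bij_betw f M M" using f by (simp add: Bij_def)
    then have "bij_betw ?p M M" by (rule bij_betw_cong[THEN iffD1, rotated]) simp
    then have "?p permutes M" by (intro bij_imp_permutes) auto
    moreover have "restrict ?p M = f"
      using f by (simp add: Bij_def extensional_restrict restrict_eq_iff cong: restrict_cong)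
    ultimately show "\<exists>p\<in>{p. p permutes M}. f = restrict p M" by (intro bexI[of _ ?p]) auto
  qed
  from bij_betw_same_card[OF this] show ?thesis
    using assms by (simp add: order_def BijGroup_def card_permutations)
qed

locale acting_group = group G + group_action G E \<phi>
  for G (structure) and E :: "'v set" and \<phi>
begin

text \<open>
  \<open>fixer U\<close> is the pointwise stabiliser of \<open>U\<close>. Restricting elements of \<open>fixer U\<close> to a larger set \<open>U'\<close>
  amounts to passing to cosets of \<open>fixer U'\<close>, so \<open>num_ext U U'\<close> is the index of \<open>fixer U'\<close> in \<open>fixer U\<close>.
  In the same way \<open>local_class \<Gamma> U h\<close> represents the double coset \<open>\<Gamma> h (fixer U)\<close>, and \<open>num_classes \<Gamma> U\<close> is
  the number of such double cosets. As everywhere with \<^const>\<open>card\<close>, the value 0 means infinite.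
\<close>

definition fixer :: "'v set \<Rightarrow> 'a set" where
  "fixer U = {h \<in> carrier G. \<forall>u\<in>U. \<phi> h u = u}"

definition num_ext :: "'v set \<Rightarrow> 'v set \<Rightarrow> nat" where
  "num_ext U U' = card ((\<lambda>h. restrict (\<phi> h) U') ` fixer U)"

definition local_class :: "'a set \<Rightarrow> 'v set \<Rightarrow> 'a \<Rightarrow> ('v \<Rightarrow> 'v) set" where
  "local_class \<Gamma> U h = (\<lambda>\<gamma>. restrict (\<phi> (\<gamma> \<otimes> h)) U) ` \<Gamma>"

definition num_classes :: "'a set \<Rightarrow> 'v set \<Rightarrow> nat" where
  "num_classes \<Gamma> U = card (local_class \<Gamma> U ` carrier G)"

lemma act_closed: "g \<in> carrier G \<Longrightarrow> x \<in> E \<Longrightarrow> \<phi> g x \<in> E"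
  using element_image by blast

lemma act_one: "x \<in> E \<Longrightarrow> \<phi> \<one> x = x"
  using id_eq_one by (metis restrict_apply')

lemma act_inv: "g \<in> carrier G \<Longrightarrow> x \<in> E \<Longrightarrow> \<phi> (inv g) (\<phi> g x) = x"
  by (rule orbit_sym_aux) auto

lemma act_inv': "g \<in> carrier G \<Longrightarrow> x \<in> E \<Longrightarrow> \<phi> g (\<phi> (inv g) x) = x"
  using act_inv[of "inv g" x] by simp

lemma act_inj: "g \<in> carrier G \<Longrightarrow> x \<in> E \<Longrightarrow> y \<in> E \<Longrightarrow> \<phi> g x = \<phi> g y \<longleftrightarrow> x = y"
  using act_inv by metis

lemma fixer_empty [simp]: "fixer {} = carrier G"
  by (simp add: fixer_def)

lemma fixer_carrier: "k \<in> fixer U \<Longrightarrow> k \<in> carrier G"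
  by (simp add: fixer_def)

lemma one_in_fixer: "U \<subseteq> E \<Longrightarrow> \<one> \<in> fixer U"
  by (auto simp: fixer_def act_one)

lemma mult_in_fixer: "U \<subseteq> E \<Longrightarrow> h \<in> fixer U \<Longrightarrow> k \<in> fixer U \<Longrightarrow> h \<otimes> k \<in> fixer U"
  by (auto simp: fixer_def composition_rule subset_iff)

lemma agree_iff_fixer:
  assumes "U \<subseteq> E" "x \<in> carrier G" "y \<in> carrier G"
  shows "(\<forall>u\<in>U. \<phi> y u = \<phi> x u) \<longleftrightarrow> inv x \<otimes> y \<in> fixer U"
proof -
  have "\<phi> y u = \<phi> x u \<longleftrightarrow> \<phi> (inv x \<otimes> y) u = u" if "u \<in> U" for u
    using assms that act_inv[of x u] act_inv'[of x "\<phi> y u"] act_closed[of y u]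
    by (auto simp: composition_rule subset_iff)
  then show ?thesis using assms by (auto simp: fixer_def)
qed

lemma agree_eq_image_fixer:
  assumes "U' \<subseteq> U" "U \<subseteq> E" "x \<in> fixer U'"
  shows "{y \<in> fixer U'. \<forall>u\<in>U. \<phi> y u = \<phi> x u} = (\<lambda>k. x \<otimes> k) ` fixer U"
proof (intro equalityI subsetI)
  have x: "x \<in> carrier G" using assms(3) by (rule fixer_carrier)
  fix y assume "y \<in> {y \<in> fixer U'. \<forall>u\<in>U. \<phi> y u = \<phi> x u}"
  then have y: "y \<in> carrier G" "inv x \<otimes> y \<in> fixer U"
    using agree_iff_fixer[OF assms(2) x] fixer_carrier by auto
  then have "y = x \<otimes> (inv x \<otimes> y)" using x by (simp flip: m_assoc)
  then show "y \<in> (\<lambda>k. x \<otimes> k) ` fixer U" using y by blast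
next
  fix y assume "y \<in> (\<lambda>k. x \<otimes> k) ` fixer U"
  then obtain k where k: "k \<in> fixer U" "y = x \<otimes> k" by blast
  moreover have "k \<in> fixer U'" using k(1) assms(1) by (auto simp: fixer_def)
  moreover have "\<phi> y u = \<phi> x u" if "u \<in> U" for u
    using that k assms(2,3) by (auto simp: fixer_def composition_rule subset_iff)
  ultimately show "y \<in> {y \<in> fixer U'. \<forall>u\<in>U. \<phi> y u = \<phi> x u}"
    using assms by (auto intro: mult_in_fixer)
qed

text \<open>
  All elements agreeing with \<open>x\<close> on \<open>U\<close> form the coset \<open>x (fixer U)\<close>, so the number of ways to extend a
  partial map from \<open>U\<close> to \<open>U'\<close> does not depend on the map.
\<close>

lemma card_extensions:
  assumes "U\<^sub>0 \<subseteq> U" "U \<subseteq> U'" "U' \<subseteq> E" "x \<in> fixer U\<^sub>0"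
  shows "card ((\<lambda>h. restrict (\<phi> h) U') ` {y \<in> fixer U\<^sub>0. \<forall>u\<in>U. \<phi> y u = \<phi> x u}) = num_ext U U'"
proof -
  have "(\<lambda>h. restrict (\<phi> h) U') ` {y \<in> fixer U\<^sub>0. \<forall>u\<in>U. \<phi> y u = \<phi> x u}
      = (\<lambda>k. restrict (\<phi> (x \<otimes> k)) U') ` fixer U"
    using assms by (subst agree_eq_image_fixer) (auto simp: image_image)
  also have "card \<dots> = num_ext U U'"
    unfolding num_ext_def
  proof (rule card_image_eq_if_same_kernel)
    fix k l assume "k \<in> fixer U" "l \<in> fixer U"
    then have kl: "k \<in> carrier G" "l \<in> carrier G" "x \<in> carrier G"
      using fixer_carrier assms(4) by auto
    have "\<phi> (x \<otimes> k) u = \<phi> (x \<otimes> l) u \<longleftrightarrow> \<phi> k u = \<phi> l u" if "u \<in> U'" for u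
    proof -
      have "u \<in> E" using that assms(3) by blast
      then show ?thesis using kl by (simp add: composition_rule act_inj act_closed)
    qed
    then show "restrict (\<phi> (x \<otimes> k)) U' = restrict (\<phi> (x \<otimes> l)) U' \<longleftrightarrow>
        restrict (\<phi> k) U' = restrict (\<phi> l) U'" by (simp add: restrict_eq_iff)
  qed
  finally show ?thesis .
qed

lemma num_ext_mult:
  assumes "U \<subseteq> U'" "U' \<subseteq> U''" "U'' \<subseteq> E" and "num_ext U U' > 0" "num_ext U' U'' > 0"
  shows "num_ext U U'' = num_ext U' U'' * num_ext U U'"
  unfolding num_ext_def[of U]
proof (rule card_image_fibres(2))
  show "finite ((\<lambda>h. restrict (\<phi> h) U') ` fixer U)"
    using assms(4) unfolding num_ext_def by (rule card_ge_0_finite)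
  show "card ((\<lambda>h. restrict (\<phi> h) U'') `
      {y \<in> fixer U. restrict (\<phi> y) U' = restrict (\<phi> x) U'}) = num_ext U' U''"
    if "x \<in> fixer U" for x
    using card_extensions[of U U' U'' x] that assms by (simp add: restrict_eq_iff)
  show "restrict (\<phi> x) U' = restrict (\<phi> y) U'" if "restrict (\<phi> x) U'' = restrict (\<phi> y) U''" for x y
    using that assms(2) by (auto simp: restrict_eq_iff)
qed (use assms in auto)

text \<open>
  The elements of \<open>fixer U\<close> act on \<open>M\<close> through a subgroup of the symmetric group of \<open>M\<close>, whose order is the
  index to be bounded; now apply Lagrange's theorem.
\<close>

lemma num_ext_dvd_fact:
  assumes "U \<subseteq> E" "M \<subseteq> E" "finite M"
    and inv: "\<And>k m. k \<in> fixer U \<Longrightarrow> m \<in> M \<Longrightarrow> \<phi> k m \<in> M"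
  shows "num_ext U (U \<union> M) dvd fact (card M)"
proof -
  let ?r = "\<lambda>k. restrict (\<phi> k) M"
  interpret S: group "BijGroup M" by (rule group_BijGroup)
  have in_Bij: "?r k \<in> Bij M" if "k \<in> fixer U" for k
  proof -
    have "inj_on (\<phi> k) M"
      using fixer_carrier[OF that] assms(2) by (auto simp: inj_on_def act_inj subset_iff)
    moreover have "\<phi> k ` M = M"
      using inv[OF that] calculation assms(3) by (intro endo_inj_surj) auto
    ultimately show ?thesis by (auto simp: Bij_def bij_betw_def inj_on_def)
  qed
  have mult: "?r h \<otimes>\<^bsub>BijGroup M\<^esub> ?r k = ?r (h \<otimes> k)" if "h \<in> fixer U" "k \<in> fixer U" for h k
  proof -
    have "\<phi> (h \<otimes> k) m = \<phi> h (\<phi> k m)" if "m \<in> M" for m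
      using that fixer_carrier \<open>h \<in> _\<close> \<open>k \<in> _\<close> assms(2) by (intro composition_rule) auto
    then show ?thesis using in_Bij that inv
      by (simp add: BijGroup_def compose_def restrict_eq_iff)
  qed
  have inv_in: "inv k \<in> fixer U" if "k \<in> fixer U" for k
    using that assms agree_iff_fixer[of U k \<one>] by (auto simp: fixer_def act_one subset_iff)
  have "subgroup (?r ` fixer U) (BijGroup M)"
  proof (rule S.subgroupI)
    show "?r ` fixer U \<subseteq> carrier (BijGroup M)" using in_Bij by (auto simp: BijGroup_def)
    show "?r ` fixer U \<noteq> {}" using one_in_fixer assms by blast
    show "a \<otimes>\<^bsub>BijGroup M\<^esub> b \<in> ?r ` fixer U" if "a \<in> ?r ` fixer U" "b \<in> ?r ` fixer U" for a b
      using that mult assms mult_in_fixer by blast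
    show "inv\<^bsub>BijGroup M\<^esub> a \<in> ?r ` fixer U" if "a \<in> ?r ` fixer U" for a
    proof -
      obtain k where k: "k \<in> fixer U" "a = ?r k" using \<open>a \<in> ?r ` fixer U\<close> by blast
      have "?r (inv k) \<otimes>\<^bsub>BijGroup M\<^esub> a = ?r \<one>"
        using k mult[of "inv k" k] inv_in fixer_carrier by simp
      also have "\<dots> = \<one>\<^bsub>BijGroup M\<^esub>"
        using assms by (auto simp: BijGroup_def restrict_eq_iff act_one subset_iff)
      finally have "inv\<^bsub>BijGroup M\<^esub> a = ?r (inv k)"
        using k in_Bij inv_in by (intro S.inv_equality) (auto simp: BijGroup_def)
      then show ?thesis using inv_in k by blast
    qed
  qed
  then have "card (?r ` fixer U) dvd order (BijGroup M)"
    by (metis S.lagrange dvd_triv_right)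
  moreover have "num_ext U (U \<union> M) = card (?r ` fixer U)"
    unfolding num_ext_def
    by (rule card_image_eq_if_same_kernel) (auto simp: restrict_eq_iff fixer_def)
  ultimately show ?thesis using assms by (simp add: order_BijGroup)
qed

lemma local_class_eq_iff:
  assumes "subgroup \<Gamma> G" "U \<subseteq> E" "h \<in> carrier G" "h' \<in> carrier G"
  shows "local_class \<Gamma> U h = local_class \<Gamma> U h' \<longleftrightarrow> (\<exists>\<gamma>\<in>\<Gamma>. \<forall>u\<in>U. \<phi> h' u = \<phi> (\<gamma> \<otimes> h) u)"
proof
  interpret \<Gamma>: subgroup \<Gamma> G by fact
  assume "local_class \<Gamma> U h = local_class \<Gamma> U h'"
  moreover have "restrict (\<phi> (\<one> \<otimes> h')) U \<in> local_class \<Gamma> U h'"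
    unfolding local_class_def by (rule imageI[OF \<Gamma>.one_closed])
  ultimately obtain \<gamma> where "\<gamma> \<in> \<Gamma>" "restrict (\<phi> h') U = restrict (\<phi> (\<gamma> \<otimes> h)) U"
    using l_one[OF assms(4)] unfolding local_class_def by force
  then show "\<exists>\<gamma>\<in>\<Gamma>. \<forall>u\<in>U. \<phi> h' u = \<phi> (\<gamma> \<otimes> h) u"
    by (auto simp: restrict_eq_iff)
next
  interpret \<Gamma>: subgroup \<Gamma> G by fact
  have sub: "local_class \<Gamma> U h' \<subseteq> local_class \<Gamma> U h"
    if \<gamma>: "\<gamma> \<in> \<Gamma>" "\<forall>u\<in>U. \<phi> h' u = \<phi> (\<gamma> \<otimes> h) u" "h \<in> carrier G" "h' \<in> carrier G" for \<gamma> h h'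
  proof -
    have "restrict (\<phi> (\<delta> \<otimes> h')) U = restrict (\<phi> (\<delta> \<otimes> \<gamma> \<otimes> h)) U" if "\<delta> \<in> \<Gamma>" for \<delta>
      unfolding restrict_eq_iff
    proof
      fix u assume "u \<in> U"
      then have "u \<in> E" "\<phi> h' u = \<phi> (\<gamma> \<otimes> h) u" using assms(2) \<gamma>(2) by auto
      then show "\<phi> (\<delta> \<otimes> h') u = \<phi> (\<delta> \<otimes> \<gamma> \<otimes> h) u"
        using that \<gamma>(1,3,4) by (simp add: composition_rule act_closed)
    qed
    then show ?thesis unfolding local_class_def
      using \<Gamma>.m_closed[OF _ \<gamma>(1)] by (intro image_subsetI) simp
  qed
  assume "\<exists>\<gamma>\<in>\<Gamma>. \<forall>u\<in>U. \<phi> h' u = \<phi> (\<gamma> \<otimes> h) u"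
  then obtain \<gamma> where \<gamma>: "\<gamma> \<in> \<Gamma>" "\<forall>u\<in>U. \<phi> h' u = \<phi> (\<gamma> \<otimes> h) u" by blast
  have agree: "\<forall>u\<in>U. \<phi> h u = \<phi> (inv \<gamma> \<otimes> h') u"
  proof
    fix u assume "u \<in> U"
    then have "u \<in> E" "\<phi> h' u = \<phi> (\<gamma> \<otimes> h) u" using assms(2) \<gamma>(2) by auto
    then show "\<phi> h u = \<phi> (inv \<gamma> \<otimes> h') u"
      using \<gamma>(1) assms(3,4) act_inv[of \<gamma> "\<phi> h u"] by (simp add: composition_rule act_closed)
  qed
  show "local_class \<Gamma> U h = local_class \<Gamma> U h'"
    using sub[OF \<gamma> assms(3,4)] sub[OF \<Gamma>.m_inv_closed[OF \<gamma>(1)] agree assms(4,3)] by (rule equalityI[rotated])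
qed

definition semiregular :: "'a set \<Rightarrow> bool" where
  "semiregular \<Gamma> \<longleftrightarrow> (\<forall>\<gamma>\<in>\<Gamma>. \<forall>v\<in>E. \<phi> \<gamma> v = v \<longrightarrow> \<gamma> = \<one>)"

lemma semiregularD: "semiregular \<Gamma> \<Longrightarrow> \<gamma> \<in> \<Gamma> \<Longrightarrow> v \<in> E \<Longrightarrow> \<phi> \<gamma> v = v \<Longrightarrow> \<gamma> = \<one>"
  unfolding semiregular_def by blast

lemma semiregular_eqD:
  assumes "subgroup \<Gamma> G" "semiregular \<Gamma>" "\<gamma> \<in> \<Gamma>" "\<gamma>' \<in> \<Gamma>" "v \<in> E" "\<phi> \<gamma> v = \<phi> \<gamma>' v"
  shows "\<gamma> = \<gamma>'"
proof -
  interpret \<Gamma>: subgroup \<Gamma> G by fact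
  have "\<phi> (inv \<gamma>' \<otimes> \<gamma>) v = v" using assms by (simp add: composition_rule act_inv)
  then have "inv \<gamma>' \<otimes> \<gamma> = \<one>" using assms by (intro semiregularD[OF assms(2)]) auto
  then show ?thesis using assms by (metis \<Gamma>.mem_carrier inv_closed inv_equality inv_inv)
qed

text \<open>
  This is the counting identity behind the weights of the gluing construction. Passing from \<open>\<Gamma> h (fixer U)\<close>
  to the double cosets of the smaller group \<open>fixer U'\<close> inside it, one gets \<open>\<Gamma> h k (fixer U')\<close> with
  \<open>k \<in> fixer U\<close>; a coincidence of two of them would produce an element of \<open>\<Gamma>\<close> fixing \<open>h u\<close> for \<open>u \<in> U\<close>,
  so they are in bijection with the cosets of \<open>fixer U'\<close> in \<open>fixer U\<close>.
\<close>

lemma num_classes_mult: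
  assumes \<Gamma>: "subgroup \<Gamma> G" and free: "semiregular \<Gamma>"
    and U: "U \<noteq> {}" "U \<subseteq> U'" "U' \<subseteq> E" and pos: "num_classes \<Gamma> U > 0" "num_ext U U' > 0"
  shows "num_classes \<Gamma> U' = num_ext U U' * num_classes \<Gamma> U"
  unfolding num_classes_def
proof (rule card_image_fibres(2))
  interpret \<Gamma>: subgroup \<Gamma> G by fact
  have UE: "U \<subseteq> E" using U by simp
  note iff = local_class_eq_iff[OF \<Gamma>]
  show "finite (local_class \<Gamma> U ` carrier G)"
    using pos(1) unfolding num_classes_def by (rule card_ge_0_finite)
  show "local_class \<Gamma> U x = local_class \<Gamma> U y"
    if "x \<in> carrier G" "y \<in> carrier G" "local_class \<Gamma> U' x = local_class \<Gamma> U' y" for x y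
    using that iff[of U' x y] iff[of U x y] U by blast
  fix x assume x: "x \<in> carrier G"
  have "local_class \<Gamma> U' ` {y \<in> carrier G. local_class \<Gamma> U y = local_class \<Gamma> U x}
      = local_class \<Gamma> U' ` (\<lambda>k. x \<otimes> k) ` fixer U"
  proof (intro equalityI subsetI)
    fix D assume "D \<in> local_class \<Gamma> U' ` {y \<in> carrier G. local_class \<Gamma> U y = local_class \<Gamma> U x}"
    then obtain y where y: "y \<in> carrier G" "local_class \<Gamma> U y = local_class \<Gamma> U x"
      "D = local_class \<Gamma> U' y" by blast
    obtain \<gamma> where \<gamma>: "\<gamma> \<in> \<Gamma>" "\<forall>u\<in>U. \<phi> x u = \<phi> (\<gamma> \<otimes> y) u"
      using y iff[OF UE y(1) x] by blast
    have "\<gamma> \<otimes> y \<in> (\<lambda>k. x \<otimes> k) ` fixer U"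
      using agree_eq_image_fixer[of "{}" U x] \<gamma> y x UE by auto
    moreover have "local_class \<Gamma> U' y = local_class \<Gamma> U' (\<gamma> \<otimes> y)"
      using iff[of U' y "\<gamma> \<otimes> y"] \<gamma> y U by auto
    ultimately show "D \<in> local_class \<Gamma> U' ` (\<lambda>k. x \<otimes> k) ` fixer U" using y by blast
  next
    fix D assume "D \<in> local_class \<Gamma> U' ` (\<lambda>k. x \<otimes> k) ` fixer U"
    then obtain k where k: "k \<in> fixer U" "D = local_class \<Gamma> U' (x \<otimes> k)" by blast
    have kc: "k \<in> carrier G" using k(1) by (rule fixer_carrier)
    have "\<forall>u\<in>U. \<phi> (x \<otimes> k) u = \<phi> (\<one> \<otimes> x) u"
      using k x UE by (auto simp: fixer_def composition_rule subset_iff)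
    then have "local_class \<Gamma> U x = local_class \<Gamma> U (x \<otimes> k)"
      using iff[OF UE x, of "x \<otimes> k"] kc x \<Gamma>.one_closed by blast
    then show "D \<in> local_class \<Gamma> U' ` {y \<in> carrier G. local_class \<Gamma> U y = local_class \<Gamma> U x}"
      using k kc x by auto
  qed
  also have "card \<dots> = num_ext U U'"
    unfolding num_ext_def image_image
  proof (rule card_image_eq_if_same_kernel)
    fix k l assume k: "k \<in> fixer U" and l: "l \<in> fixer U"
    have kl: "k \<in> carrier G" "l \<in> carrier G" using k l fixer_carrier by auto
    obtain u where u: "u \<in> U" "u \<in> E" using U by blast
    have "\<gamma> = \<one>" if "\<gamma> \<in> \<Gamma>" "\<forall>u\<in>U'. \<phi> (x \<otimes> l) u = \<phi> (\<gamma> \<otimes> (x \<otimes> k)) u" for \<gamma>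
    proof (rule semiregularD[OF free])
      have "\<phi> (x \<otimes> l) u = \<phi> (\<gamma> \<otimes> (x \<otimes> k)) u" using that(2) u U by blast
      then show "\<phi> \<gamma> (\<phi> x u) = \<phi> x u"
        using that(1) u k l x kl by (simp add: fixer_def composition_rule)
    qed (use that u x act_closed in auto)
    then have "(\<exists>\<gamma>\<in>\<Gamma>. \<forall>u\<in>U'. \<phi> (x \<otimes> l) u = \<phi> (\<gamma> \<otimes> (x \<otimes> k)) u) \<longleftrightarrow>
        (\<forall>u\<in>U'. \<phi> (x \<otimes> l) u = \<phi> (\<one> \<otimes> (x \<otimes> k)) u)"
      using \<Gamma>.one_closed by blast
    then have "local_class \<Gamma> U' (x \<otimes> k) = local_class \<Gamma> U' (x \<otimes> l) \<longleftrightarrow>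
        (\<forall>u\<in>U'. \<phi> (x \<otimes> l) u = \<phi> (x \<otimes> k) u)"
      using iff[OF U(3), of "x \<otimes> k" "x \<otimes> l"] x kl by simp
    also have "\<dots> \<longleftrightarrow> restrict (\<phi> k) U' = restrict (\<phi> l) U'"
    proof -
      have "\<phi> (x \<otimes> l) u = \<phi> (x \<otimes> k) u \<longleftrightarrow> \<phi> k u = \<phi> l u" if "u \<in> U'" for u
      proof -
        have "u \<in> E" using that U(3) by blast
        then show ?thesis using x kl by (auto simp: composition_rule act_inj act_closed)
      qed
      then show ?thesis by (simp add: restrict_eq_iff)
    qed
    finally show "local_class \<Gamma> U' (x \<otimes> k) = local_class \<Gamma> U' (x \<otimes> l) \<longleftrightarrow>
        restrict (\<phi> k) U' = restrict (\<phi> l) U'" .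
  qed
  finally show "card (local_class \<Gamma> U' ` {y \<in> carrier G. local_class \<Gamma> U y = local_class \<Gamma> U x})
      = num_ext U U'" .
qed (use pos in auto)

lemma num_classes_translate:
  assumes "subgroup \<Gamma> G" "U \<subseteq> E" "g \<in> carrier G"
  shows "num_classes \<Gamma> (\<phi> g ` U) = num_classes \<Gamma> U"
proof -
  have gU: "\<phi> g ` U \<subseteq> E" using assms act_closed by auto
  have "(\<lambda>h. h \<otimes> g) ` carrier G = carrier G"
  proof (intro equalityI subsetI)
    show "x \<in> (\<lambda>h. h \<otimes> g) ` carrier G" if "x \<in> carrier G" for x
      using that assms(3) by (intro image_eqI[of _ _ "x \<otimes> inv g"]) (auto simp: m_assoc)
  qed (use assms(3) in auto)
  then have "num_classes \<Gamma> U = card ((\<lambda>h. local_class \<Gamma> U (h \<otimes> g)) ` carrier G)"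
    unfolding num_classes_def by (metis image_image)
  also have "\<dots> = num_classes \<Gamma> (\<phi> g ` U)"
    unfolding num_classes_def
  proof (rule card_image_eq_if_same_kernel)
    fix x y assume xy: "x \<in> carrier G" "y \<in> carrier G"
    have "\<phi> (y \<otimes> g) u = \<phi> (\<gamma> \<otimes> (x \<otimes> g)) u \<longleftrightarrow> \<phi> y (\<phi> g u) = \<phi> (\<gamma> \<otimes> x) (\<phi> g u)"
      if "\<gamma> \<in> \<Gamma>" "u \<in> U" for u \<gamma>
    proof -
      have "\<gamma> \<in> carrier G" "u \<in> E"
        using that assms(2) subgroup.mem_carrier[OF assms(1)] by auto
      then show ?thesis using xy assms(3) by (simp add: composition_rule act_closed)
    qed
    then show "local_class \<Gamma> U (x \<otimes> g) = local_class \<Gamma> U (y \<otimes> g) \<longleftrightarrow>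
        local_class \<Gamma> (\<phi> g ` U) x = local_class \<Gamma> (\<phi> g ` U) y"
      using xy assms gU by (simp add: local_class_eq_iff)
  qed
  finally show ?thesis by simp
qed

text \<open>
  The double cosets of \<open>\<Gamma>\<close> and the stabiliser of \<open>v\<close> are the \<open>\<Gamma>\<close>-orbits inside the \<open>G\<close>-orbit of \<open>v\<close>.
\<close>

lemma num_classes_vertex:
  assumes \<Gamma>: "subgroup \<Gamma> G" and v: "v \<in> E"
  shows "num_classes \<Gamma> {v} = card ((\<lambda>x. (\<lambda>\<gamma>. \<phi> \<gamma> x) ` \<Gamma>) ` (\<lambda>h. \<phi> h v) ` carrier G)"
  unfolding num_classes_def image_image
proof (rule card_image_eq_if_same_kernel)
  interpret \<Gamma>: subgroup \<Gamma> G by fact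
  define F where "F w = restrict (\<lambda>_. w) {v}" for w :: 'v
  have F: "local_class \<Gamma> {v} x = F ` (\<lambda>\<gamma>. \<phi> \<gamma> (\<phi> x v)) ` \<Gamma>" if "x \<in> carrier G" for x
    unfolding local_class_def image_image F_def
    by (intro image_cong[OF refl] restrict_ext) (use that v in \<open>simp add: composition_rule\<close>)
  have "inj F" by (rule injI) (metis F_def restrict_apply' singletonI)
  then show "local_class \<Gamma> {v} x = local_class \<Gamma> {v} y \<longleftrightarrow>
      (\<lambda>\<gamma>. \<phi> \<gamma> (\<phi> x v)) ` \<Gamma> = (\<lambda>\<gamma>. \<phi> \<gamma> (\<phi> y v)) ` \<Gamma>"
    if "x \<in> carrier G" "y \<in> carrier G" for x y
    unfolding F[OF that(1)] F[OF that(2)] by (rule inj_image_eq_iff)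
qed

lemma num_ext_pos:
  assumes "U\<^sub>0 \<subseteq> U" "U' \<subseteq> U''" "U \<subseteq> E" and pos: "num_ext U\<^sub>0 U'' > 0"
  shows "num_ext U U' > 0"
proof -
  have "finite ((\<lambda>h. restrict (\<phi> h) U'') ` fixer U\<^sub>0)"
    using pos unfolding num_ext_def by (rule card_ge_0_finite)
  then have "finite ((\<lambda>f. restrict f U') ` (\<lambda>h. restrict (\<phi> h) U'') ` fixer U\<^sub>0)" by (rule finite_imageI)
  moreover have "(\<lambda>h. restrict (\<phi> h) U') ` fixer U \<subseteq> (\<lambda>f. restrict f U') ` (\<lambda>h. restrict (\<phi> h) U'') ` fixer U\<^sub>0"
  proof (rule image_subsetI)
    fix h assume "h \<in> fixer U"
    then have h: "h \<in> fixer U\<^sub>0" using assms(1) by (auto simp: fixer_def)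
    have "restrict (\<phi> h) U' = restrict (restrict (\<phi> h) U'') U'"
      using assms(2) by (simp add: restrict_restrict Int_absorb1)
    then show "restrict (\<phi> h) U' \<in> (\<lambda>f. restrict f U') ` (\<lambda>h. restrict (\<phi> h) U'') ` fixer U\<^sub>0"
      using h by blast
  qed
  ultimately have "finite ((\<lambda>h. restrict (\<phi> h) U') ` fixer U)" by (rule finite_subset[rotated])
  moreover have "fixer U \<noteq> {}" using one_in_fixer[of U] assms by blast
  ultimately show ?thesis by (simp add: num_ext_def card_gt_0_iff)
qed

text \<open>
  The orbit under a subset of the group; \<^const>\<open>Group_Action.orbit\<close> takes the whole carrier.
\<close>

definition orbit_of :: "'a set \<Rightarrow> 'v \<Rightarrow> 'v set" where
  "orbit_of K x = (\<lambda>k. \<phi> k x) ` K"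

lemma orbit_of_self: "subgroup K G \<Longrightarrow> x \<in> E \<Longrightarrow> x \<in> orbit_of K x"
  unfolding orbit_of_def by (rule image_eqI[of _ _ \<one>]) (simp_all add: act_one subgroup.one_closed)

lemma orbit_of_subset: "subgroup K G \<Longrightarrow> x \<in> E \<Longrightarrow> orbit_of K x \<subseteq> E"
  unfolding orbit_of_def by (intro image_subsetI act_closed subgroup.mem_carrier)

lemma orbit_of_eq:
  assumes K: "subgroup K G" and "x \<in> E" "y \<in> orbit_of K x"
  shows "orbit_of K y = orbit_of K x"
proof -
  interpret K: subgroup K G by fact
  obtain k where k: "k \<in> K" "y = \<phi> k x" using assms(3) by (auto simp: orbit_of_def)
  have "orbit_of K y \<subseteq> orbit_of K x"
  proof
    fix z assume "z \<in> orbit_of K y"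
    then obtain l where "l \<in> K" "z = \<phi> l y" by (auto simp: orbit_of_def)
    then have "z = \<phi> (l \<otimes> k) x" "l \<otimes> k \<in> K" using k assms(2) by (auto simp: composition_rule)
    then show "z \<in> orbit_of K x" unfolding orbit_of_def by blast
  qed
  moreover have "orbit_of K x \<subseteq> orbit_of K y"
  proof
    fix z assume "z \<in> orbit_of K x"
    then obtain l where l: "l \<in> K" "z = \<phi> l x" by (auto simp: orbit_of_def)
    then have "z = \<phi> (l \<otimes> inv k) y" "l \<otimes> inv k \<in> K"
      using k assms(2) by (auto simp: composition_rule act_closed act_inv)
    then show "z \<in> orbit_of K y" unfolding orbit_of_def by blast
  qed
  ultimately show ?thesis by blast
qed

lemma num_classes_eq_orbits:
  assumes "subgroup \<Gamma> G" "v \<in> E"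
  shows "num_classes \<Gamma> {v} = card (orbit_of \<Gamma> ` orbit_of (carrier G) v)"
  using num_classes_vertex[OF assms] unfolding orbit_of_def .

lemma orbits_of_subgroup:
  assumes \<Gamma>: "subgroup \<Gamma> G" and fin: "finite (orbit_of \<Gamma> ` E)"
  shows "finite (orbit_of (carrier G) ` E)"
    and "(\<Sum>A\<in>orbit_of (carrier G) ` E. card (orbit_of \<Gamma> ` A)) = card (orbit_of \<Gamma> ` E)"
proof -
  interpret \<Gamma>: subgroup \<Gamma> G by fact
  have sub: "subgroup (carrier G) G" by (rule subgroup_self)
  have "orbit_of (carrier G) x \<in> (\<lambda>B. \<Union>y\<in>B. orbit_of (carrier G) y) ` (orbit_of \<Gamma> ` E)" if x: "x \<in> E" for x
  proof -
    have "orbit_of (carrier G) y = orbit_of (carrier G) x" if "y \<in> orbit_of \<Gamma> x" for y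
      by (rule orbit_of_eq[OF sub x]) (use that \<Gamma>.subset in \<open>auto simp: orbit_of_def\<close>)
    then have "orbit_of (carrier G) x = (\<Union>y\<in>orbit_of \<Gamma> x. orbit_of (carrier G) y)"
      using orbit_of_self[OF \<Gamma> x] by blast
    then show ?thesis using x by blast
  qed
  then have "orbit_of (carrier G) ` E \<subseteq> (\<lambda>B. \<Union>y\<in>B. orbit_of (carrier G) y) ` (orbit_of \<Gamma> ` E)"
    by (rule image_subsetI)
  then show finG: "finite (orbit_of (carrier G) ` E)"
    using finite_imageI[OF fin] by (rule finite_subset)
  have "orbit_of \<Gamma> ` E = (\<Union>A\<in>orbit_of (carrier G) ` E. orbit_of \<Gamma> ` A)"
    using orbit_of_self[OF sub] orbit_of_subset[OF sub] by blast
  also have "card \<dots> = (\<Sum>A\<in>orbit_of (carrier G) ` E. card (orbit_of \<Gamma> ` A))"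
  proof (rule card_UN_disjoint[OF finG])
    show "\<forall>A\<in>orbit_of (carrier G) ` E. finite (orbit_of \<Gamma> ` A)"
    proof
      fix A assume "A \<in> orbit_of (carrier G) ` E"
      then have "A \<subseteq> E" using orbit_of_subset[OF sub] by blast
      then show "finite (orbit_of \<Gamma> ` A)" using fin by (meson finite_subset image_mono)
    qed
    show "\<forall>A\<in>orbit_of (carrier G) ` E. \<forall>B\<in>orbit_of (carrier G) ` E.
        A \<noteq> B \<longrightarrow> orbit_of \<Gamma> ` A \<inter> orbit_of \<Gamma> ` B = {}"
    proof (intro ballI impI equals0I)
      fix A B D assume A: "A \<in> orbit_of (carrier G) ` E" and B: "B \<in> orbit_of (carrier G) ` E"
        and "A \<noteq> B" and D: "D \<in> orbit_of \<Gamma> ` A \<inter> orbit_of \<Gamma> ` B"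
      obtain a b where a: "a \<in> E" "A = orbit_of (carrier G) a" and b: "b \<in> E" "B = orbit_of (carrier G) b"
        using A B by blast
      obtain x y where x: "x \<in> A" "D = orbit_of \<Gamma> x" and y: "y \<in> B" "D = orbit_of \<Gamma> y" using D by blast
      have xy: "x \<in> E" "y \<in> E" using x y a b orbit_of_subset[OF sub] by blast+
      have "x \<in> orbit_of \<Gamma> y" using orbit_of_self[OF \<Gamma> xy(1)] x(2) y(2) by simp
      then have "x \<in> orbit_of (carrier G) y" using \<Gamma>.subset by (auto simp: orbit_of_def)
      then have "orbit_of (carrier G) x = orbit_of (carrier G) y" by (rule orbit_of_eq[OF sub xy(2)])
      moreover have "orbit_of (carrier G) x = A" using orbit_of_eq[OF sub a(1)] x(1) a(2) by blast
      moreover have "orbit_of (carrier G) y = B" using orbit_of_eq[OF sub b(1)] y(1) b(2) by blast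
      ultimately show False using \<open>A \<noteq> B\<close> by simp
    qed
  qed
  finally show "(\<Sum>A\<in>orbit_of (carrier G) ` E. card (orbit_of \<Gamma> ` A)) = card (orbit_of \<Gamma> ` E)" by simp
qed

end

section \<open>Equivariant matchings\<close>

text \<open>
  Think of \<open>RA\<close> and \<open>RY\<close> as orbit equivalence relations of a group acting on \<open>A\<close> and freely on \<open>Y\<close>. Choose a
  representative \<open>r y\<close> in each orbit of \<open>Y\<close> and number the fibre over it arbitrarily; freeness says that
  each \<open>a\<close> has just one translate \<open>t a\<close> in the fibre over the representative, whose number it inherits.
\<close>

lemma invariant_numbering_of_fibres:
  fixes \<pi> :: "'a \<Rightarrow> 'y"
  assumes RA: "equiv A RA" and RY: "equiv Y RY"
    and \<pi>: "\<And>a. a \<in> A \<Longrightarrow> \<pi> a \<in> Y"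
    and compat: "\<And>a b. (a, b) \<in> RA \<Longrightarrow> (\<pi> a, \<pi> b) \<in> RY"
    and free: "\<And>a b. (a, b) \<in> RA \<Longrightarrow> \<pi> a = \<pi> b \<Longrightarrow> a = b"
    and lift: "\<And>a y. a \<in> A \<Longrightarrow> (\<pi> a, y) \<in> RY \<Longrightarrow> \<exists>b. (a, b) \<in> RA \<and> \<pi> b = y"
    and fin: "\<And>y. y \<in> Y \<Longrightarrow> finite {a \<in> A. \<pi> a = y}"
  shows "\<exists>\<nu>. (\<forall>(a, b)\<in>RA. \<nu> a = \<nu> b) \<and>
           (\<forall>y\<in>Y. bij_betw \<nu> {a \<in> A. \<pi> a = y} {..<card {a \<in> A. \<pi> a = y}})"
proof -
  define r where "r y = (SOME z. (y, z) \<in> RY)" for y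
  define f where "f z = (SOME f. bij_betw f {a \<in> A. \<pi> a = z} {..<card {a \<in> A. \<pi> a = z}})" for z
  define t where "t a = (SOME b. (a, b) \<in> RA \<and> \<pi> b = r (\<pi> a))" for a
  have r: "(y, r y) \<in> RY" if "y \<in> Y" for y
    unfolding r_def using equiv_class_self[OF RY that] by (intro someI[of "\<lambda>z. (y, z) \<in> RY"]) simp
  have r_cong: "r y = r y'" if "(y, y') \<in> RY" for y y'
  proof -
    have "(y, z) \<in> RY \<longleftrightarrow> (y', z) \<in> RY" for z
      using equiv_class_eq[OF RY that] by blast
    then show ?thesis by (simp add: r_def)
  qed
  have f: "bij_betw (f z) {a \<in> A. \<pi> a = z} {..<card {a \<in> A. \<pi> a = z}}" if "z \<in> Y" for z
    using ex_bij_betw_finite_nat[OF fin[OF that]] unfolding f_def atLeast0LessThan by (rule someI_ex)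
  have t: "(a, t a) \<in> RA \<and> \<pi> (t a) = r (\<pi> a)" if "a \<in> A" for a
    unfolding t_def using lift[OF that r[OF \<pi>[OF that]]] by (rule someI_ex)
  have RA_A: "a \<in> A" "b \<in> A" if "(a, b) \<in> RA" for a b
    using equiv_type[OF RA] that by auto
  have RA_sym: "(b, a) \<in> RA" if "(a, b) \<in> RA" for a b
    using RA that unfolding equiv_def by (blast dest: symD)
  have RA_trans: "(a, c) \<in> RA" if "(a, b) \<in> RA" "(b, c) \<in> RA" for a b c
    using RA that unfolding equiv_def by (blast dest: transD)
  have t_unique: "b = t a" if "(a, b) \<in> RA" "\<pi> b = r (\<pi> a)" for a b
    using t[OF RA_A(1)[OF that(1)]] RA_trans[OF RA_sym[OF that(1)]] that(2) by (intro free) auto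
  have t_cong: "t a = t b" if ab: "(a, b) \<in> RA" for a b
  proof (rule t_unique)
    show "(b, t a) \<in> RA" 
      by (rule RA_trans[OF RA_sym[OF ab] conjunct1[OF t[OF RA_A(1)[OF ab]]]])
    show "\<pi> (t a) = r (\<pi> b)" using t RA_A(1)[OF ab] r_cong[OF compat[OF ab]] by simp
  qed
  have t_bij: "bij_betw t {a \<in> A. \<pi> a = y} {a \<in> A. \<pi> a = r y}" if y: "y \<in> Y" for y
  proof (rule bij_betwI')
    fix a b assume a: "a \<in> {a \<in> A. \<pi> a = y}" and b: "b \<in> {a \<in> A. \<pi> a = y}"
    show "t a = t b \<longleftrightarrow> a = b"
    proof
      assume eq: "t a = t b"
      have "(a, t b) \<in> RA" using t[of a] a eq by auto
      moreover have "(t b, b) \<in> RA" using t[of b] b RA_sym by auto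
      ultimately have "(a, b) \<in> RA" by (rule RA_trans)
      then show "a = b" using a b by (intro free) auto
    qed simp
    show "t a \<in> {a \<in> A. \<pi> a = r y}" using t[of a] a RA_A(2)[of a "t a"] by auto
  next
    fix c assume c: "c \<in> {a \<in> A. \<pi> a = r y}"
    have "(r y, y) \<in> RY" using r[OF y] RY unfolding equiv_def by (blast dest: symD)
    then obtain b where b: "(c, b) \<in> RA" "\<pi> b = y" using lift[of c y] c by auto
    have "c = t b" using RA_sym[OF b(1)] c b(2) by (intro t_unique) auto
    then show "\<exists>b\<in>{a \<in> A. \<pi> a = y}. c = t b" using b RA_A(2)[OF b(1)] by auto
  qed
  have rY: "r y \<in> Y" if "y \<in> Y" for y
    using equiv_type[OF RY] r[OF that] by auto
  define \<nu> where "\<nu> a = f (r (\<pi> a)) (t a)" for a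
  have "bij_betw \<nu> {a \<in> A. \<pi> a = y} {..<card {a \<in> A. \<pi> a = y}}" if y: "y \<in> Y" for y
  proof -
    have "bij_betw (f (r y) \<circ> t) {a \<in> A. \<pi> a = y} {..<card {a \<in> A. \<pi> a = r y}}"
      using t_bij[OF y] f[OF rY[OF y]] by (rule bij_betw_trans)
    moreover have "card {a \<in> A. \<pi> a = r y} = card {a \<in> A. \<pi> a = y}"
      using bij_betw_same_card[OF t_bij[OF y]] by simp
    ultimately have "bij_betw (f (r y) \<circ> t) {a \<in> A. \<pi> a = y} {..<card {a \<in> A. \<pi> a = y}}"
      by simp
    then show ?thesis
      by (rule bij_betw_cong[THEN iffD1, rotated]) (simp add: \<nu>_def)
  qed
  moreover have "\<nu> a = \<nu> b" if "(a, b) \<in> RA" for a b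
    using that by (simp add: \<nu>_def t_cong r_cong[OF compat])
  ultimately show ?thesis by (intro exI[of _ \<nu>]) blast
qed

text \<open>
  Matching equal numbers in the fibres over \<open>y\<close> and \<open>\<iota> y\<close> is symmetric in \<open>y\<close> and \<open>\<iota> y\<close>, hence an involution,
  and it is equivariant because the numbering is invariant. No choice between \<open>y\<close> and \<open>\<iota> y\<close> is made.
\<close>

lemma equivariant_matching:
  fixes \<pi> :: "'a \<Rightarrow> 'y"
  assumes RA: "equiv A RA" and RY: "equiv Y RY"
    and \<pi>: "\<And>a. a \<in> A \<Longrightarrow> \<pi> a \<in> Y"
    and compat: "\<And>a b. (a, b) \<in> RA \<Longrightarrow> (\<pi> a, \<pi> b) \<in> RY"
    and free: "\<And>a b. (a, b) \<in> RA \<Longrightarrow> \<pi> a = \<pi> b \<Longrightarrow> a = b"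
    and lift: "\<And>a y. a \<in> A \<Longrightarrow> (\<pi> a, y) \<in> RY \<Longrightarrow> \<exists>b. (a, b) \<in> RA \<and> \<pi> b = y"
    and \<iota>: "\<And>y. y \<in> Y \<Longrightarrow> \<iota> y \<in> Y" "\<And>y. y \<in> Y \<Longrightarrow> \<iota> (\<iota> y) = y"
      "\<And>y z. (y, z) \<in> RY \<Longrightarrow> (\<iota> y, \<iota> z) \<in> RY"
    and fin: "\<And>y. y \<in> Y \<Longrightarrow> finite {a \<in> A. \<pi> a = y}"
    and card: "\<And>y. y \<in> Y \<Longrightarrow> card {a \<in> A. \<pi> a = \<iota> y} = card {a \<in> A. \<pi> a = y}"
  shows "\<exists>N. (\<forall>a\<in>A. N a \<in> A \<and> \<pi> (N a) = \<iota> (\<pi> a) \<and> N (N a) = a) \<and>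
             (\<forall>a b. (a, b) \<in> RA \<longrightarrow> (N a, N b) \<in> RA)"
proof -
  obtain \<nu> where \<nu>_inv: "\<forall>(a, b)\<in>RA. \<nu> a = \<nu> b"
    and \<nu>_bij: "\<forall>y\<in>Y. bij_betw \<nu> {a \<in> A. \<pi> a = y} {..<card {a \<in> A. \<pi> a = y}}"
    using invariant_numbering_of_fibres[OF RA RY \<pi> compat free lift fin] by blast
  define N where "N a = inv_into {b \<in> A. \<pi> b = \<iota> (\<pi> a)} \<nu> (\<nu> a)" for a
  have N: "N a \<in> A \<and> \<pi> (N a) = \<iota> (\<pi> a) \<and> \<nu> (N a) = \<nu> a" if a: "a \<in> A" for a
  proof -
    have "\<nu> a \<in> {..<card {b \<in> A. \<pi> b = \<pi> a}}"
      using \<nu>_bij[rule_format, OF \<pi>[OF a]] a by (auto simp: bij_betw_def)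
    then have "\<nu> a \<in> \<nu> ` {b \<in> A. \<pi> b = \<iota> (\<pi> a)}"
      using \<nu>_bij[rule_format, OF \<iota>(1)[OF \<pi>[OF a]]] card[OF \<pi>[OF a]] by (simp add: bij_betw_def)
    from inv_into_into[OF this] f_inv_into_f[OF this] show ?thesis by (simp add: N_def)
  qed
  have unique: "b = c" if "b \<in> A" "c \<in> A" "\<pi> b = \<pi> c" "\<nu> b = \<nu> c" for b c
  proof -
    have "inj_on \<nu> {a \<in> A. \<pi> a = \<pi> c}"
      using \<nu>_bij[rule_format, OF \<pi>[OF that(2)]] by (simp add: bij_betw_def)
    then show ?thesis by (rule inj_onD) (use that in auto)
  qed
  show ?thesis
  proof (intro exI[of _ N] conjI ballI allI impI)
    fix a assume a: "a \<in> A"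
    show "N a \<in> A" "\<pi> (N a) = \<iota> (\<pi> a)" using N[OF a] by auto
    have "N (N a) \<in> A" "\<pi> (N (N a)) = \<iota> (\<iota> (\<pi> a))" "\<nu> (N (N a)) = \<nu> a"
      using N[OF a] N[of "N a"] by auto
    then show "N (N a) = a" using a \<iota>(2)[OF \<pi>[OF a]] by (intro unique) auto
  next
    fix a b assume ab: "(a, b) \<in> RA"
    have A: "a \<in> A" "b \<in> A" using equiv_type[OF RA] ab by auto
    have "(\<pi> (N a), \<pi> (N b)) \<in> RY" using \<iota>(3)[OF compat[OF ab]] N A by simp
    then obtain c where c: "(N a, c) \<in> RA" "\<pi> c = \<pi> (N b)"
      using lift[of "N a" "\<pi> (N b)"] N A by blast
    have "c \<in> A" using equiv_type[OF RA] c by auto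
    moreover have "\<nu> c = \<nu> (N b)" 
      using \<nu>_inv[rule_format, OF c(1)] \<nu>_inv[rule_format, OF ab] N A by simp
    ultimately have "c = N b" using c(2) N[OF A(2)] by (intro unique) auto
    then show "(N a, N b) \<in> RA" using c by simp
  qed
qed

section \<open>Walks and coverings of trees\<close>

locale bidirected_tree_graph = bidirected_digraph T arev
  for T :: "('v, 'e) pre_digraph" and arev :: "'e \<Rightarrow> 'e" +
  assumes connected: "connected T"
    and no_circuit: "\<not> (\<exists>p. cycle p \<and> no_backtracking arev p)"
begin

lemma ex_awalk:
  assumes "u \<in> verts T" "v \<in> verts T" shows "\<exists>p. awalk u p v"
proof -
  have "symmetric T" using sym_arcs by simp
  moreover have "u \<rightarrow>\<^sup>*\<^bsub>mk_symmetric T\<^esub> v"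
    using connected assms by (auto simp: connected_def strongly_connected_def)
  ultimately show ?thesis by (simp add: reachable_mk_symmetric_eq reachable_awalk)
qed

lemma verts_nonempty: "verts T \<noteq> {}"
  using connected by (simp add: connected_def strongly_connected_def)

text \<open>
  A shortest closed subwalk visits no vertex twice, so it is a cycle and has to backtrack.
\<close>

lemma closed_walk_backtracks:
  assumes "awalk u p u" "p \<noteq> []"
  shows "\<exists>q e r. p = q @ [e, arev e] @ r"
  using assms
proof (induction "length p" arbitrary: u p rule: less_induct)
  case less
  show ?case
  proof (cases "distinct (tl (awalk_verts u p))")
    case True
    then have "cycle p" using less.prems unfolding cycle_def by blast
    then have "\<not> no_backtracking arev p" using no_circuit by blast
    then obtain i where i: "Suc i < length p" "p ! Suc i = arev (p ! i)"
      unfolding no_backtracking_def by blast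
    then have "p = take i p @ [p ! i, arev (p ! i)] @ drop (Suc (Suc i)) p"
      using id_take_nth_drop[of i p] Cons_nth_drop_Suc[of "Suc i" p] by simp
    then show ?thesis by blast
  next
    case False
    obtain e p' where p: "p = e # p'" using less.prems by (cases p) auto
    have nd: "awalk (head T e) p' u" "\<not> distinct (awalk_verts (head T e) p')"
      using less.prems(1) False unfolding p by (auto simp: awalk_Cons_iff)
    then obtain q r s w where "p' = q @ r @ s" "0 < length r" "awalk w r w"
      using awalk_not_distinct_decomp[OF nd] by auto
    then obtain q' e' r' where "r = q' @ [e', arev e'] @ r'"
      using less.hyps[of r w] p by auto
    then have "p = (e # q @ q') @ [e', arev e'] @ (r' @ s)"
      using p \<open>p' = q @ r @ s\<close> by simp
    then show ?thesis by blast
  qed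
qed

lemma awalk_without_backtracking:
  assumes "u \<in> verts T" "v \<in> verts T"
  shows "\<exists>p. awalk u p v \<and> \<not> (\<exists>q e r. p = q @ [e, arev e] @ r)"
proof -
  obtain p where p: "awalk u p v" "\<And>q. awalk u q v \<Longrightarrow> length p \<le> length q"
    using ex_awalk[OF assms] ex_has_least_nat[of "\<lambda>p. awalk u p v" _ length] by blast
  have no: "p \<noteq> q @ [e, arev e] @ r" for q e r
  proof
    assume eq: "p = q @ [e, arev e] @ r"
    have "awalk u (q @ r) v"
      using p(1) unfolding eq by (auto simp: awalk_Cons_iff)
    then show False using p(2)[of "q @ r"] eq by simp
  qed
  show ?thesis by (intro exI[of _ p] conjI p(1) notI) (elim exE, erule no[THEN notE])
qed

lemma arc_eqI:
  assumes "e \<in> arcs T" "e' \<in> arcs T" "tail T e = tail T e'" "head T e = head T e'"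
  shows "e = e'"
proof -
  have "awalk (tail T e) [e, arev e'] (tail T e)"
    using assms by (simp add: awalk_Cons_iff awalk_Nil_iff)
  then obtain q a r where "[e, arev e'] = q @ [a, arev a] @ r"
    using closed_walk_backtracks by blast
  then show ?thesis by (cases q) (auto simp: arev_eq_iff)
qed

lemma awalk_rev:
  assumes "awalk u p v" shows "awalk v (rev (map arev p)) u"
  using assms
proof (induction p arbitrary: u)
  case (Cons e p)
  then have e: "e \<in> arcs T" "u = tail T e" "awalk (head T e) p v" by (auto simp: awalk_Cons_iff)
  have "awalk (head T e) [arev e] u" using e by (simp add: awalk_Cons_iff awalk_Nil_iff)
  then show ?case using awalk_appendI[OF Cons.IH[OF e(3)]] by simp
qed (auto simp: awalk_Nil_iff)

text \<open>
  A family of sets \<open>S v\<close> together with bijections \<open>\<tau> e\<close> along the arcs, inverse to each other for inverse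
  arcs, is a covering space of the tree; since closed walks can be contracted by cancelling
  backtracks, transport along walks depends on the end points only and every point lies on a section.
\<close>

context
  fixes \<tau> :: "'e \<Rightarrow> 's \<Rightarrow> 's" and S :: "'v \<Rightarrow> 's set"
  assumes maps: "\<And>e x. e \<in> arcs T \<Longrightarrow> x \<in> S (tail T e) \<Longrightarrow> \<tau> e x \<in> S (head T e)"
    and cancel: "\<And>e x. e \<in> arcs T \<Longrightarrow> x \<in> S (tail T e) \<Longrightarrow> \<tau> (arev e) (\<tau> e x) = x"
begin

lemma transport_maps:
  assumes "awalk u p v" "x \<in> S u" shows "fold \<tau> p x \<in> S v"
  using assms by (induction p arbitrary: u x) (auto simp: awalk_Cons_iff awalk_Nil_iff maps)

lemma transport_closed:
  assumes "awalk u p u" "x \<in> S u" shows "fold \<tau> p x = x"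
  using assms(1)
proof (induction "length p" arbitrary: p rule: less_induct)
  case less
  show ?case
  proof (cases "p = []")
    case False
    then obtain q e r where p: "p = q @ [e, arev e] @ r"
      using closed_walk_backtracks less.prems by blast
    have w: "awalk u q (tail T e)" "e \<in> arcs T" "awalk (tail T e) r u"
      using less.prems unfolding p by (auto simp: awalk_Cons_iff)
    have "fold \<tau> p x = fold \<tau> (q @ r) x"
      using cancel[OF w(2) transport_maps[OF w(1) assms(2)]] p by simp
    also have "\<dots> = x" using w awalk_appendI p by (intro less.hyps) auto
    finally show ?thesis .
  qed simp
qed

lemma transport_rev:
  assumes "awalk u p v" "x \<in> S u" shows "fold \<tau> (rev (map arev p)) (fold \<tau> p x) = x"
  using assms
  by (induction p arbitrary: u x) (auto simp: awalk_Cons_iff awalk_Nil_iff maps cancel)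

lemma transport_unique:
  assumes p: "awalk u p v" and q: "awalk u q v" and x: "x \<in> S u"
  shows "fold \<tau> p x = fold \<tau> q x"
proof -
  let ?r = "rev (map arev p)"
  have r: "awalk v ?r u" using p by (rule awalk_rev)
  have "rev (map arev ?r) = p" by (simp add: rev_map o_def)
  then have "fold \<tau> p (fold \<tau> ?r (fold \<tau> q x)) = fold \<tau> q x"
    using transport_rev[OF r transport_maps[OF q x]] by simp
  moreover have "fold \<tau> ?r (fold \<tau> q x) = x"
    using transport_closed[OF awalk_appendI[OF q r] x] by simp
  ultimately show ?thesis by simp
qed

lemma transport_section:
  assumes v: "v \<in> verts T" and x: "x \<in> S v"
  shows "\<exists>s. s v = x \<and> (\<forall>u\<in>verts T. s u \<in> S u) \<and> (\<forall>e\<in>arcs T. s (head T e) = \<tau> e (s (tail T e)))"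
proof -
  define s where "s u = fold \<tau> (SOME p. awalk v p u) x" for u
  have s: "s u = fold \<tau> p x" if "awalk v p u" for u p
    unfolding s_def using someI[of "\<lambda>p. awalk v p u", OF that] that x by (rule transport_unique)
  show ?thesis
  proof (intro exI[of _ s] conjI ballI)
    show "s v = x" using s[of "[]" v] v by (simp add: awalk_Nil_iff)
    show "s u \<in> S u" if "u \<in> verts T" for u
    proof -
      obtain p where "awalk v p u" using ex_awalk[OF v \<open>u \<in> verts T\<close>] by blast
      then show ?thesis using s transport_maps x by metis
    qed
    show "s (head T e) = \<tau> e (s (tail T e))" if e: "e \<in> arcs T" for e
    proof -
      obtain p where p: "awalk v p (tail T e)" using ex_awalk[OF v tail_in_verts[OF e]] by blast
      have "awalk v (p @ [e]) (head T e)" by (rule awalk_appendI[OF p arc_implies_awalk[OF e]])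
      from s[OF this] s[OF p] show ?thesis by simp
    qed
  qed
qed

end

text \<open>
  A covering of a tree by itself is an isomorphism. If two vertices had the same image, a walk
  between them without backtracking would be mapped to a closed walk; that one backtracks, and
  injectivity on the arcs at a vertex pulls the backtracking back.
\<close>

lemma local_isomorphism_bij:
  assumes fv: "\<And>v. v \<in> verts T \<Longrightarrow> fv v \<in> verts T" and fe: "\<And>e. e \<in> arcs T \<Longrightarrow> fe e \<in> arcs T"
    and tail: "\<And>e. e \<in> arcs T \<Longrightarrow> tail T (fe e) = fv (tail T e)"
    and arev: "\<And>e. e \<in> arcs T \<Longrightarrow> fe (arev e) = arev (fe e)"
    and inj: "\<And>e e'. e \<in> arcs T \<Longrightarrow> e' \<in> arcs T \<Longrightarrow> tail T e = tail T e' \<Longrightarrow> fe e = fe e' \<Longrightarrow> e = e'"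
    and surj: "\<And>v e'. v \<in> verts T \<Longrightarrow> e' \<in> arcs T \<Longrightarrow> tail T e' = fv v \<Longrightarrow>
       \<exists>e\<in>arcs T. tail T e = v \<and> fe e = e'"
  shows "bij_betw fv (verts T) (verts T)" "bij_betw fe (arcs T) (arcs T)"
proof -
  have head: "head T (fe e) = fv (head T e)" if "e \<in> arcs T" for e
    using tail[of "arev e"] arev[OF that] that fe[OF that] by (metis arev_in_arcs tail_arev)
  have walk: "awalk (fv u) (map fe p) (fv v)" if "awalk u p v" for u p v
    using that by (induction p arbitrary: u) (auto simp: awalk_Cons_iff awalk_Nil_iff fv fe tail head)
  have inj_v: "u = v" if uv: "u \<in> verts T" "v \<in> verts T" "fv u = fv v" for u v
  proof (rule ccontr)
    assume "u \<noteq> v"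
    obtain p where p: "awalk u p v" "\<not> (\<exists>q e r. p = q @ [e, arev e] @ r)"
      using awalk_without_backtracking[OF uv(1,2)] by blast
    have "p \<noteq> []" using p(1) \<open>u \<noteq> v\<close> by (auto simp: awalk_Nil_iff)
    then obtain q e r where "map fe p = q @ [e, arev e] @ r"
      using closed_walk_backtracks[of "fv u" "map fe p"] walk[OF p(1)] uv(3) by auto
    then obtain q' a b r' where dec: "p = q' @ [a, b] @ r'" "fe b = arev (fe a)"
      by (auto simp: map_eq_append_conv map_eq_Cons_conv)
    have ab: "a \<in> arcs T" "b \<in> arcs T" "tail T b = head T a"
      using p(1) unfolding dec(1) by (auto simp: awalk_Cons_iff)
    have "b = arev a" by (rule inj) (use ab dec(2) arev in \<open>auto\<close>)
    then have "p = q' @ [a, arev a] @ r'" using dec(1) by simp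
    then have "\<exists>q e r. p = q @ [e, arev e] @ r" by (intro exI)
    then show False using p(2) by contradiction
  qed
  have surj_v: "\<exists>u\<in>verts T. fv u = w" if w: "w \<in> verts T" for w
  proof -
    obtain v where v: "v \<in> verts T" using verts_nonempty by blast
    obtain p where "awalk (fv v) p w" using ex_awalk fv[OF v] w by blast
    then show ?thesis using v
    proof (induction p arbitrary: v)
      case (Cons e p)
      then have e: "e \<in> arcs T" "tail T e = fv v" "awalk (head T e) p w"
        by (auto simp: awalk_Cons_iff)
      then obtain a where a: "a \<in> arcs T" "fe a = e" using surj Cons.prems by blast
      have "awalk (fv (head T a)) p w" using e(3) a head by auto
      then show ?case using Cons.IH[of "head T a"] a(1) by simp
    qed (auto simp: awalk_Nil_iff)
  qed
  show "bij_betw fv (verts T) (verts T)"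
  proof (rule bij_betwI')
    show "\<exists>x\<in>verts T. y = fv x" if "y \<in> verts T" for y using surj_v[OF that] by auto
  qed (use inj_v fv in auto)
  show "bij_betw fe (arcs T) (arcs T)"
  proof (rule bij_betwI')
    fix a b assume ab: "a \<in> arcs T" "b \<in> arcs T"
    show "fe a = fe b \<longleftrightarrow> a = b"
    proof
      assume eq: "fe a = fe b"
      have "fv (tail T a) = fv (tail T b)" using tail[OF ab(1)] tail[OF ab(2)] eq by simp
      then have "tail T a = tail T b" using inj_v ab by simp
      then show "a = b" using inj ab eq by blast
    qed simp
    show "fe a \<in> arcs T" using fe ab by simp
  next
    fix e assume e: "e \<in> arcs T"
    obtain v where "v \<in> verts T" "fv v = tail T e" using surj_v[of "tail T e"] e by auto
    then show "\<exists>a\<in>arcs T. e = fe a" using surj[of v e] e by auto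
  qed
qed

end

section \<open>Groups acting on trees, and balls\<close>

text \<open>
  A tree has no multiple arcs, so the action \<open>\<psi>\<close> on arcs is determined by the action \<open>\<phi>\<close> on vertices, and it
  inherits compatibility with products and with \<open>arev\<close> from it.
\<close>

locale tree_action = bidirected_tree_graph T arev + acting_group G "verts T" \<phi>
  for T :: "('v, 'e) pre_digraph" and arev and G :: "('g, 'm) monoid_scheme" (structure) and \<phi> +
  fixes \<psi> :: "'g \<Rightarrow> 'e \<Rightarrow> 'e"
  assumes arc_closed: "h \<in> carrier G \<Longrightarrow> e \<in> arcs T \<Longrightarrow> \<psi> h e \<in> arcs T"
    and tail_arc: "h \<in> carrier G \<Longrightarrow> e \<in> arcs T \<Longrightarrow> tail T (\<psi> h e) = \<phi> h (tail T e)"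
    and head_arc: "h \<in> carrier G \<Longrightarrow> e \<in> arcs T \<Longrightarrow> head T (\<psi> h e) = \<phi> h (head T e)"
begin

lemma arc_cong:
  assumes "h \<in> carrier G" "k \<in> carrier G" "e \<in> arcs T"
    and "\<phi> h (tail T e) = \<phi> k (tail T e)" "\<phi> h (head T e) = \<phi> k (head T e)"
  shows "\<psi> h e = \<psi> k e"
  using assms by (intro arc_eqI) (simp_all add: arc_closed tail_arc head_arc)

lemma arc_arev: "h \<in> carrier G \<Longrightarrow> e \<in> arcs T \<Longrightarrow> \<psi> h (arev e) = arev (\<psi> h e)"
  by (intro arc_eqI) (simp_all add: arc_closed tail_arc head_arc)

lemma arc_mult:
  "h \<in> carrier G \<Longrightarrow> k \<in> carrier G \<Longrightarrow> e \<in> arcs T \<Longrightarrow> \<psi> (h \<otimes> k) e = \<psi> h (\<psi> k e)"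
  by (intro arc_eqI) (simp_all add: arc_closed tail_arc head_arc composition_rule)

lemma arc_one: "e \<in> arcs T \<Longrightarrow> \<psi> \<one> e = e"
  by (intro arc_eqI) (simp_all add: arc_closed tail_arc head_arc act_one)

lemma arc_inv: "h \<in> carrier G \<Longrightarrow> e \<in> arcs T \<Longrightarrow> \<psi> (inv h) (\<psi> h e) = e"
  by (intro arc_eqI) (simp_all add: arc_closed tail_arc head_arc act_inv)

lemma arc_inv': "h \<in> carrier G \<Longrightarrow> e \<in> arcs T \<Longrightarrow> \<psi> h (\<psi> (inv h) e) = e"
  by (intro arc_eqI) (simp_all add: arc_closed tail_arc head_arc act_inv')

lemma awalk_image:
  assumes "h \<in> carrier G" "awalk u p v"
  shows "awalk (\<phi> h u) (map (\<psi> h) p) (\<phi> h v)"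
  using assms(2) by (induction p arbitrary: u)
    (use assms(1) in \<open>auto simp: awalk_Cons_iff awalk_Nil_iff arc_closed tail_arc head_arc act_closed\<close>)

definition ball_verts :: "nat \<Rightarrow> 'v \<Rightarrow> 'v set" where
  "ball_verts R v = {u. \<exists>p. awalk v p u \<and> length p \<le> R}"

text \<open>
  The end points of all walks of length exactly \<open>r\<close>; backtracking is allowed, so this is not quite the
  metric sphere, but it satisfies a simple recursion and still has at most \<open>d ^ r\<close> elements.
\<close>

definition sphere_verts :: "nat \<Rightarrow> 'v \<Rightarrow> 'v set" where
  "sphere_verts r v = {u. \<exists>p. awalk v p u \<and> length p = r}"

lemma ball_verts_subset: "ball_verts R v \<subseteq> verts T"
  by (auto simp: ball_verts_def)

lemma centre_in_ball: "v \<in> verts T \<Longrightarrow> v \<in> ball_verts R v"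
  by (auto simp: ball_verts_def awalk_Nil_iff intro!: exI[of _ "[]"])

lemma ball_verts_image:
  assumes "h \<in> carrier G" "v \<in> verts T"
  shows "ball_verts R (\<phi> h v) = \<phi> h ` ball_verts R v"
proof (intro equalityI subsetI)
  fix u assume "u \<in> \<phi> h ` ball_verts R v"
  then obtain w p where w: "awalk v p w" "length p \<le> R" "u = \<phi> h w"
    by (auto simp: ball_verts_def)
  then show "u \<in> ball_verts R (\<phi> h v)"
    using awalk_image[OF assms(1) w(1)] unfolding ball_verts_def by (auto intro!: exI[of _ "map (\<psi> h) p"])
next
  fix u assume "u \<in> ball_verts R (\<phi> h v)"
  then obtain p where p: "awalk (\<phi> h v) p u" "length p \<le> R" by (auto simp: ball_verts_def)
  have "awalk v (map (\<psi> (inv h)) p) (\<phi> (inv h) u)"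
    using awalk_image[OF inv_closed[OF assms(1)] p(1)] act_inv[OF assms] by simp
  then have "\<phi> (inv h) u \<in> ball_verts R v"
    using p(2) unfolding ball_verts_def by (auto intro!: exI[of _ "map (\<psi> (inv h)) p"])
  moreover have "u = \<phi> h (\<phi> (inv h) u)" using act_inv'[OF assms(1)] p(1) by auto
  ultimately show "u \<in> \<phi> h ` ball_verts R v" by blast
qed

lemma sphere_verts_0: "v \<in> verts T \<Longrightarrow> sphere_verts 0 v = {v}"
  by (auto simp: sphere_verts_def awalk_Nil_iff)

lemma sphere_verts_subset: "sphere_verts r v \<subseteq> verts T"
  by (auto simp: sphere_verts_def)

lemma sphere_verts_Suc:
  "sphere_verts (Suc r) v = (\<Union>u\<in>sphere_verts r v. head T ` out_arcs T u)"
proof (intro equalityI subsetI)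
  fix w assume "w \<in> sphere_verts (Suc r) v"
  then obtain p where p: "awalk v p w" "length p = Suc r" by (auto simp: sphere_verts_def)
  then obtain q e where q: "p = q @ [e]" by (metis length_Suc_conv_rev)
  have "awalk v q (tail T e)" "e \<in> arcs T" "w = head T e"
    using p(1) unfolding q by (auto simp: awalk_Cons_iff awalk_Nil_iff)
  then show "w \<in> (\<Union>u\<in>sphere_verts r v. head T ` out_arcs T u)"
    using p(2) q by (auto simp: sphere_verts_def)
next
  fix w assume "w \<in> (\<Union>u\<in>sphere_verts r v. head T ` out_arcs T u)"
  then obtain p e where p: "awalk v p (tail T e)" "length p = r" "e \<in> arcs T" "w = head T e"
    by (auto simp: sphere_verts_def)
  then have "awalk v (p @ [e]) w" using awalk_appendI[OF p(1) arc_implies_awalk[OF p(3)]] by simp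
  then show "w \<in> sphere_verts (Suc r) v"
    using p(2) unfolding sphere_verts_def by (auto intro!: exI[of _ "p @ [e]"])
qed

lemma ball_verts_eq_spheres: "ball_verts R v = (\<Union>r\<le>R. sphere_verts r v)"
  by (auto simp: ball_verts_def sphere_verts_def)

text \<open>
  Add the neighbours of one vertex \<open>x\<close> of \<open>S\<close> after the other: what fixes \<open>x\<close> permutes the at most \<open>d\<close>
  neighbours of \<open>x\<close>, which costs a factor dividing \<open>d!\<close>.
\<close>

lemma num_ext_neighbours_dvd:
  assumes deg: "\<And>u. u \<in> verts T \<Longrightarrow> finite (out_arcs T u) \<and> out_degree T u \<le> d"
    and "finite S" "S \<subseteq> U" "U \<subseteq> verts T"
  shows "num_ext U (U \<union> (\<Union>u\<in>S. head T ` out_arcs T u)) dvd fact d ^ card S"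
  using assms(2,3)
proof (induction S rule: finite_induct)
  case empty
  then show ?case using num_ext_dvd_fact[of U "{}"] assms(4) by simp
next
  case (insert x S)
  let ?W = "U \<union> (\<Union>u\<in>S. head T ` out_arcs T u)" and ?M = "head T ` out_arcs T x"
  have x: "x \<in> U" "x \<in> verts T" using insert.prems assms(4) by auto
  have W: "?W \<subseteq> verts T" "?M \<subseteq> verts T" using assms(4) by auto
  have "card ?M \<le> d"
    using card_image_le[of "out_arcs T x" "head T"] deg[OF x(2)] by (simp add: out_degree_def)
  have "num_ext ?W (?W \<union> ?M) dvd fact (card ?M)"
  proof (rule num_ext_dvd_fact)
    fix k m assume k: "k \<in> fixer ?W" and m: "m \<in> ?M"
    obtain e where e: "e \<in> arcs T" "tail T e = x" "m = head T e" using m by auto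
    have "\<phi> k x = x" using k x by (auto simp: fixer_def)
    then have "\<psi> k e \<in> out_arcs T x" "\<phi> k m = head T (\<psi> k e)"
      using e fixer_carrier[OF k] by (auto simp: arc_closed tail_arc head_arc)
    then show "\<phi> k m \<in> ?M" by blast
  qed (use W deg[OF x(2)] in auto)
  also have "fact (card ?M) dvd (fact d :: nat)" using \<open>card ?M \<le> d\<close> by (rule fact_dvd)
  finally have 1: "num_ext ?W (?W \<union> ?M) dvd fact d" .
  have 2: "num_ext U ?W dvd fact d ^ card S" using insert by auto
  have pos: "num_ext ?W (?W \<union> ?M) > 0" "num_ext U ?W > 0"
    using 1 2 by (auto intro!: Nat.gr0I)
  have "num_ext U (?W \<union> ?M) = num_ext ?W (?W \<union> ?M) * num_ext U ?W"
    by (intro num_ext_mult) (use W pos in auto)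
  also have "\<dots> dvd fact d * fact d ^ card S" using 1 2 by (rule mult_dvd_mono)
  finally show ?case using insert.hyps by (simp add: Un_ac)
qed

lemma card_sphere_le:
  assumes deg: "\<And>u. u \<in> verts T \<Longrightarrow> finite (out_arcs T u) \<and> out_degree T u \<le> d"
    and v: "v \<in> verts T"
  shows "finite (sphere_verts r v) \<and> card (sphere_verts r v) \<le> d ^ r"
proof (induction r)
  case 0
  show ?case using v by (simp add: sphere_verts_0)
next
  case (Suc r)
  have fin: "finite (sphere_verts r v)" using Suc by simp
  have h: "finite (head T ` out_arcs T u) \<and> card (head T ` out_arcs T u) \<le> d"
    if "u \<in> sphere_verts r v" for u
    using deg[of u] that sphere_verts_subset card_image_le[of "out_arcs T u" "head T"]
    by (fastforce simp: out_degree_def)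
  have "card (sphere_verts (Suc r) v) \<le> (\<Sum>u\<in>sphere_verts r v. card (head T ` out_arcs T u))"
    unfolding sphere_verts_Suc by (rule card_UN_le[OF fin])
  also have "\<dots> \<le> (\<Sum>u\<in>sphere_verts r v. d)" using h by (intro sum_mono) auto
  also have "\<dots> \<le> d ^ Suc r" using Suc by simp
  finally show ?case using fin h by (auto simp: sphere_verts_Suc)
qed

lemma num_ext_ball_dvd:
  assumes deg: "\<And>u. u \<in> verts T \<Longrightarrow> finite (out_arcs T u) \<and> out_degree T u \<le> d"
    and v: "v \<in> verts T"
  shows "num_ext {v} (ball_verts R v) dvd fact d ^ (\<Sum>r<R. d ^ r)"
proof (induction R)
  case 0
  show ?case
    using v num_ext_dvd_fact[of "{v}" "{}"] by (simp add: ball_verts_eq_spheres sphere_verts_0)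
next
  case (Suc R)
  let ?B = "ball_verts R v" and ?S = "sphere_verts R v"
  have eq: "ball_verts (Suc R) v = ?B \<union> (\<Union>u\<in>?S. head T ` out_arcs T u)"
    by (simp add: ball_verts_eq_spheres atMost_Suc flip: sphere_verts_Suc) blast
  have "num_ext ?B (ball_verts (Suc R) v) dvd fact d ^ card ?S"
    unfolding eq using card_sphere_le[OF deg v] ball_verts_subset
    by (intro num_ext_neighbours_dvd[OF deg]) (auto simp: ball_verts_eq_spheres)
  also have "\<dots> dvd fact d ^ (d ^ R)"
    using card_sphere_le[OF deg v] by (intro le_imp_power_dvd) auto
  finally have 1: "num_ext ?B (ball_verts (Suc R) v) dvd fact d ^ (d ^ R)" .
  have pos: "num_ext ?B (ball_verts (Suc R) v) > 0" "num_ext {v} ?B > 0"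
    using 1 Suc by (auto intro!: Nat.gr0I)
  have "num_ext {v} (ball_verts (Suc R) v) = num_ext ?B (ball_verts (Suc R) v) * num_ext {v} ?B"
    by (rule num_ext_mult[OF _ _ _ pos(2,1)])
      (use centre_in_ball[OF v] ball_verts_subset eq in auto)
  also have "\<dots> dvd fact d ^ (d ^ R) * fact d ^ (\<Sum>r<R. d ^ r)" using 1 Suc by (rule mult_dvd_mono)
  finally show ?case by (simp add: power_add mult.commute)
qed

end

section \<open>Gluing local maps along arcs\<close>

context tree_action begin

text \<open>
  The set on which local maps at the two ends of \<open>e\<close> will be required to agree. It contains both ends as
  soon as \<open>R\<close> is positive.
\<close>

definition edge_nbhd :: "nat \<Rightarrow> 'e \<Rightarrow> 'v set" where
  "edge_nbhd R e = ball_verts R (tail T e) \<inter> ball_verts R (head T e)"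

text \<open>
  Over each arc \<open>e\<close> lie the states \<open>(e, f, i)\<close>, where \<open>f\<close> is the restriction of a group element to a set \<open>U e\<close>
  and the index \<open>i < w e\<close> provides \<open>w e\<close> copies of it. The group \<open>\<Gamma>\<^sub>1 \<times> \<Gamma>\<^sub>2\<close> acts on the states: \<open>(\<gamma>, \<delta>)\<close> moves
  the place by \<open>\<gamma>\<close> and replaces \<open>f\<close> by \<open>\<delta> \<circ> f \<circ> inv \<gamma>\<close>; \<open>state_rel\<close> is the orbit relation of this action.
\<close>

definition local_maps :: "'v set \<Rightarrow> ('v \<Rightarrow> 'v) set" where
  "local_maps U = (\<lambda>h. restrict (\<phi> h) U) ` carrier G"

definition states :: "('e \<Rightarrow> 'v set) \<Rightarrow> ('e \<Rightarrow> nat) \<Rightarrow> ('e \<times> ('v \<Rightarrow> 'v) \<times> nat) set" where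
  "states U w = {(e, f, i). e \<in> arcs T \<and> f \<in> local_maps (U e) \<and> i < w e}"

definition state_rel ::
  "'g set \<Rightarrow> 'g set \<Rightarrow> ('e \<Rightarrow> 'v set) \<Rightarrow> ('e \<Rightarrow> nat) \<Rightarrow> (('e \<times> ('v \<Rightarrow> 'v) \<times> nat) \<times> ('e \<times> ('v \<Rightarrow> 'v) \<times> nat)) set" where
  "state_rel \<Gamma>\<^sub>1 \<Gamma>\<^sub>2 U w =
     {((e, restrict (\<phi> h) (U e), i), (\<psi> \<gamma> e, restrict (\<phi> (\<delta> \<otimes> h \<otimes> inv \<gamma>)) (U (\<psi> \<gamma> e)), i)) | e h i \<gamma> \<delta>.
        e \<in> arcs T \<and> h \<in> carrier G \<and> i < w e \<and> \<gamma> \<in> \<Gamma>\<^sub>1 \<and> \<delta> \<in> \<Gamma>\<^sub>2}"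

lemma translate_apply:
  assumes "h \<in> carrier G" "\<gamma> \<in> carrier G" "\<delta> \<in> carrier G" "u \<in> verts T"
  shows "\<phi> (\<delta> \<otimes> h \<otimes> inv \<gamma>) (\<phi> \<gamma> u) = \<phi> \<delta> (\<phi> h u)"
  using assms by (simp add: composition_rule act_closed act_inv)

lemma translate_cong:
  assumes "h \<in> carrier G" "h' \<in> carrier G" "\<gamma> \<in> carrier G" "\<delta> \<in> carrier G" "U \<subseteq> verts T"
    and "restrict (\<phi> h) U = restrict (\<phi> h') U"
  shows "restrict (\<phi> (\<delta> \<otimes> h \<otimes> inv \<gamma>)) (\<phi> \<gamma> ` U) = restrict (\<phi> (\<delta> \<otimes> h' \<otimes> inv \<gamma>)) (\<phi> \<gamma> ` U)"
proof (rule restrict_ext)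
  fix x assume "x \<in> \<phi> \<gamma> ` U"
  then obtain u where u: "u \<in> U" "x = \<phi> \<gamma> u" "u \<in> verts T" using assms(5) by blast
  then have "\<phi> h u = \<phi> h' u" using assms(6) by (simp add: restrict_eq_iff)
  then show "\<phi> (\<delta> \<otimes> h \<otimes> inv \<gamma>) x = \<phi> (\<delta> \<otimes> h' \<otimes> inv \<gamma>) x"
    using assms u by (simp add: translate_apply)
qed

lemma translate_mult:
  assumes "h \<in> carrier G" "\<gamma> \<in> carrier G" "\<delta> \<in> carrier G" "\<gamma>' \<in> carrier G" "\<delta>' \<in> carrier G"
  shows "\<delta>' \<otimes> (\<delta> \<otimes> h \<otimes> inv \<gamma>) \<otimes> inv \<gamma>' = (\<delta>' \<otimes> \<delta>) \<otimes> h \<otimes> inv (\<gamma>' \<otimes> \<gamma>)"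
  using assms by (simp add: m_assoc inv_mult_group)

lemma equiv_state_rel:
  assumes \<Gamma>\<^sub>1: "subgroup \<Gamma>\<^sub>1 G" and \<Gamma>\<^sub>2: "subgroup \<Gamma>\<^sub>2 G"
    and U: "\<And>e. e \<in> arcs T \<Longrightarrow> U e \<subseteq> verts T"
    and U_image: "\<And>h e. h \<in> carrier G \<Longrightarrow> e \<in> arcs T \<Longrightarrow> U (\<psi> h e) = \<phi> h ` U e"
    and w: "\<And>h e. h \<in> carrier G \<Longrightarrow> e \<in> arcs T \<Longrightarrow> w (\<psi> h e) = w e"
  shows "equiv (states U w) (state_rel \<Gamma>\<^sub>1 \<Gamma>\<^sub>2 U w)"
proof (rule equivI)
  interpret \<Gamma>\<^sub>1: subgroup \<Gamma>\<^sub>1 G by fact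
  interpret \<Gamma>\<^sub>2: subgroup \<Gamma>\<^sub>2 G by fact
  let ?R = "state_rel \<Gamma>\<^sub>1 \<Gamma>\<^sub>2 U w"
  have intro_rel: "((e, restrict (\<phi> h) (U e), i), (\<psi> \<gamma> e, restrict (\<phi> (\<delta> \<otimes> h \<otimes> inv \<gamma>)) (U (\<psi> \<gamma> e)), i)) \<in> ?R"
    if "e \<in> arcs T" "h \<in> carrier G" "i < w e" "\<gamma> \<in> \<Gamma>\<^sub>1" "\<delta> \<in> \<Gamma>\<^sub>2" for e h i \<gamma> \<delta>
    using that unfolding state_rel_def by blast
  show "?R \<subseteq> states U w \<times> states U w"
    unfolding state_rel_def states_def local_maps_def
    by (auto simp: w arc_closed intro!: imageI)
  show "refl_on (states U w) ?R"
  proof (rule refl_onI)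
    fix a assume "a \<in> states U w"
    then obtain e h i where a: "a = (e, restrict (\<phi> h) (U e), i)" "e \<in> arcs T" "h \<in> carrier G" "i < w e"
      unfolding states_def local_maps_def by auto
    show "(a, a) \<in> ?R"
      using intro_rel[OF a(2,3,4) \<Gamma>\<^sub>1.one_closed \<Gamma>\<^sub>2.one_closed] a by (simp add: arc_one)
  qed
  show "sym ?R"
  proof (rule symI)
    fix a b assume "(a, b) \<in> ?R"
    then obtain e h i \<gamma> \<delta> where *: "e \<in> arcs T" "h \<in> carrier G" "i < w e" "\<gamma> \<in> \<Gamma>\<^sub>1" "\<delta> \<in> \<Gamma>\<^sub>2"
      and a: "a = (e, restrict (\<phi> h) (U e), i)"
      and b: "b = (\<psi> \<gamma> e, restrict (\<phi> (\<delta> \<otimes> h \<otimes> inv \<gamma>)) (U (\<psi> \<gamma> e)), i)"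
      unfolding state_rel_def by blast
    have "\<psi> (inv \<gamma>) (\<psi> \<gamma> e) = e" using * by (simp add: arc_one flip: arc_mult)
    moreover have "inv \<delta> \<otimes> (\<delta> \<otimes> h \<otimes> inv \<gamma>) \<otimes> inv (inv \<gamma>) = h"
      using * by (subst translate_mult) auto
    moreover have "\<delta> \<otimes> h \<otimes> inv \<gamma> \<in> carrier G" "\<psi> \<gamma> e \<in> arcs T" "i < w (\<psi> \<gamma> e)"
      using * by (auto simp: arc_closed w)
    ultimately show "(b, a) \<in> ?R"
      using intro_rel[of "\<psi> \<gamma> e" "\<delta> \<otimes> h \<otimes> inv \<gamma>" i "inv \<gamma>" "inv \<delta>"] * a b by simp
  qed
  show "trans ?R"
  proof (rule transI)
    fix a b c assume "(a, b) \<in> ?R" "(b, c) \<in> ?R"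
    then obtain e h i \<gamma> \<delta> e' h' i' \<gamma>' \<delta>' where
      1: "e \<in> arcs T" "h \<in> carrier G" "i < w e" "\<gamma> \<in> \<Gamma>\<^sub>1" "\<delta> \<in> \<Gamma>\<^sub>2" and
      a: "a = (e, restrict (\<phi> h) (U e), i)" and
      b: "b = (\<psi> \<gamma> e, restrict (\<phi> (\<delta> \<otimes> h \<otimes> inv \<gamma>)) (U (\<psi> \<gamma> e)), i)" and
      2: "e' \<in> arcs T" "h' \<in> carrier G" "i' < w e'" "\<gamma>' \<in> \<Gamma>\<^sub>1" "\<delta>' \<in> \<Gamma>\<^sub>2" and
      b': "b = (e', restrict (\<phi> h') (U e'), i')" and
      c: "c = (\<psi> \<gamma>' e', restrict (\<phi> (\<delta>' \<otimes> h' \<otimes> inv \<gamma>')) (U (\<psi> \<gamma>' e')), i')"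
      unfolding state_rel_def by blast
    have e': "e' = \<psi> \<gamma> e" "i' = i" and
      h': "restrict (\<phi> h') (U e') = restrict (\<phi> (\<delta> \<otimes> h \<otimes> inv \<gamma>)) (U e')" using b b' by auto
    have "restrict (\<phi> (\<delta>' \<otimes> h' \<otimes> inv \<gamma>')) (U (\<psi> \<gamma>' e'))
        = restrict (\<phi> (\<delta>' \<otimes> (\<delta> \<otimes> h \<otimes> inv \<gamma>) \<otimes> inv \<gamma>')) (U (\<psi> \<gamma>' e'))"
      unfolding U_image[OF \<Gamma>\<^sub>1.mem_carrier[OF 2(4)] 2(1)]
      by (rule translate_cong[OF _ _ _ _ U[OF 2(1)] h']) (use 1 2 in auto)
    moreover have "\<psi> \<gamma>' e' = \<psi> (\<gamma>' \<otimes> \<gamma>) e" using 1 2 e' by (simp add: arc_mult)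
    moreover have "\<delta>' \<otimes> (\<delta> \<otimes> h \<otimes> inv \<gamma>) \<otimes> inv \<gamma>' = (\<delta>' \<otimes> \<delta>) \<otimes> h \<otimes> inv (\<gamma>' \<otimes> \<gamma>)"
      using 1 2 by (intro translate_mult) auto
    ultimately show "(a, c) \<in> ?R"
      using intro_rel[OF 1(1,2,3) \<Gamma>\<^sub>1.m_closed[OF 2(4) 1(4)] \<Gamma>\<^sub>2.m_closed[OF 2(5) 1(5)]] a c e'(2) by simp
  qed
qed

lemma edge_nbhd_arev: "e \<in> arcs T \<Longrightarrow> edge_nbhd R (arev e) = edge_nbhd R e"
  by (auto simp: edge_nbhd_def)

lemma edge_nbhd_subset: "edge_nbhd R e \<subseteq> ball_verts R (tail T e)" "edge_nbhd R e \<subseteq> verts T"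
  using ball_verts_subset by (auto simp: edge_nbhd_def)

lemma edge_nbhd_image:
  assumes "h \<in> carrier G" "e \<in> arcs T"
  shows "edge_nbhd R (\<psi> h e) = \<phi> h ` edge_nbhd R e"
proof -
  have "inj_on (\<phi> h) (verts T)" using assms(1) by (rule inj_prop)
  then have "\<phi> h ` edge_nbhd R e = \<phi> h ` ball_verts R (tail T e) \<inter> \<phi> h ` ball_verts R (head T e)"
    unfolding edge_nbhd_def by (rule inj_on_image_Int) (use ball_verts_subset in auto)
  then show ?thesis
    using assms by (simp add: edge_nbhd_def tail_arc head_arc ball_verts_image)
qed

lemma ends_in_edge_nbhd:
  assumes "R \<ge> 1" "e \<in> arcs T"
  shows "tail T e \<in> edge_nbhd R e" "head T e \<in> edge_nbhd R e"
proof -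
  have "head T e \<in> ball_verts R (tail T e)"
    using assms arc_implies_awalk[OF assms(2)] unfolding ball_verts_def
    by (auto intro!: exI[of _ "[e]"])
  moreover have "tail T e \<in> ball_verts R (head T e)"
    using assms arc_implies_awalk[OF arev_in_arcs[OF assms(2)]] unfolding ball_verts_def
    by (auto intro!: exI[of _ "[arev e]"])
  ultimately show "tail T e \<in> edge_nbhd R e" "head T e \<in> edge_nbhd R e"
    using assms by (auto simp: edge_nbhd_def centre_in_ball)
qed

end

text \<open>
  A state at a vertex \<open>v\<close> is a restriction of a group element to the \<open>R\<close>-ball around \<open>v\<close> with an index below
  \<open>w v\<close>. States at the ends of an arc \<open>e\<close> can be glued if they agree on \<open>edge_nbhd R e\<close>. The hypothesis
  \<open>balance\<close> says that every partial map on \<open>edge_nbhd R e\<close> is continued by the same number of states at the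
  tail and at the head of \<open>e\<close>, so that all states can be glued along \<open>e\<close> in pairs.
\<close>

locale gluing = tree_action T arev G \<phi> \<psi>
  for T :: "('v, 'e) pre_digraph" and arev and G :: "('g, 'm) monoid_scheme" (structure) and \<phi> \<psi> +
  fixes \<Gamma>\<^sub>1 \<Gamma>\<^sub>2 :: "'g set" and R :: nat and w :: "'v \<Rightarrow> nat"
  assumes \<Gamma>\<^sub>1: "subgroup \<Gamma>\<^sub>1 G" and \<Gamma>\<^sub>2: "subgroup \<Gamma>\<^sub>2 G"
    and free\<^sub>1: "semiregular \<Gamma>\<^sub>1" and free\<^sub>2: "semiregular \<Gamma>\<^sub>2"
    and R_pos: "R \<ge> 1"
    and w_pos: "v \<in> verts T \<Longrightarrow> w v > 0"
    and w_image: "h \<in> carrier G \<Longrightarrow> v \<in> verts T \<Longrightarrow> w (\<phi> h v) = w v"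
    and ext_pos: "e \<in> arcs T \<Longrightarrow> num_ext (edge_nbhd R e) (ball_verts R (tail T e)) > 0"
    and balance: "e \<in> arcs T \<Longrightarrow>
      w (tail T e) * num_ext (edge_nbhd R e) (ball_verts R (tail T e)) =
      w (head T e) * num_ext (edge_nbhd R e) (ball_verts R (head T e))"
begin

sublocale \<Gamma>\<^sub>1: subgroup \<Gamma>\<^sub>1 G by (rule \<Gamma>\<^sub>1)
sublocale \<Gamma>\<^sub>2: subgroup \<Gamma>\<^sub>2 G by (rule \<Gamma>\<^sub>2)

abbreviation tail_ball :: "'e \<Rightarrow> 'v set" where
  "tail_ball e \<equiv> ball_verts R (tail T e)"

text \<open>
  A flag is an arc with a state at its tail; its germ is what remains visible from the head. Germs are
  states with a single copy, of index 0.
\<close>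

abbreviation flags :: "('e \<times> ('v \<Rightarrow> 'v) \<times> nat) set" where
  "flags \<equiv> states tail_ball (\<lambda>e. w (tail T e))"

abbreviation flag_rel where
  "flag_rel \<equiv> state_rel \<Gamma>\<^sub>1 \<Gamma>\<^sub>2 tail_ball (\<lambda>e. w (tail T e))"

abbreviation germs :: "('e \<times> ('v \<Rightarrow> 'v) \<times> nat) set" where
  "germs \<equiv> states (edge_nbhd R) (\<lambda>e. 1)"

abbreviation germ_rel where
  "germ_rel \<equiv> state_rel \<Gamma>\<^sub>1 \<Gamma>\<^sub>2 (edge_nbhd R) (\<lambda>e. 1)"

definition germ :: "'e \<times> ('v \<Rightarrow> 'v) \<times> nat \<Rightarrow> 'e \<times> ('v \<Rightarrow> 'v) \<times> nat" where
  "germ = (\<lambda>(e, f, i). (e, restrict f (edge_nbhd R e), 0))"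

definition reverse :: "'e \<times> ('v \<Rightarrow> 'v) \<times> nat \<Rightarrow> 'e \<times> ('v \<Rightarrow> 'v) \<times> nat" where
  "reverse = (\<lambda>(e, f, i). (arev e, f, i))"

lemma germ_flag:
  "germ (e, restrict (\<phi> h) (tail_ball e), i) = (e, restrict (\<phi> h) (edge_nbhd R e), 0)"
  using edge_nbhd_subset(1) by (simp add: germ_def restrict_restrict Int_absorb1)

lemma flag_relE:
  assumes "(a, b) \<in> flag_rel"
  obtains e h i \<gamma> \<delta> where "e \<in> arcs T" "h \<in> carrier G" "i < w (tail T e)" "\<gamma> \<in> \<Gamma>\<^sub>1" "\<delta> \<in> \<Gamma>\<^sub>2"
    "a = (e, restrict (\<phi> h) (tail_ball e), i)"
    "b = (\<psi> \<gamma> e, restrict (\<phi> (\<delta> \<otimes> h \<otimes> inv \<gamma>)) (tail_ball (\<psi> \<gamma> e)), i)"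
  using assms unfolding state_rel_def by blast

lemma germ_relE:
  assumes "(a, b) \<in> germ_rel"
  obtains e h \<gamma> \<delta> where "e \<in> arcs T" "h \<in> carrier G" "\<gamma> \<in> \<Gamma>\<^sub>1" "\<delta> \<in> \<Gamma>\<^sub>2"
    "a = (e, restrict (\<phi> h) (edge_nbhd R e), 0)"
    "b = (\<psi> \<gamma> e, restrict (\<phi> (\<delta> \<otimes> h \<otimes> inv \<gamma>)) (edge_nbhd R (\<psi> \<gamma> e)), 0)"
  using assms unfolding state_rel_def by blast

lemma flag_relI:
  assumes "e \<in> arcs T" "h \<in> carrier G" "i < w (tail T e)" "\<gamma> \<in> \<Gamma>\<^sub>1" "\<delta> \<in> \<Gamma>\<^sub>2"
  shows "((e, restrict (\<phi> h) (tail_ball e), i),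
    (\<psi> \<gamma> e, restrict (\<phi> (\<delta> \<otimes> h \<otimes> inv \<gamma>)) (tail_ball (\<psi> \<gamma> e)), i)) \<in> flag_rel"
  using assms unfolding state_rel_def by blast

lemma germ_relI:
  assumes "e \<in> arcs T" "h \<in> carrier G" "\<gamma> \<in> \<Gamma>\<^sub>1" "\<delta> \<in> \<Gamma>\<^sub>2"
  shows "((e, restrict (\<phi> h) (edge_nbhd R e), 0),
    (\<psi> \<gamma> e, restrict (\<phi> (\<delta> \<otimes> h \<otimes> inv \<gamma>)) (edge_nbhd R (\<psi> \<gamma> e)), 0)) \<in> germ_rel"
  using assms unfolding state_rel_def by blast

lemma flagE:
  assumes "a \<in> flags"
  obtains e h i where "e \<in> arcs T" "h \<in> carrier G" "i < w (tail T e)"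
    "a = (e, restrict (\<phi> h) (tail_ball e), i)"
  using assms unfolding states_def local_maps_def by blast

lemma germE:
  assumes "a \<in> germs"
  obtains e h where "e \<in> arcs T" "h \<in> carrier G" "a = (e, restrict (\<phi> h) (edge_nbhd R e), 0)"
  using assms unfolding states_def local_maps_def by blast

text \<open>
  The action of \<open>\<Gamma>\<^sub>1 \<times> \<Gamma>\<^sub>2\<close> on germs is free: \<open>\<gamma>\<close> is trivial because it fixes the arc, then \<open>\<delta>\<close> because it fixes
  the image of its tail.
\<close>

lemma germ_free:
  assumes "\<gamma> \<in> \<Gamma>\<^sub>1" "\<delta> \<in> \<Gamma>\<^sub>2" "e \<in> arcs T" "h \<in> carrier G"
    and "\<psi> \<gamma> e = e" "\<phi> (\<delta> \<otimes> h \<otimes> inv \<gamma>) (tail T e) = \<phi> h (tail T e)"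
  shows "\<gamma> = \<one> \<and> \<delta> = \<one>"
proof -
  have \<gamma>: "\<gamma> = \<one>"
    using semiregularD[OF free\<^sub>1 assms(1), of "tail T e"] tail_arc[of \<gamma> e] assms by simp
  have "\<phi> \<delta> (\<phi> h (tail T e)) = \<phi> h (tail T e)"
    using assms unfolding \<gamma> by (simp add: composition_rule)
  from semiregularD[OF free\<^sub>2 assms(2) _ this] show ?thesis using assms \<gamma> by (simp add: act_closed)
qed

lemma card_flags_over_germ:
  assumes e: "e \<in> arcs T" and h: "h \<in> carrier G"
  shows "finite {a \<in> flags. germ a = (e, restrict (\<phi> h) (edge_nbhd R e), 0)}"
    and "card {a \<in> flags. germ a = (e, restrict (\<phi> h) (edge_nbhd R e), 0)} =
      num_ext (edge_nbhd R e) (tail_ball e) * w (tail T e)"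
proof -
  let ?F = "(\<lambda>k. restrict (\<phi> k) (tail_ball e)) ` {k \<in> carrier G. \<forall>u\<in>edge_nbhd R e. \<phi> k u = \<phi> h u}"
  have eq: "{a \<in> flags. germ a = (e, restrict (\<phi> h) (edge_nbhd R e), 0)} = {e} \<times> ?F \<times> {..<w (tail T e)}"
  proof (intro equalityI subsetI)
    fix a assume a: "a \<in> {a \<in> flags. germ a = (e, restrict (\<phi> h) (edge_nbhd R e), 0)}"
    then obtain e' k i where "e' \<in> arcs T" "k \<in> carrier G" "i < w (tail T e')"
      "a = (e', restrict (\<phi> k) (tail_ball e'), i)" by (auto elim: flagE)
    then show "a \<in> {e} \<times> ?F \<times> {..<w (tail T e)}"
      using a by (auto simp: germ_flag restrict_eq_iff)
  next
    fix a assume "a \<in> {e} \<times> ?F \<times> {..<w (tail T e)}"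
    then obtain k i where k: "k \<in> carrier G" "\<forall>u\<in>edge_nbhd R e. \<phi> k u = \<phi> h u" "i < w (tail T e)"
      "a = (e, restrict (\<phi> k) (tail_ball e), i)" by blast
    have "a \<in> flags" using k e unfolding states_def local_maps_def by blast
    then show "a \<in> {a \<in> flags. germ a = (e, restrict (\<phi> h) (edge_nbhd R e), 0)}"
      using k by (simp add: germ_flag restrict_eq_iff)
  qed
  have F: "card ?F = num_ext (edge_nbhd R e) (tail_ball e)"
    using card_extensions[of "{}" "edge_nbhd R e" "tail_ball e" h] h edge_nbhd_subset ball_verts_subset
    by simp
  then have "finite ?F" using ext_pos[OF e] by (intro card_ge_0_finite) simp
  then show "finite {a \<in> flags. germ a = (e, restrict (\<phi> h) (edge_nbhd R e), 0)}"
    unfolding eq by simp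
  show "card {a \<in> flags. germ a = (e, restrict (\<phi> h) (edge_nbhd R e), 0)} =
      num_ext (edge_nbhd R e) (tail_ball e) * w (tail T e)"
    unfolding eq by (simp add: card_cartesian_product F)
qed

text \<open>
  The gluing along all arcs at once: \<open>N\<close> turns a flag at \<open>e\<close> into the flag at \<open>arev e\<close> to which it is glued.
\<close>

lemma ex_flag_matching:
  "\<exists>N. (\<forall>a\<in>flags. N a \<in> flags \<and> germ (N a) = reverse (germ a) \<and> N (N a) = a) \<and>
       (\<forall>a b. (a, b) \<in> flag_rel \<longrightarrow> (N a, N b) \<in> flag_rel)"
proof (rule equivariant_matching[of flags flag_rel germs germ_rel])
  show "equiv flags flag_rel"
    by (rule equiv_state_rel[OF \<Gamma>\<^sub>1 \<Gamma>\<^sub>2])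
      (use ball_verts_subset in \<open>simp_all add: ball_verts_image w_image tail_arc\<close>)
  show "equiv germs germ_rel"
    by (rule equiv_state_rel[OF \<Gamma>\<^sub>1 \<Gamma>\<^sub>2]) (use edge_nbhd_subset in \<open>auto simp: edge_nbhd_image\<close>)
  show "germ a \<in> germs" if "a \<in> flags" for a
    using that by (elim flagE) (auto simp: germ_flag states_def local_maps_def)
  show "(germ a, germ b) \<in> germ_rel" if "(a, b) \<in> flag_rel" for a b
    using that by (elim flag_relE) (simp only: germ_flag germ_relI)
  show "a = b" if ab: "(a, b) \<in> flag_rel" "germ a = germ b" for a b
    using ab(1)
  proof (rule flag_relE)
    fix e h i \<gamma> \<delta> assume *: "e \<in> arcs T" "h \<in> carrier G" "i < w (tail T e)" "\<gamma> \<in> \<Gamma>\<^sub>1" "\<delta> \<in> \<Gamma>\<^sub>2"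
      and a: "a = (e, restrict (\<phi> h) (tail_ball e), i)"
      and b: "b = (\<psi> \<gamma> e, restrict (\<phi> (\<delta> \<otimes> h \<otimes> inv \<gamma>)) (tail_ball (\<psi> \<gamma> e)), i)"
    have e: "\<psi> \<gamma> e = e"
      and r: "restrict (\<phi> (\<delta> \<otimes> h \<otimes> inv \<gamma>)) (edge_nbhd R e) = restrict (\<phi> h) (edge_nbhd R e)"
      using ab(2) unfolding a b germ_flag by auto
    have "\<phi> (\<delta> \<otimes> h \<otimes> inv \<gamma>) (tail T e) = \<phi> h (tail T e)"
      using r ends_in_edge_nbhd(1)[OF R_pos *(1)] by (simp add: restrict_eq_iff)
    then have "\<gamma> = \<one> \<and> \<delta> = \<one>" using * e by (intro germ_free)
    then show "a = b" using a b * by (simp add: arc_one)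
  qed
  show "\<exists>b. (a, b) \<in> flag_rel \<and> germ b = y" if a: "a \<in> flags" and y: "(germ a, y) \<in> germ_rel" for a y
    using a
  proof (rule flagE)
    fix e h i assume *: "e \<in> arcs T" "h \<in> carrier G" "i < w (tail T e)"
      and a: "a = (e, restrict (\<phi> h) (tail_ball e), i)"
    from y show ?thesis
    proof (rule germ_relE)
      fix e' h' \<gamma> \<delta> assume **: "e' \<in> arcs T" "h' \<in> carrier G" "\<gamma> \<in> \<Gamma>\<^sub>1" "\<delta> \<in> \<Gamma>\<^sub>2"
        and ga: "germ a = (e', restrict (\<phi> h') (edge_nbhd R e'), 0)"
        and y: "y = (\<psi> \<gamma> e', restrict (\<phi> (\<delta> \<otimes> h' \<otimes> inv \<gamma>)) (edge_nbhd R (\<psi> \<gamma> e')), 0)"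
      have e': "e' = e" and h': "restrict (\<phi> h) (edge_nbhd R e) = restrict (\<phi> h') (edge_nbhd R e)"
        using ga unfolding a germ_flag by auto
      have "restrict (\<phi> (\<delta> \<otimes> h \<otimes> inv \<gamma>)) (edge_nbhd R (\<psi> \<gamma> e)) =
          restrict (\<phi> (\<delta> \<otimes> h' \<otimes> inv \<gamma>)) (edge_nbhd R (\<psi> \<gamma> e))"
        unfolding edge_nbhd_image[OF \<Gamma>\<^sub>1.mem_carrier[OF **(3)] *(1)]
        by (rule translate_cong[OF _ _ _ _ edge_nbhd_subset(2) h']) (use * ** in auto)
      then show ?thesis
        using flag_relI[OF * **(3,4)] unfolding a y e' germ_flag[symmetric]
        by (intro exI conjI) (auto simp: germ_flag)
    qed
  qed
  show "reverse y \<in> germs" if "y \<in> germs" for y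
    using that by (elim germE) (auto simp: reverse_def states_def local_maps_def edge_nbhd_arev)
  show "reverse (reverse y) = y" if "y \<in> germs" for y
    by (cases y) (simp add: reverse_def)
  show "(reverse y, reverse z) \<in> germ_rel" if "(y, z) \<in> germ_rel" for y z
    using that
  proof (rule germ_relE)
    fix e h \<gamma> \<delta> assume *: "e \<in> arcs T" "h \<in> carrier G" "\<gamma> \<in> \<Gamma>\<^sub>1" "\<delta> \<in> \<Gamma>\<^sub>2"
      and y: "y = (e, restrict (\<phi> h) (edge_nbhd R e), 0)"
      and z: "z = (\<psi> \<gamma> e, restrict (\<phi> (\<delta> \<otimes> h \<otimes> inv \<gamma>)) (edge_nbhd R (\<psi> \<gamma> e)), 0)"
    show ?thesis
      using germ_relI[OF arev_in_arcs[OF *(1)] *(2,3,4)] * unfolding y z reverse_def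
      by (simp add: edge_nbhd_arev arc_arev arc_closed)
  qed
  show "finite {a \<in> flags. germ a = y}" if "y \<in> germs" for y
    using that by (elim germE) (simp add: card_flags_over_germ(1))
  show "card {a \<in> flags. germ a = reverse y} = card {a \<in> flags. germ a = y}" if "y \<in> germs" for y
    using that
  proof (rule germE)
    fix e h assume *: "e \<in> arcs T" "h \<in> carrier G" and y: "y = (e, restrict (\<phi> h) (edge_nbhd R e), 0)"
    have r: "reverse y = (arev e, restrict (\<phi> h) (edge_nbhd R (arev e)), 0)"
      using * y by (simp add: reverse_def edge_nbhd_arev)
    show ?thesis
      unfolding r card_flags_over_germ(2)[OF arev_in_arcs[OF *(1)] *(2)]
      unfolding y card_flags_over_germ(2)[OF *]
      using balance[OF *(1)] * by (simp add: edge_nbhd_arev mult.commute)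
  qed
qed

end

text \<open>
  The value of \<open>s\<close> at \<open>\<phi> \<gamma> v\<close> is the translate of its value at \<open>v\<close> under \<open>(\<gamma>, \<delta>)\<close>.
\<close>

definition (in gluing) translates ::
  "('v \<Rightarrow> ('v \<Rightarrow> 'v) \<times> nat) \<Rightarrow> 'g \<Rightarrow> 'g \<Rightarrow> 'v \<Rightarrow> bool" where
  "translates s \<gamma> \<delta> v \<longleftrightarrow> (\<exists>h\<in>carrier G. fst (s v) = restrict (\<phi> h) (ball_verts R v) \<and>
     s (\<phi> \<gamma> v) = (restrict (\<phi> (\<delta> \<otimes> h \<otimes> inv \<gamma>)) (ball_verts R (\<phi> \<gamma> v)), snd (s v)))"

text \<open>
  A section of the covering of the tree by glued states: a choice of a state at each vertex so that the
  states at adjacent vertices are glued. As the gluing is equivariant, a section that looks the same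
  at \<open>v\<close> and at \<open>\<phi> \<gamma> v\<close> up to \<open>(\<gamma>, \<delta>)\<close> does so at all vertices.
\<close>

locale local_section = gluing T arev G \<phi> \<psi> \<Gamma>\<^sub>1 \<Gamma>\<^sub>2 R w
  for T :: "('v, 'e) pre_digraph" and arev and G :: "('g, 'm) monoid_scheme" (structure)
    and \<phi> \<psi> \<Gamma>\<^sub>1 \<Gamma>\<^sub>2 R w +
  fixes s :: "'v \<Rightarrow> ('v \<Rightarrow> 'v) \<times> nat"
  assumes s_map: "v \<in> verts T \<Longrightarrow> fst (s v) \<in> local_maps (ball_verts R v)"
    and s_index: "v \<in> verts T \<Longrightarrow> snd (s v) < w v"
    and s_agree: "e \<in> arcs T \<Longrightarrow>
      restrict (fst (s (head T e))) (edge_nbhd R e) = restrict (fst (s (tail T e))) (edge_nbhd R e)"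
    and s_translates: "e \<in> arcs T \<Longrightarrow> \<gamma> \<in> \<Gamma>\<^sub>1 \<Longrightarrow> \<delta> \<in> \<Gamma>\<^sub>2 \<Longrightarrow>
      translates s \<gamma> \<delta> (tail T e) \<Longrightarrow> translates s \<gamma> \<delta> (head T e)"

context gluing begin

lemmas free\<^sub>1_eq = semiregular_eqD[OF \<Gamma>\<^sub>1 free\<^sub>1]
lemmas free\<^sub>2_eq = semiregular_eqD[OF \<Gamma>\<^sub>2 free\<^sub>2]

text \<open>
  Follow the gluing from the state given by the identity at some vertex. For \<open>s_translates\<close> the pair that
  relates the states at the head is shown to be the pair \<open>(\<gamma>, \<delta>)\<close> that relates those at the tail: both
  move \<open>head T e\<close> in the same way, and the image of \<open>tail T e\<close> too, so freeness applies.
\<close>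

lemma ex_local_section: "\<exists>s. local_section T arev G \<phi> \<psi> \<Gamma>\<^sub>1 \<Gamma>\<^sub>2 R w s"
proof -
  obtain N where N: "\<And>a. a \<in> flags \<Longrightarrow> N a \<in> flags" "\<And>a. a \<in> flags \<Longrightarrow> germ (N a) = reverse (germ a)"
    "\<And>a. a \<in> flags \<Longrightarrow> N (N a) = a" "\<And>a b. (a, b) \<in> flag_rel \<Longrightarrow> (N a, N b) \<in> flag_rel"
    using ex_flag_matching by blast
  define \<tau> where "\<tau> e x = snd (N (e, x))" for e x
  define S where "S v = local_maps (ball_verts R v) \<times> {..<w v}" for v
  have flag: "(e, x) \<in> flags \<longleftrightarrow> e \<in> arcs T \<and> x \<in> S (tail T e)" for e x
    by (cases x) (auto simp: states_def S_def)
  have N_eq: "N (e, x) = (arev e, \<tau> e x)" and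
    N_germ: "restrict (fst (\<tau> e x)) (edge_nbhd R e) = restrict (fst x) (edge_nbhd R e)"
    if ex: "e \<in> arcs T" "x \<in> S (tail T e)" for e x
  proof -
    obtain f i where x: "x = (f, i)" by (cases x)
    obtain e' f' i' where N': "N (e, x) = (e', f', i')" by (cases "N (e, x)") auto
    have "germ (e', f', i') = reverse (germ (e, f, i))"
      using N(2)[of "(e, x)"] ex unfolding flag N'[symmetric] x by blast
    then have "e' = arev e" "restrict f' (edge_nbhd R e') = restrict f (edge_nbhd R e)"
      by (auto simp: germ_def reverse_def)
    then show "N (e, x) = (arev e, \<tau> e x)"
      "restrict (fst (\<tau> e x)) (edge_nbhd R e) = restrict (fst x) (edge_nbhd R e)"
      using N' x ex by (simp_all add: \<tau>_def edge_nbhd_arev)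
  qed
  have maps: "\<tau> e x \<in> S (head T e)" if "e \<in> arcs T" "x \<in> S (tail T e)" for e x
  proof -
    have "(arev e, \<tau> e x) \<in> flags" using N(1)[of "(e, x)"] that N_eq[OF that] flag by simp
    then show ?thesis using that unfolding flag by simp
  qed
  have cancel: "\<tau> (arev e) (\<tau> e x) = x" if "e \<in> arcs T" "x \<in> S (tail T e)" for e x
  proof -
    have "N (arev e, \<tau> e x) = (e, x)" using N(3)[of "(e, x)"] that N_eq[OF that] flag by simp
    then show ?thesis by (simp add: \<tau>_def[of "arev e"])
  qed
  obtain v\<^sub>0 where v\<^sub>0: "v\<^sub>0 \<in> verts T" using verts_nonempty by blast
  have x\<^sub>0: "(restrict (\<phi> \<one>) (ball_verts R v\<^sub>0), 0) \<in> S v\<^sub>0"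
    using w_pos[OF v\<^sub>0] by (auto simp: S_def local_maps_def)
  obtain s where s: "\<And>u. u \<in> verts T \<Longrightarrow> s u \<in> S u"
    "\<And>e. e \<in> arcs T \<Longrightarrow> s (head T e) = \<tau> e (s (tail T e))"
    using transport_section[of S \<tau>, OF maps cancel v\<^sub>0 x\<^sub>0] by blast
  have agree: "restrict (fst (s (head T e))) (edge_nbhd R e) = restrict (fst (s (tail T e))) (edge_nbhd R e)"
    if "e \<in> arcs T" for e
    unfolding s(2)[OF that] using that s(1) by (intro N_germ) auto
  have "translates s \<gamma> \<delta> (head T e)"
    if e: "e \<in> arcs T" and \<gamma>: "\<gamma> \<in> \<Gamma>\<^sub>1" and \<delta>: "\<delta> \<in> \<Gamma>\<^sub>2" and tr: "translates s \<gamma> \<delta> (tail T e)" for e \<gamma> \<delta>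
  proof -
    \<comment> \<open>Glue the flags at \<open>e\<close> and at \<open>\<psi> \<gamma> e\<close>; the results are related again, by some \<open>(\<gamma>', \<delta>')\<close>.\<close>
    let ?t = "tail T e" and ?e = "\<psi> \<gamma> e"
    obtain h where h: "h \<in> carrier G" "fst (s ?t) = restrict (\<phi> h) (tail_ball e)"
      "s (\<phi> \<gamma> ?t) = (restrict (\<phi> (\<delta> \<otimes> h \<otimes> inv \<gamma>)) (ball_verts R (\<phi> \<gamma> ?t)), snd (s ?t))"
      using tr unfolding translates_def by blast
    have e': "?e \<in> arcs T" "tail T ?e = \<phi> \<gamma> ?t" "head T ?e = \<phi> \<gamma> (head T e)"
      using e \<gamma> by (simp_all add: arc_closed tail_arc head_arc)
    have st: "s ?t = (restrict (\<phi> h) (tail_ball e), snd (s ?t))" using h(2) by (metis prod.collapse)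
    have "snd (s ?t) < w ?t" using s(1)[of ?t] e by (auto simp: S_def)
    from flag_relI[OF e h(1) this \<gamma> \<delta>]
    have "((e, s ?t), (?e, s (\<phi> \<gamma> ?t))) \<in> flag_rel" using h(3) st e'(2) by simp
    then have "(N (e, s ?t), N (?e, s (tail T ?e))) \<in> flag_rel" using e'(2) N(4) by simp
    moreover have "N (e, s ?t) = (arev e, s (head T e))" using N_eq[of e "s ?t"] s e by simp
    moreover have "N (?e, s (tail T ?e)) = (arev ?e, s (head T ?e))"
      using N_eq[of ?e "s (tail T ?e)"] s e'(1) by simp
    ultimately have "((arev e, s (head T e)), (arev ?e, s (head T ?e))) \<in> flag_rel" by simp
    then show ?thesis
    proof (rule flag_relE)
      fix a h' i \<gamma>' \<delta>' assume *: "a \<in> arcs T" "h' \<in> carrier G" "\<gamma>' \<in> \<Gamma>\<^sub>1" "\<delta>' \<in> \<Gamma>\<^sub>2"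
        and a: "(arev e, s (head T e)) = (a, restrict (\<phi> h') (tail_ball a), i)"
        and b: "(arev ?e, s (head T ?e)) =
          (\<psi> \<gamma>' a, restrict (\<phi> (\<delta>' \<otimes> h' \<otimes> inv \<gamma>')) (tail_ball (\<psi> \<gamma>' a)), i)"
      have a': "a = arev e" "s (head T e) = (restrict (\<phi> h') (ball_verts R (head T e)), i)"
        using a e by auto
      have "tail T (arev ?e) = tail T (\<psi> \<gamma>' (arev e))" using b a' by simp
      then have "\<phi> \<gamma> (head T e) = \<phi> \<gamma>' (head T e)"
        using e e' \<gamma> * by (simp add: tail_arc)
      then have \<gamma>': "\<gamma>' = \<gamma>" using free\<^sub>1_eq[OF \<gamma> *(3) head_in_verts[OF e]] by simp
      have b': "s (head T ?e) = (restrict (\<phi> (\<delta>' \<otimes> h' \<otimes> inv \<gamma>)) (ball_verts R (\<phi> \<gamma> (head T e))), i)"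
        using b a' e e' \<gamma> * by (simp add: \<gamma>' tail_arc)
      have t: "?t \<in> edge_nbhd R e" using ends_in_edge_nbhd[OF R_pos e] by simp
      have t': "?t \<in> tail_ball e" "?t \<in> ball_verts R (head T e)" "?t \<in> verts T"
        using t e by (auto simp: edge_nbhd_def)
      have "\<phi> h' ?t = \<phi> h ?t"
        using agree[OF e] t t' unfolding restrict_eq_iff a'(2) h(2) by auto
      moreover have "\<phi> (\<delta>' \<otimes> h' \<otimes> inv \<gamma>) (\<phi> \<gamma> ?t) = \<phi> (\<delta> \<otimes> h \<otimes> inv \<gamma>) (\<phi> \<gamma> ?t)"
      proof -
        have g: "\<phi> \<gamma> ?t \<in> edge_nbhd R ?e" using ends_in_edge_nbhd(1)[OF R_pos e'(1)] e'(2) by simp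
        then have "\<phi> \<gamma> ?t \<in> ball_verts R (\<phi> \<gamma> ?t)" "\<phi> \<gamma> ?t \<in> ball_verts R (\<phi> \<gamma> (head T e))"
          using e' by (auto simp: edge_nbhd_def)
        moreover have "fst (s (head T ?e)) (\<phi> \<gamma> ?t) = fst (s (tail T ?e)) (\<phi> \<gamma> ?t)"
          using agree[OF e'(1)] g unfolding restrict_eq_iff by blast
        ultimately show ?thesis unfolding b' unfolding e'(2) h(3) by simp
      qed
      ultimately have "\<phi> \<delta>' (\<phi> h ?t) = \<phi> \<delta> (\<phi> h ?t)"
        using * h(1) \<gamma> \<delta> t'(3) by (simp add: translate_apply)
      then have "\<delta>' = \<delta>" using free\<^sub>2_eq[OF *(4) \<delta>] h(1) t'(3) act_closed by blast
      then show ?thesis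
        unfolding translates_def using a' b' e'(3) * by (intro bexI[of _ h']) auto
    qed
  qed
  note tr = this
  have "local_section T arev G \<phi> \<psi> \<Gamma>\<^sub>1 \<Gamma>\<^sub>2 R w s"
  proof unfold_locales
    show "fst (s v) \<in> local_maps (ball_verts R v)" "snd (s v) < w v" if "v \<in> verts T" for v
      using s(1)[OF that] by (auto simp: S_def)
  qed (fact agree, fact tr)
  then show ?thesis by (intro exI[of _ s])
qed

end

context local_section begin

text \<open>
  The automorphism of the tree defined by a section: near \<open>v\<close> it is the group element \<open>lift v\<close> chosen to
  represent the state at \<open>v\<close>.
\<close>

definition lift :: "'v \<Rightarrow> 'g" where
  "lift v = (SOME h. h \<in> carrier G \<and> fst (s v) = restrict (\<phi> h) (ball_verts R v))"

definition vert_map :: "'v \<Rightarrow> 'v" where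
  "vert_map = (\<lambda>v\<in>verts T. \<phi> (lift v) v)"

definition arc_map :: "'e \<Rightarrow> 'e" where
  "arc_map = (\<lambda>e\<in>arcs T. \<psi> (lift (tail T e)) e)"

lemma lift:
  assumes "v \<in> verts T"
  shows "lift v \<in> carrier G" "fst (s v) = restrict (\<phi> (lift v)) (ball_verts R v)"
proof -
  have "\<exists>h. h \<in> carrier G \<and> fst (s v) = restrict (\<phi> h) (ball_verts R v)"
    using s_map[OF assms] by (auto simp: local_maps_def)
  from someI_ex[OF this] show "lift v \<in> carrier G" "fst (s v) = restrict (\<phi> (lift v)) (ball_verts R v)"
    by (simp_all add: lift_def)
qed

lemma lift_agree:
  assumes e: "e \<in> arcs T" and u: "u \<in> edge_nbhd R e"
  shows "\<phi> (lift (head T e)) u = \<phi> (lift (tail T e)) u"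
  using s_agree[OF e] u lift(2)[of "head T e"] lift(2)[of "tail T e"] e
  unfolding restrict_eq_iff by (auto simp: edge_nbhd_def)

text \<open>
  Every vertex of a walk of length at most \<open>R\<close> ending in \<open>u\<close> has \<open>u\<close> in its ball, and so \<open>u\<close> lies in
  \<open>edge_nbhd R e\<close> for each arc \<open>e\<close> of the walk.
\<close>

lemma lift_eq_on_ball:
  assumes "awalk v p u" "length p \<le> R" shows "\<phi> (lift v) u = \<phi> (lift u) u"
  using assms
proof (induction p arbitrary: v)
  case (Cons e p)
  then have e: "e \<in> arcs T" "tail T e = v" "awalk (head T e) p u" by (auto simp: awalk_Cons_iff)
  have "u \<in> ball_verts R (head T e)" using e(3) Cons.prems by (auto simp: ball_verts_def)
  moreover have "u \<in> ball_verts R v" using Cons.prems unfolding ball_verts_def by blast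
  ultimately have "u \<in> edge_nbhd R e" using e(2) by (simp add: edge_nbhd_def)
  then have "\<phi> (lift v) u = \<phi> (lift (head T e)) u" using lift_agree[OF e(1)] e(2) by simp
  then show ?case using Cons.IH[OF e(3)] Cons.prems by simp
qed (auto simp: awalk_Nil_iff)

lemma vert_map_local:
  assumes "u \<in> ball_verts R v" shows "vert_map u = \<phi> (lift v) u"
proof -
  obtain p where p: "awalk v p u" "length p \<le> R" using assms by (auto simp: ball_verts_def)
  then show ?thesis using lift_eq_on_ball[OF p] by (auto simp: vert_map_def)
qed

lemma arc_map_local:
  assumes e: "e \<in> arcs T" and v: "v \<in> verts T"
    and ends: "tail T e \<in> ball_verts R v" "head T e \<in> ball_verts R v"
  shows "arc_map e = \<psi> (lift v) e"
proof -
  have "head T e \<in> tail_ball e" "tail T e \<in> tail_ball e"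
    using ends_in_edge_nbhd[OF R_pos e] by (auto simp: edge_nbhd_def)
  then have "\<psi> (lift (tail T e)) e = \<psi> (lift v) e"
    using vert_map_local ends lift(1) v e by (intro arc_cong) (simp_all flip: vert_map_local)
  then show ?thesis using e by (simp add: arc_map_def)
qed

lemma arc_map_eq_head:
  assumes e: "e \<in> arcs T" shows "arc_map e = \<psi> (lift (head T e)) e"
  using ends_in_edge_nbhd[OF R_pos e] e by (intro arc_map_local) (auto simp: edge_nbhd_def)

lemma tail_arc_map: "e \<in> arcs T \<Longrightarrow> tail T (arc_map e) = vert_map (tail T e)"
  by (simp add: arc_map_def vert_map_def tail_arc lift)

lemma arc_map_arev:
  assumes "e \<in> arcs T" shows "arc_map (arev e) = arev (arc_map e)"
proof -
  have "arc_map (arev e) = \<psi> (lift (head T e)) (arev e)" using assms by (simp add: arc_map_def)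
  also have "\<dots> = arev (arc_map e)" using assms by (simp add: arc_map_eq_head arc_arev lift)
  finally show ?thesis .
qed

lemma maps_bij:
  shows "bij_betw vert_map (verts T) (verts T)" "bij_betw arc_map (arcs T) (arcs T)"
proof -
  have inj: "e = e'"
    if "e \<in> arcs T" "e' \<in> arcs T" "tail T e = tail T e'" "arc_map e = arc_map e'" for e e'
  proof -
    let ?h = "lift (tail T e)"
    have h: "?h \<in> carrier G" using lift(1) that(1) by simp
    have "\<psi> ?h e = \<psi> ?h e'" using that by (simp add: arc_map_def)
    then show ?thesis by (metis arc_inv h that(1,2))
  qed
  have surj: "\<exists>e\<in>arcs T. tail T e = v \<and> arc_map e = e'"
    if "v \<in> verts T" "e' \<in> arcs T" "tail T e' = vert_map v" for v e'
  proof (intro bexI conjI)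
    let ?h = "lift v" and ?e = "\<psi> (inv (lift v)) e'"
    have h: "?h \<in> carrier G" using lift(1) that(1) by simp
    show e: "?e \<in> arcs T" using h that by (simp add: arc_closed)
    show t: "tail T ?e = v" using h that by (simp add: tail_arc vert_map_def act_inv)
    show "arc_map ?e = e'" using arc_inv'[OF h that(2)] e t by (simp add: arc_map_def)
  qed
  have "vert_map v \<in> verts T" if "v \<in> verts T" for v
    using that lift(1) by (simp add: vert_map_def act_closed)
  moreover have "arc_map e \<in> arcs T" if "e \<in> arcs T" for e
    using that lift(1) by (simp add: arc_map_def arc_closed)
  ultimately show "bij_betw vert_map (verts T) (verts T)" "bij_betw arc_map (arcs T) (arcs T)"
    using local_isomorphism_bij[of vert_map arc_map] tail_arc_map arc_map_arev inj surj by blast+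
qed

lemma translates_everywhere:
  assumes "\<gamma> \<in> \<Gamma>\<^sub>1" "\<delta> \<in> \<Gamma>\<^sub>2" "u \<in> verts T" "v \<in> verts T" "translates s \<gamma> \<delta> u"
  shows "translates s \<gamma> \<delta> v"
proof -
  obtain p where "awalk u p v" using ex_awalk[OF assms(3,4)] by blast
  then show ?thesis using assms(5)
  proof (induction p arbitrary: u)
    case (Cons e p)
    then show ?case using s_translates[OF _ assms(1,2), of e] by (auto simp: awalk_Cons_iff)
  qed (auto simp: awalk_Nil_iff)
qed

lemma vert_map_eq: "v \<in> verts T \<Longrightarrow> vert_map v = fst (s v) v"
  using lift(2)[of v] centre_in_ball[of v R] by (simp add: vert_map_def)

lemma vert_map_translates:
  assumes "\<gamma> \<in> \<Gamma>\<^sub>1" "\<delta> \<in> \<Gamma>\<^sub>2" "v \<in> verts T" "translates s \<gamma> \<delta> v"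
  shows "vert_map (\<phi> \<gamma> v) = \<phi> \<delta> (vert_map v)"
proof -
  obtain h where h: "h \<in> carrier G" "fst (s v) = restrict (\<phi> h) (ball_verts R v)"
    "s (\<phi> \<gamma> v) = (restrict (\<phi> (\<delta> \<otimes> h \<otimes> inv \<gamma>)) (ball_verts R (\<phi> \<gamma> v)), snd (s v))"
    using assms(4) unfolding translates_def by blast
  have v': "\<phi> \<gamma> v \<in> verts T" using assms by (simp add: act_closed)
  show ?thesis
    using h assms centre_in_ball[OF v'] centre_in_ball[OF assms(3)]
    by (simp add: vert_map_eq[OF v'] vert_map_eq[OF assms(3)] translate_apply)
qed

text \<open>
  The type of the state at \<open>u\<close> up to \<open>\<Gamma>\<^sub>1 \<times> \<Gamma>\<^sub>2\<close>: \<open>t\<close> moves it to \<open>\<phi> t u\<close>, which will be a chosen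
  representative of the \<open>\<Gamma>\<^sub>1\<close>-orbit of \<open>u\<close>, and left multiplication by \<open>\<Gamma>\<^sub>2\<close> is divided out.
\<close>

definition state_class :: "'g \<Rightarrow> 'v \<Rightarrow> 'v \<times> ('v \<Rightarrow> 'v) set \<times> nat" where
  "state_class t u =
     (\<phi> t u, local_class \<Gamma>\<^sub>2 (ball_verts R (\<phi> t u)) (lift u \<otimes> inv t), snd (s u))"

lemma state_class_in:
  assumes "t \<in> \<Gamma>\<^sub>1" "u \<in> verts T"
  shows "state_class t u \<in>
    {\<phi> t u} \<times> local_class \<Gamma>\<^sub>2 (ball_verts R (\<phi> t u)) ` carrier G \<times> {..<w (\<phi> t u)}"
  using assms s_index[OF assms(2)] lift(1)[OF assms(2)] by (auto simp: state_class_def w_image)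

text \<open>
  Two vertices with states of the same type are related by a pair \<open>(\<gamma>, \<delta>)\<close> with \<open>\<gamma> = inv t' \<otimes> t\<close>, hence the whole
  section is invariant under this pair, which means that \<open>vert_map\<close> conjugates \<open>\<gamma>\<close> to \<open>\<delta>\<close>.
\<close>

lemma same_state_class:
  assumes t: "t \<in> \<Gamma>\<^sub>1" "t' \<in> \<Gamma>\<^sub>1" and u: "u \<in> verts T" "u' \<in> verts T"
    and eq: "state_class t u = state_class t' u'"
  shows "\<exists>\<delta>\<in>\<Gamma>\<^sub>2. \<forall>v\<in>verts T. vert_map (\<phi> (inv t' \<otimes> t) v) = \<phi> \<delta> (vert_map v)"
proof -
  let ?B = "ball_verts R (\<phi> t u)" and ?\<gamma> = "inv t' \<otimes> t"
  have tc: "t \<in> carrier G" "t' \<in> carrier G" using t by auto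
  have \<gamma>: "?\<gamma> \<in> \<Gamma>\<^sub>1" using t by simp
  have r: "\<phi> t u = \<phi> t' u'"
    using eq unfolding state_class_def prod.inject by (elim conjE)
  have i: "snd (s u) = snd (s u')"
    using eq unfolding state_class_def prod.inject by (elim conjE)
  have c: "local_class \<Gamma>\<^sub>2 ?B (lift u \<otimes> inv t) = local_class \<Gamma>\<^sub>2 ?B (lift u' \<otimes> inv t')"
    using eq unfolding state_class_def prod.inject r[symmetric] by (elim conjE)
  have lc: "lift u \<otimes> inv t \<in> carrier G" "lift u' \<otimes> inv t' \<in> carrier G"
    using lift(1) u tc by auto
  obtain \<delta> where \<delta>: "\<delta> \<in> \<Gamma>\<^sub>2" "\<forall>x\<in>?B. \<phi> (lift u' \<otimes> inv t') x = \<phi> (\<delta> \<otimes> (lift u \<otimes> inv t)) x"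
    using c local_class_eq_iff[OF \<Gamma>\<^sub>2 ball_verts_subset lc] by blast
  have u': "\<phi> ?\<gamma> u = u'"
    using tc u r act_inv[OF tc(2) u(2)] by (simp add: composition_rule)
  have "restrict (\<phi> (lift u')) (ball_verts R u') = restrict (\<phi> (\<delta> \<otimes> lift u \<otimes> inv ?\<gamma>)) (ball_verts R u')"
  proof (rule restrict_ext)
    fix y assume y: "y \<in> ball_verts R u'"
    have yT: "y \<in> verts T" using y ball_verts_subset by blast
    have "\<phi> t' y \<in> ?B" unfolding r using y ball_verts_image[OF tc(2) u(2)] by blast
    then have "\<phi> (lift u' \<otimes> inv t') (\<phi> t' y) = \<phi> (\<delta> \<otimes> (lift u \<otimes> inv t)) (\<phi> t' y)" using \<delta> by blast
    moreover have "\<phi> (lift u' \<otimes> inv t') (\<phi> t' y) = \<phi> (lift u') y"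
      using yT tc lift(1)[OF u(2)] by (simp add: composition_rule act_closed act_inv)
    moreover have "\<phi> (\<delta> \<otimes> (lift u \<otimes> inv t)) (\<phi> t' y) = \<phi> (\<delta> \<otimes> lift u \<otimes> inv ?\<gamma>) y"
      using yT tc \<delta>(1) lift(1)[OF u(1)]
      by (simp add: composition_rule act_closed inv_mult_group)
    ultimately show "\<phi> (lift u') y = \<phi> (\<delta> \<otimes> lift u \<otimes> inv ?\<gamma>) y" by simp
  qed
  then have "s u' = (restrict (\<phi> (\<delta> \<otimes> lift u \<otimes> inv ?\<gamma>)) (ball_verts R u'), snd (s u))"
    using lift(2)[OF u(2)] i by (simp add: prod_eq_iff)
  then have "translates s ?\<gamma> \<delta> u"
    unfolding translates_def u' using lift[OF u(1)] by blast
  then have "\<forall>v\<in>verts T. vert_map (\<phi> ?\<gamma> v) = \<phi> \<delta> (vert_map v)"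
    using translates_everywhere[OF \<gamma> \<delta>(1) u(1)] vert_map_translates[OF \<gamma> \<delta>(1)] by blast
  then show ?thesis using \<delta>(1) by blast
qed

end

section \<open>Balanced weights and the index bound\<close>

lemma sum_powers_le: "d \<ge> (2::nat) \<Longrightarrow> R \<ge> 1 \<Longrightarrow> (\<Sum>r<R. d ^ r) \<le> 2 * d ^ (R - 1)"
proof (induction R)
  case (Suc R)
  show ?case
  proof (cases "R = 0")
    case False
    then have "(\<Sum>r<R. d ^ r) \<le> 2 * d ^ (R - 1)" using Suc by simp
    also have "\<dots> \<le> d * d ^ (R - 1)" using Suc.prems(1) by (rule mult_right_mono) simp
    also have "\<dots> = d ^ R" using False by (cases R) auto
    finally show ?thesis by simp
  qed simp
qed simp

lemma fact_power_le:
  assumes "R \<ge> 1"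
  shows "(fact d :: nat) ^ (\<Sum>r<R. d ^ r) \<le> fact d ^ (4 * d ^ (R - 1))"
proof (cases "d \<ge> 2")
  case True
  have "(\<Sum>r<R. d ^ r) \<le> 4 * d ^ (R - 1)" using sum_powers_le[OF True assms] by simp
  then show ?thesis by (intro power_increasing) (auto simp: fact_ge_1)
next
  case False
  then have "d = 0 \<or> d = 1" by auto
  then show ?thesis by auto
qed

context local_section begin

text \<open>
  Classify \<open>\<gamma> \<in> \<Gamma>\<^sub>1\<close> by the type of the state at \<open>\<phi> \<gamma> v\<close>. Elements of the same class differ by one that
  \<open>vert_map\<close> conjugates into \<open>\<Gamma>\<^sub>2\<close>, so the index in \<open>\<Gamma>\<^sub>1\<close> of the elements conjugated into \<open>\<Gamma>\<^sub>2\<close> is at most the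
  number of types of states over \<open>v\<close>.
\<close>

lemma conjugates_in_finite_classes\<^sub>1:
  assumes v: "v \<in> verts T" and fin: "num_classes \<Gamma>\<^sub>2 (ball_verts R v) > 0"
  shows "\<exists>(\<kappa> :: 'g \<Rightarrow> 'v \<times> ('v \<Rightarrow> 'v) set \<times> nat) F. finite F \<and> card F = num_classes \<Gamma>\<^sub>2 (ball_verts R v) * w v \<and>
    (\<forall>\<gamma>\<in>\<Gamma>\<^sub>1. \<kappa> \<gamma> \<in> F) \<and>
    (\<forall>\<gamma>\<in>\<Gamma>\<^sub>1. \<forall>\<gamma>'\<in>\<Gamma>\<^sub>1. \<kappa> \<gamma> = \<kappa> \<gamma>' \<longrightarrow>
      (\<exists>\<delta>\<in>\<Gamma>\<^sub>2. \<forall>u\<in>verts T. vert_map (\<phi> (\<gamma>' \<otimes> inv \<gamma>) u) = \<phi> \<delta> (vert_map u)))"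
proof -
  let ?F = "{v} \<times> local_class \<Gamma>\<^sub>2 (ball_verts R v) ` carrier G \<times> {..<w v}"
    and ?\<kappa> = "\<lambda>\<gamma>. state_class (inv \<gamma>) (\<phi> \<gamma> v)"
  have f: "finite (local_class \<Gamma>\<^sub>2 (ball_verts R v) ` carrier G)"
    using fin unfolding num_classes_def by (rule card_ge_0_finite)
  show ?thesis
  proof (intro exI[of _ ?\<kappa>] exI[of _ ?F] conjI ballI impI)
    show "finite ?F" using f by simp
    show "card ?F = num_classes \<Gamma>\<^sub>2 (ball_verts R v) * w v"
      by (simp add: num_classes_def card_cartesian_product)
    show "?\<kappa> \<gamma> \<in> ?F" if "\<gamma> \<in> \<Gamma>\<^sub>1" for \<gamma>
      using state_class_in[of "inv \<gamma>" "\<phi> \<gamma> v"] that v by (simp add: act_inv act_closed)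
    show "\<exists>\<delta>\<in>\<Gamma>\<^sub>2. \<forall>u\<in>verts T. vert_map (\<phi> (\<gamma>' \<otimes> inv \<gamma>) u) = \<phi> \<delta> (vert_map u)"
      if "\<gamma> \<in> \<Gamma>\<^sub>1" "\<gamma>' \<in> \<Gamma>\<^sub>1" "?\<kappa> \<gamma> = ?\<kappa> \<gamma>'" for \<gamma> \<gamma>'
      using same_state_class[OF _ _ _ _ that(3)] that(1,2) v by (simp add: act_closed)
  qed
qed

text \<open>
  The same from the side of \<open>\<Gamma>\<^sub>2\<close>: classify \<open>\<delta> \<in> \<Gamma>\<^sub>2\<close> by the type of the state at the vertex \<open>y \<delta>\<close> that
  \<open>vert_map\<close> takes to \<open>\<phi> \<delta> x\<close>. These vertices may lie in several \<open>\<Gamma>\<^sub>1\<close>-orbits, so \<open>t u\<close> moves \<open>u\<close> to the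
  representative \<open>rr u\<close> of its orbit.
\<close>

lemma conjugates_in_finite_classes\<^sub>2:
  assumes fin1: "finite (orbit_of \<Gamma>\<^sub>1 ` verts T)"
    and fin2: "\<forall>v\<in>verts T. num_classes \<Gamma>\<^sub>2 (ball_verts R v) > 0"
  shows "\<exists>(\<kappa> :: 'g \<Rightarrow> 'v \<times> ('v \<Rightarrow> 'v) set \<times> nat) F. finite F \<and> (\<forall>\<delta>\<in>\<Gamma>\<^sub>2. \<kappa> \<delta> \<in> F) \<and>
    (\<forall>\<delta>\<in>\<Gamma>\<^sub>2. \<forall>\<delta>'\<in>\<Gamma>\<^sub>2. \<kappa> \<delta> = \<kappa> \<delta>' \<longrightarrow>
      (\<exists>\<gamma>\<in>\<Gamma>\<^sub>1. \<forall>u\<in>verts T. vert_map (\<phi> \<gamma> u) = \<phi> (\<delta>' \<otimes> inv \<delta>) (vert_map u)))"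
proof -
  obtain v where v: "v \<in> verts T" using verts_nonempty by blast
  define x where "x = vert_map v"
  have x: "x \<in> verts T" using maps_bij(1) v by (auto simp: x_def bij_betw_def)
  define rep where "rep A = (SOME r. r \<in> A)" for A :: "'v set"
  define rr where "rr u = rep (orbit_of \<Gamma>\<^sub>1 u)" for u
  have "rr ` verts T = rep ` orbit_of \<Gamma>\<^sub>1 ` verts T" by (auto simp: rr_def image_image)
  then have fin_rr: "finite (rr ` verts T)" using fin1 by simp
  have ex_t: "\<exists>t. t \<in> \<Gamma>\<^sub>1 \<and> \<phi> t u = rr u" if u: "u \<in> verts T" for u
  proof -
    have "rr u \<in> orbit_of \<Gamma>\<^sub>1 u"
      unfolding rr_def rep_def using orbit_of_self[OF \<Gamma>\<^sub>1 u] by (rule someI)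
    then show ?thesis by (auto simp: orbit_of_def)
  qed
  define t where "t u = (SOME t. t \<in> \<Gamma>\<^sub>1 \<and> \<phi> t u = rr u)" for u
  have t: "t u \<in> \<Gamma>\<^sub>1" "\<phi> (t u) u = rr u" if "u \<in> verts T" for u
    using someI_ex[OF ex_t[OF that]] by (simp_all add: t_def)
  define y where "y \<delta> = inv_into (verts T) vert_map (\<phi> \<delta> x)" for \<delta>
  have y: "y \<delta> \<in> verts T" "vert_map (y \<delta>) = \<phi> \<delta> x" if "\<delta> \<in> \<Gamma>\<^sub>2" for \<delta>
  proof -
    have "\<phi> \<delta> x \<in> vert_map ` verts T"
      using maps_bij(1) that x act_closed by (simp add: bij_betw_def)
    from inv_into_into[OF this] f_inv_into_f[OF this]
    show "y \<delta> \<in> verts T" "vert_map (y \<delta>) = \<phi> \<delta> x" by (simp_all add: y_def)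
  qed
  let ?F = "\<Union>r\<in>rr ` verts T. {r} \<times> local_class \<Gamma>\<^sub>2 (ball_verts R r) ` carrier G \<times> {..<w r}"
    and ?\<kappa> = "\<lambda>\<delta>. state_class (t (y \<delta>)) (y \<delta>)"
  have "finite ?F"
  proof (rule finite_UN_I[OF fin_rr])
    fix r assume "r \<in> rr ` verts T"
    then have "r \<in> verts T" using t \<Gamma>\<^sub>1.mem_carrier act_closed by (metis imageE)
    then have "finite (local_class \<Gamma>\<^sub>2 (ball_verts R r) ` carrier G)"
      using fin2 unfolding num_classes_def by (intro card_ge_0_finite) simp
    then show "finite ({r} \<times> local_class \<Gamma>\<^sub>2 (ball_verts R r) ` carrier G \<times> {..<w r})" by simp
  qed
  moreover have "?\<kappa> \<delta> \<in> ?F" if "\<delta> \<in> \<Gamma>\<^sub>2" for \<delta>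
    using state_class_in[OF t(1)[OF y(1)[OF that]] y(1)[OF that]]
    unfolding t(2)[OF y(1)[OF that]] by (rule UN_I[OF imageI[OF y(1)[OF that]]])
  moreover have "\<exists>\<gamma>\<in>\<Gamma>\<^sub>1. \<forall>u\<in>verts T. vert_map (\<phi> \<gamma> u) = \<phi> (\<delta>' \<otimes> inv \<delta>) (vert_map u)"
    if \<delta>: "\<delta> \<in> \<Gamma>\<^sub>2" "\<delta>' \<in> \<Gamma>\<^sub>2" and eq: "?\<kappa> \<delta> = ?\<kappa> \<delta>'" for \<delta> \<delta>'
  proof -
    let ?u = "y \<delta>" and ?u' = "y \<delta>'"
    let ?\<gamma> = "inv (t ?u') \<otimes> t ?u"
    have u: "?u \<in> verts T" "?u' \<in> verts T" using y \<delta> by auto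
    have tt: "t ?u \<in> \<Gamma>\<^sub>1" "t ?u' \<in> \<Gamma>\<^sub>1" using t u by auto
    have tc: "t ?u \<in> carrier G" "t ?u' \<in> carrier G" using tt by auto
    obtain \<epsilon> where \<epsilon>: "\<epsilon> \<in> \<Gamma>\<^sub>2" "\<forall>v\<in>verts T. vert_map (\<phi> ?\<gamma> v) = \<phi> \<epsilon> (vert_map v)"
      using same_state_class[OF tt u eq] by blast
    have "\<phi> (t ?u) ?u = \<phi> (t ?u') ?u'"
      using eq unfolding state_class_def prod.inject by (elim conjE)
    then have "\<phi> ?\<gamma> ?u = ?u'" using tc u by (simp add: composition_rule act_inv)
    then have "\<phi> \<delta>' x = \<phi> \<epsilon> (\<phi> \<delta> x)" using \<epsilon>(2) u(1) y(2) \<delta> by metis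
    then have "\<phi> \<delta>' x = \<phi> (\<epsilon> \<otimes> \<delta>) x" using \<epsilon>(1) \<delta> x by (simp add: composition_rule)
    then have "\<delta>' = \<epsilon> \<otimes> \<delta>" using \<epsilon>(1) \<delta> x by (intro free\<^sub>2_eq) auto
    then have "\<delta>' \<otimes> inv \<delta> = \<epsilon>" using \<epsilon>(1) \<delta> by (simp add: m_assoc)
    then show ?thesis using \<epsilon>(2) tt by auto
  qed
  ultimately show ?thesis by (intro exI[of _ ?\<kappa>] exI[of _ ?F] conjI ballI impI)
qed

end

context tree_action begin

text \<open>
  If the degrees are at most \<open>d\<close>, this is a common multiple of the numbers \<open>num_classes \<Gamma> (ball_verts R v)\<close>:
  by \<open>num_classes_ball\<close> below, the number of double cosets of \<open>\<Gamma>\<close> and the stabiliser of the ball around \<open>v\<close> is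
  the product of the index of the latter in the stabiliser of \<open>v\<close>, which divides the first factor, and
  of \<open>num_classes \<Gamma> {v}\<close>, which divides the second.
\<close>

definition common_multiple :: "nat \<Rightarrow> nat \<Rightarrow> 'g set \<Rightarrow> nat" where
  "common_multiple R d \<Gamma> = fact d ^ (\<Sum>r<R. d ^ r) * Lcm ((\<lambda>v. num_classes \<Gamma> {v}) ` verts T)"

context
  fixes \<Gamma> :: "'g set" and R d :: nat
  assumes \<Gamma>: "subgroup \<Gamma> G" and free: "semiregular \<Gamma>"
    and fin: "finite (orbit_of \<Gamma> ` verts T)" and R: "R \<ge> 1"
    and deg: "\<And>u. u \<in> verts T \<Longrightarrow> finite (out_arcs T u) \<and> out_degree T u \<le> d"
begin

lemma num_classes_vertex_bounds:
  assumes "v \<in> verts T"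
  shows "num_classes \<Gamma> {v} > 0" "num_classes \<Gamma> {v} \<le> card (orbit_of \<Gamma> ` verts T)"
proof -
  have "orbit_of (carrier G) v \<subseteq> verts T" "v \<in> orbit_of (carrier G) v"
    using orbit_of_subset orbit_of_self subgroup_self assms by auto
  then have "orbit_of \<Gamma> ` orbit_of (carrier G) v \<subseteq> orbit_of \<Gamma> ` verts T"
    "orbit_of \<Gamma> ` orbit_of (carrier G) v \<noteq> {}" by auto
  then show "num_classes \<Gamma> {v} > 0" "num_classes \<Gamma> {v} \<le> card (orbit_of \<Gamma> ` verts T)"
    unfolding num_classes_eq_orbits[OF \<Gamma> assms] using fin
    by (auto simp: card_gt_0_iff finite_subset intro: card_mono)
qed

lemma num_ext_ball_pos: "v \<in> verts T \<Longrightarrow> num_ext {v} (ball_verts R v) > 0"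
  using num_ext_ball_dvd[OF deg, of v R] by (auto intro!: Nat.gr0I)

lemma num_classes_ball:
  assumes v: "v \<in> verts T"
  shows "num_classes \<Gamma> (ball_verts R v) = num_ext {v} (ball_verts R v) * num_classes \<Gamma> {v}"
  using num_classes_vertex_bounds(1)[OF v] num_ext_ball_pos[OF v] v centre_in_ball ball_verts_subset
  by (intro num_classes_mult[OF \<Gamma> free]) auto

lemma num_classes_ball_pos: "v \<in> verts T \<Longrightarrow> num_classes \<Gamma> (ball_verts R v) > 0"
  by (simp add: num_classes_ball num_ext_ball_pos num_classes_vertex_bounds(1))

lemma finite_num_classes: "finite ((\<lambda>v. num_classes \<Gamma> {v}) ` verts T)"
  using num_classes_vertex_bounds(2) by (auto simp: finite_nat_set_iff_bounded_le)

lemma common_multiple_pos: "common_multiple R d \<Gamma> > 0"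
proof -
  have "Lcm ((\<lambda>v. num_classes \<Gamma> {v}) ` verts T) \<noteq> 0"
    unfolding Lcm_0_iff_nat[OF finite_num_classes] using num_classes_vertex_bounds(1) by force
  then show ?thesis by (simp add: common_multiple_def)
qed

lemma num_classes_dvd_common_multiple:
  assumes v: "v \<in> verts T"
  shows "num_classes \<Gamma> (ball_verts R v) dvd common_multiple R d \<Gamma>"
  unfolding num_classes_ball[OF v] common_multiple_def
  using num_ext_ball_dvd[OF deg v] v by (intro mult_dvd_mono dvd_Lcm) auto

lemma num_classes_edge:
  assumes e: "e \<in> arcs T"
  shows "num_ext (edge_nbhd R e) (ball_verts R (tail T e)) > 0"
    and "num_classes \<Gamma> (edge_nbhd R e) > 0"
    and "num_classes \<Gamma> (ball_verts R (tail T e)) =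
      num_ext (edge_nbhd R e) (ball_verts R (tail T e)) * num_classes \<Gamma> (edge_nbhd R e)"
proof -
  let ?t = "tail T e"
  have t: "?t \<in> verts T" "?t \<in> edge_nbhd R e" using ends_in_edge_nbhd[OF R e] e by auto
  show 1: "num_ext (edge_nbhd R e) (ball_verts R ?t) > 0"
    by (rule num_ext_pos[OF _ _ _ num_ext_ball_pos[OF t(1)]]) (use t edge_nbhd_subset ball_verts_subset in \<open>auto\<close>)
  have 2: "num_ext {?t} (edge_nbhd R e) > 0"
    by (rule num_ext_pos[OF _ _ _ num_ext_ball_pos[OF t(1)]]) (use t edge_nbhd_subset ball_verts_subset in \<open>auto\<close>)
  have "num_classes \<Gamma> (edge_nbhd R e) = num_ext {?t} (edge_nbhd R e) * num_classes \<Gamma> {?t}"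
    using num_classes_vertex_bounds(1)[OF t(1)] 2 t edge_nbhd_subset
    by (intro num_classes_mult[OF \<Gamma> free]) auto
  then show 3: "num_classes \<Gamma> (edge_nbhd R e) > 0"
    using 2 num_classes_vertex_bounds(1)[OF t(1)] by simp
  show "num_classes \<Gamma> (ball_verts R ?t) =
      num_ext (edge_nbhd R e) (ball_verts R ?t) * num_classes \<Gamma> (edge_nbhd R e)"
    using 1 3 t edge_nbhd_subset ball_verts_subset by (intro num_classes_mult[OF \<Gamma> free]) auto
qed

text \<open>
  \<open>num_classes \<Gamma> {v}\<close> is the number of \<open>\<Gamma>\<close>-orbits in the \<open>G\<close>-orbit of \<open>v\<close>. So there is one such number for each
  \<open>G\<close>-orbit of vertices, and their sum is the total number of \<open>\<Gamma>\<close>-orbits.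
\<close>

lemma Lcm_num_classes_le:
  assumes V: "2 * card (orbit_of \<Gamma> ` verts T) \<le> V"
  shows "real (Lcm ((\<lambda>v. num_classes \<Gamma> {v}) ` verts T)) \<le> exp (2 * sqrt (real V * ln (real V)))"
proof -
  let ?I = "orbit_of (carrier G) ` verts T"
  have eq: "(\<lambda>v. num_classes \<Gamma> {v}) ` verts T = (\<lambda>A. card (orbit_of \<Gamma> ` A)) ` ?I"
    using num_classes_eq_orbits[OF \<Gamma>] by (auto simp: image_image)
  have "card (orbit_of \<Gamma> ` verts T) > 0" using fin verts_nonempty by (simp add: card_gt_0_iff)
  then have V2: "V \<ge> 2" using V by simp
  show ?thesis
    unfolding eq
  proof (rule Lcm_le_exp_sqrt)
    show "finite ?I" using orbits_of_subgroup(1)[OF \<Gamma> fin] .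
    show "2 * (\<Sum>A\<in>?I. card (orbit_of \<Gamma> ` A)) \<le> V"
      using V unfolding orbits_of_subgroup(2)[OF \<Gamma> fin] .
    fix A assume "A \<in> ?I"
    then obtain v where "v \<in> verts T" "A = orbit_of (carrier G) v" by blast
    then show "card (orbit_of \<Gamma> ` A) > 0"
      using num_classes_vertex_bounds(1)[of v] num_classes_eq_orbits[OF \<Gamma>, of v] by simp
  qed (use V2 in auto)
qed

lemma common_multiple_le:
  assumes V: "2 * card (orbit_of \<Gamma> ` verts T) \<le> V"
  shows "real (common_multiple R d \<Gamma>) \<le> fact d ^ (4 * d ^ (R - 1)) * exp (2 * sqrt (real V * ln (real V)))"
proof -
  have "real (fact d ^ (\<Sum>r<R. d ^ r)) \<le> real (fact d ^ (4 * d ^ (R - 1)))"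
    using fact_power_le[OF R, of d] by (simp only: of_nat_le_iff)
  then show ?thesis
    unfolding common_multiple_def of_nat_mult using Lcm_num_classes_le[OF V] by (intro mult_mono) auto
qed

end

text \<open>
  For \<open>\<Gamma>\<close> equal to \<open>\<Gamma>\<^sub>1\<close> or \<open>\<Gamma>\<^sub>2\<close> and \<open>L = common_multiple R d \<Gamma>\<close>, the weight
  \<open>w v = L / num_classes \<Gamma> (ball_verts R v)\<close> is balanced along each arc \<open>e\<close>, since \<open>w\<close> at either end times the number of extensions to the ball there is \<open>L / num_classes \<Gamma> (edge_nbhd R e)\<close>.
  Taking the group with fewer orbits, at most \<open>V / 2\<close>, makes the bound for the least common
  multiple applicable with \<open>V\<close>. The number of types of states over \<open>v\<close> is \<open>L\<close> if \<open>\<Gamma> = \<Gamma>\<^sub>2\<close>, and at most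
  \<open>num_classes \<Gamma>\<^sub>2 {v} * L \<le> V * L\<close> if \<open>\<Gamma> = \<Gamma>\<^sub>1\<close>.
\<close>

lemma ex_gluing_weight:
  assumes \<Gamma>\<^sub>1: "subgroup \<Gamma>\<^sub>1 G" and free\<^sub>1: "semiregular \<Gamma>\<^sub>1"
    and fin\<^sub>1: "finite (orbit_of \<Gamma>\<^sub>1 ` verts T)"
    and \<Gamma>\<^sub>2: "subgroup \<Gamma>\<^sub>2 G" and free\<^sub>2: "semiregular \<Gamma>\<^sub>2"
    and fin\<^sub>2: "finite (orbit_of \<Gamma>\<^sub>2 ` verts T)"
    and R: "R \<ge> 1" and deg: "\<And>u. u \<in> verts T \<Longrightarrow> finite (out_arcs T u) \<and> out_degree T u \<le> d"
    and V: "V = card (orbit_of \<Gamma>\<^sub>1 ` verts T) + card (orbit_of \<Gamma>\<^sub>2 ` verts T)"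
  shows "\<exists>w. gluing T arev G \<phi> \<psi> \<Gamma>\<^sub>1 \<Gamma>\<^sub>2 R w \<and>
    (\<forall>v\<in>verts T. real (num_classes \<Gamma>\<^sub>2 (ball_verts R v) * w v)
       \<le> fact d ^ (4 * d ^ (R - 1)) * real V ^ 2 * exp (2 * sqrt (real V * ln (real V))))"
proof -
  define \<Gamma> where "\<Gamma> = (if card (orbit_of \<Gamma>\<^sub>1 ` verts T) \<le> card (orbit_of \<Gamma>\<^sub>2 ` verts T) then \<Gamma>\<^sub>1 else \<Gamma>\<^sub>2)"
  have \<Gamma>: "subgroup \<Gamma> G" "semiregular \<Gamma>"
    "finite (orbit_of \<Gamma> ` verts T)" and V': "2 * card (orbit_of \<Gamma> ` verts T) \<le> V"
    using \<Gamma>\<^sub>1 free\<^sub>1 fin\<^sub>1 \<Gamma>\<^sub>2 free\<^sub>2 fin\<^sub>2 V by (auto simp: \<Gamma>_def split: if_splits)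
  let ?N = "\<lambda>v. num_classes \<Gamma> (ball_verts R v)" and ?L = "common_multiple R d \<Gamma>"
  define w where "w v = ?L div ?N v" for v
  have w: "w v * ?N v = ?L" if "v \<in> verts T" for v
    using num_classes_dvd_common_multiple[OF \<Gamma> R deg that] by (simp add: w_def)
  have L_pos: "?L > 0" by (rule common_multiple_pos[OF \<Gamma> R deg])
  have w_ext: "w (tail T e) * num_ext (edge_nbhd R e) (ball_verts R (tail T e)) * num_classes \<Gamma> (edge_nbhd R e) = ?L"
    if "e \<in> arcs T" for e
    using w[of "tail T e"] that num_classes_edge(3)[OF \<Gamma> R deg that] by (simp add: mult_ac)
  have "gluing T arev G \<phi> \<psi> \<Gamma>\<^sub>1 \<Gamma>\<^sub>2 R w"
  proof (intro gluing.intro gluing_axioms.intro tree_action_axioms)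
    show "subgroup \<Gamma>\<^sub>1 G" by (rule \<Gamma>\<^sub>1)
    show "subgroup \<Gamma>\<^sub>2 G" by (rule \<Gamma>\<^sub>2)
    show "1 \<le> R" by (rule R)
    show "semiregular \<Gamma>\<^sub>1" by (rule free\<^sub>1)
    show "semiregular \<Gamma>\<^sub>2" by (rule free\<^sub>2)
    show "w v > 0" if "v \<in> verts T" for v using w[OF that] L_pos by (intro Nat.gr0I) auto
    show "w (\<phi> h v) = w v" if "h \<in> carrier G" "v \<in> verts T" for h v
      using that \<Gamma>(1) by (simp add: w_def ball_verts_image num_classes_translate ball_verts_subset)
    show "num_ext (edge_nbhd R e) (ball_verts R (tail T e)) > 0" if "e \<in> arcs T" for e
      using num_classes_edge(1)[OF \<Gamma> R deg that] .
    show "w (tail T e) * num_ext (edge_nbhd R e) (ball_verts R (tail T e)) =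
        w (head T e) * num_ext (edge_nbhd R e) (ball_verts R (head T e))" if e: "e \<in> arcs T" for e
      using w_ext[OF e] w_ext[of "arev e"] num_classes_edge(2)[OF \<Gamma> R deg e] e
      by (simp add: edge_nbhd_arev) (metis mult_right_cancel neq0_conv)
  qed
  moreover have "real (num_classes \<Gamma>\<^sub>2 (ball_verts R v) * w v)
       \<le> fact d ^ (4 * d ^ (R - 1)) * real V ^ 2 * exp (2 * sqrt (real V * ln (real V)))"
    if v: "v \<in> verts T" for v
  proof -
    have V_pos: "V \<ge> 1"
      using V fin\<^sub>1 verts_nonempty by (metis One_nat_def Suc_leI add_gr_0 card_gt_0_iff image_is_empty)
    have "num_classes \<Gamma>\<^sub>2 (ball_verts R v) * w v \<le> V * ?L"
    proof (cases "\<Gamma> = \<Gamma>\<^sub>2")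
      case True
      have "num_classes \<Gamma>\<^sub>2 (ball_verts R v) * w v = ?L" using w[OF v] True by (simp add: mult.commute)
      also have "\<dots> \<le> V * ?L" using V_pos by simp
      finally show ?thesis .
    next
      case False
      then have [simp]: "\<Gamma> = \<Gamma>\<^sub>1" by (auto simp: \<Gamma>_def split: if_splits)
      let ?k = "num_ext {v} (ball_verts R v)"
      have "w v * (?k * num_classes \<Gamma>\<^sub>1 {v}) = ?L"
        using w[OF v] num_classes_ball[OF \<Gamma> R deg v] by simp
      then have "w v * ?k \<le> ?L"
        using num_classes_vertex_bounds(1)[OF \<Gamma> R deg v]
        by (metis \<open>\<Gamma> = \<Gamma>\<^sub>1\<close> L_pos dvd_imp_le dvd_triv_left mult.assoc)
      moreover have "num_classes \<Gamma>\<^sub>2 {v} \<le> V"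
        using num_classes_vertex_bounds(2)[OF \<Gamma>\<^sub>2 free\<^sub>2 fin\<^sub>2 R deg v] V by simp
      ultimately have "num_classes \<Gamma>\<^sub>2 {v} * (w v * ?k) \<le> V * ?L" by (rule mult_le_mono[rotated])
      then show ?thesis
        using num_classes_ball[OF \<Gamma>\<^sub>2 free\<^sub>2 fin\<^sub>2 R deg v] by (simp add: mult_ac)
    qed
    also have "V * ?L \<le> V ^ 2 * ?L" using V_pos by (simp add: power2_eq_square)
    finally have "real (num_classes \<Gamma>\<^sub>2 (ball_verts R v) * w v) \<le> real (V ^ 2 * ?L)"
      by (simp only: of_nat_le_iff)
    also have "\<dots> = real V ^ 2 * real ?L" by simp
    also have "\<dots> \<le> real V ^ 2 * (fact d ^ (4 * d ^ (R - 1)) * exp (2 * sqrt (real V * ln (real V))))"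
      by (intro mult_left_mono common_multiple_le[OF \<Gamma> R deg V']) auto
    finally show ?thesis by (simp add: mult_ac)
  qed
  ultimately show ?thesis by blast
qed

end

section \<open>The automorphism group of a tree\<close>

lemma card_image_le_if_factors:
  assumes "finite F" "\<And>x. x \<in> S \<Longrightarrow> \<kappa> x \<in> F" "\<And>x y. x \<in> S \<Longrightarrow> y \<in> S \<Longrightarrow> \<kappa> x = \<kappa> y \<Longrightarrow> f x = f y"
  shows "finite (f ` S)" "card (f ` S) \<le> card F"
proof -
  have sub: "f ` S \<subseteq> (\<lambda>c. f (inv_into S \<kappa> c)) ` F"
  proof (rule image_subsetI)
    fix x assume x: "x \<in> S"
    then have "\<kappa> x \<in> \<kappa> ` S" by simp
    have "f x = f (inv_into S \<kappa> (\<kappa> x))"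
      by (rule assms(3)[OF x inv_into_into[OF \<open>\<kappa> x \<in> \<kappa> ` S\<close>]]) (simp add: f_inv_into_f[OF \<open>\<kappa> x \<in> \<kappa> ` S\<close>])
    then show "f x \<in> (\<lambda>c. f (inv_into S \<kappa> c)) ` F" using assms(2)[OF x] by (rule image_eqI)
  qed
  show "finite (f ` S)" using sub assms(1) by (meson finite_imageI finite_subset)
  have "card (f ` S) \<le> card ((\<lambda>c. f (inv_into S \<kappa> c)) ` F)"
    using sub assms(1) by (intro card_mono) auto
  also have "\<dots> \<le> card F" using assms(1) by (rule card_image_le)
  finally show "card (f ` S) \<le> card F" .
qed

text \<open>
  A classification of \<open>K\<close> whose classes lie in single cosets of \<open>L\<close> bounds the index of \<open>L\<close>.
\<close>

lemma (in group) rcosets_le_classes: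
  assumes L: "subgroup L G" and K: "K \<subseteq> carrier G"
    and F: "finite F" "\<And>k. k \<in> K \<Longrightarrow> \<kappa> k \<in> F"
    and same: "\<And>k k'. k \<in> K \<Longrightarrow> k' \<in> K \<Longrightarrow> \<kappa> k = \<kappa> k' \<Longrightarrow> k' \<otimes> inv k \<in> L"
  shows "finite (rcosets\<^bsub>G\<lparr>carrier := K\<rparr>\<^esub> L)" "card (rcosets\<^bsub>G\<lparr>carrier := K\<rparr>\<^esub> L) \<le> card F"
proof -
  have eq: "rcosets\<^bsub>G\<lparr>carrier := K\<rparr>\<^esub> L = (\<lambda>k. L #> k) ` K"
    by (auto simp: RCOSETS_def r_coset_def)
  have "L #> k = L #> k'" if "k \<in> K" "k' \<in> K" "\<kappa> k = \<kappa> k'" for k k'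
  proof (rule repr_independence[OF _ _ L])
    have kc: "k \<in> carrier G" "k' \<in> carrier G" using that K by auto
    then have "k' = (k' \<otimes> inv k) \<otimes> k" by (simp add: m_assoc)
    then show "k' \<in> L #> k" using rcosI[OF same[OF that] subgroup.subset[OF L] kc(1)] by simp
    show "k \<in> carrier G" by (rule kc(1))
  qed
  note bound = card_image_le_if_factors[of F K \<kappa> "\<lambda>k. L #> k", OF F this]
  show "finite (rcosets\<^bsub>G\<lparr>carrier := K\<rparr>\<^esub> L)" unfolding eq by (rule bound(1))
  show "card (rcosets\<^bsub>G\<lparr>carrier := K\<rparr>\<^esub> L) \<le> card F" unfolding eq by (rule bound(2))
qed

lemma (in group) conjugate_subgroup_eq:
  assumes "g \<in> carrier G" "K \<subseteq> carrier G"
  shows "conjugate_subgroup G g K = (\<lambda>k. g \<otimes> k \<otimes> inv g) ` K"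
  by (auto simp: conjugate_subgroup_def l_coset_def r_coset_def)

lemma (in group) subgroup_conjugate:
  assumes g: "g \<in> carrier G" and K: "subgroup K G"
  shows "subgroup (conjugate_subgroup G g K) G"
proof -
  interpret K: subgroup K G by fact
  note eq = conjugate_subgroup_eq[OF g K.subset]
  show ?thesis
    unfolding eq
  proof (rule subgroupI)
    show "(\<lambda>k. g \<otimes> k \<otimes> inv g) ` K \<subseteq> carrier G" using g by auto
    show "(\<lambda>k. g \<otimes> k \<otimes> inv g) ` K \<noteq> {}" using K.one_closed by blast
    fix a assume "a \<in> (\<lambda>k. g \<otimes> k \<otimes> inv g) ` K"
    then obtain k where k: "k \<in> K" "a = g \<otimes> k \<otimes> inv g" by blast
    have "inv a = g \<otimes> inv k \<otimes> inv g" using k g by (simp add: inv_mult_group m_assoc)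
    then show "inv a \<in> (\<lambda>k. g \<otimes> k \<otimes> inv g) ` K" using k(1) by (intro image_eqI[of _ _ "inv k"]) auto
    fix b assume "b \<in> (\<lambda>k. g \<otimes> k \<otimes> inv g) ` K"
    then obtain l where l: "l \<in> K" "b = g \<otimes> l \<otimes> inv g" by blast
    have "a \<otimes> b = g \<otimes> (k \<otimes> l) \<otimes> inv g"
    proof -
      have "inv g \<otimes> (g \<otimes> (l \<otimes> inv g)) = l \<otimes> inv g" using l g by (simp flip: m_assoc)
      then show ?thesis using k l g by (simp add: m_assoc)
    qed
    then show "a \<otimes> b \<in> (\<lambda>k. g \<otimes> k \<otimes> inv g) ` K" using k(1) l(1) by (intro image_eqI[of _ _ "k \<otimes> l"]) auto
  qed
qed

lemma carrier_BijGroup: "carrier (BijGroup S) = Bij S"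
  by (simp add: BijGroup_def)

lemma BijGroup_mult: "f \<in> Bij S \<Longrightarrow> k \<in> Bij S \<Longrightarrow> f \<otimes>\<^bsub>BijGroup S\<^esub> k = compose S f k"
  by (simp add: BijGroup_def)

lemma BijD: "f \<in> Bij S \<Longrightarrow> x \<in> S \<Longrightarrow> f x \<in> S"
  using Bij_imp_funcset by blast

context bidirected_digraph begin

lemma automorphismsI:
  assumes "f \<in> Bij (verts G)" "k \<in> Bij (arcs G)"
    and "\<And>e. e \<in> arcs G \<Longrightarrow> tail G (k e) = f (tail G e)"
    and "\<And>e. e \<in> arcs G \<Longrightarrow> k (arev e) = arev (k e)"
  shows "(f, k) \<in> automorphisms G arev"
proof -
  have "head G (k e) = f (head G e)" if "e \<in> arcs G" for e
    using assms(3)[of "arev e"] assms(4)[of e] that BijD[OF assms(2)] by (metis arev_in_arcs tail_arev)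
  then show ?thesis using assms by (simp add: automorphisms_def)
qed

lemma automorphismsD:
  assumes "a \<in> automorphisms G arev"
  shows "fst a \<in> Bij (verts G)" "snd a \<in> Bij (arcs G)"
    "\<And>e. e \<in> arcs G \<Longrightarrow> snd a e \<in> arcs G"
    "\<And>e. e \<in> arcs G \<Longrightarrow> tail G (snd a e) = fst a (tail G e)"
    "\<And>e. e \<in> arcs G \<Longrightarrow> head G (snd a e) = fst a (head G e)"
    "\<And>e. e \<in> arcs G \<Longrightarrow> snd a (arev e) = arev (snd a e)"
    "\<And>v. v \<in> verts G \<Longrightarrow> fst a v \<in> verts G"
  using assms BijD[of "snd a" "arcs G"] BijD[of "fst a" "verts G"] by (auto simp: automorphisms_def)

lemma automorphisms_subgroup:
  "subgroup (automorphisms G arev) (BijGroup (verts G) \<times>\<times> BijGroup (arcs G))"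
proof -
  let ?V = "BijGroup (verts G)" and ?A = "BijGroup (arcs G)"
  interpret V: group ?V by (rule group_BijGroup)
  interpret A: group ?A by (rule group_BijGroup)
  interpret P: group "?V \<times>\<times> ?A" by (rule DirProd_group[OF V.group_axioms A.group_axioms])
  have B: "fst a \<in> Bij (verts G)" "snd a \<in> Bij (arcs G)" if "a \<in> automorphisms G arev" for a
    using that by (auto simp: automorphisms_def)
  show ?thesis
  proof (rule P.subgroupI)
    show "automorphisms G arev \<subseteq> carrier (?V \<times>\<times> ?A)"
      by (auto simp: automorphisms_def DirProd_def BijGroup_def)
    have "(\<lambda>x\<in>verts G. x, \<lambda>x\<in>arcs G. x) \<in> automorphisms G arev"
      by (rule automorphismsI) (auto simp: id_Bij)
    then show "automorphisms G arev \<noteq> {}" by blast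
    fix a assume a: "a \<in> automorphisms G arev"
    obtain f k where fk: "a = (f, k)" by (cases a)
    have f: "f \<in> Bij (verts G)" and k: "k \<in> Bij (arcs G)" using B[OF a] fk by auto
    let ?f = "restrict (inv_into (verts G) f) (verts G)" and ?k = "restrict (inv_into (arcs G) k) (arcs G)"
    have inv: "inv\<^bsub>?V \<times>\<times> ?A\<^esub> a = (?f, ?k)"
      unfolding fk using inv_DirProd[OF V.group_axioms A.group_axioms, of f k] f k
      by (simp add: carrier_BijGroup inv_BijGroup)
    have k': "?k e \<in> arcs G \<and> k (?k e) = e" if "e \<in> arcs G" for e
      using that k by (auto simp: Bij_def bij_betw_def f_inv_into_f inv_into_into)
    have f': "?f (f v) = v" if "v \<in> verts G" for v
      using that f by (auto simp: Bij_def bij_betw_def)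
    have k'': "?k (k e) = e" if "e \<in> arcs G" for e
      using that k by (auto simp: Bij_def bij_betw_def)
    show "inv\<^bsub>?V \<times>\<times> ?A\<^esub> a \<in> automorphisms G arev"
      unfolding inv
    proof (rule automorphismsI)
      show "?f \<in> Bij (verts G)" "?k \<in> Bij (arcs G)" using f k by (auto intro: restrict_inv_into_Bij)
      fix e assume e: "e \<in> arcs G"
      have "f (tail G (?k e)) = tail G e" "k (arev (?k e)) = arev e"
        using a k'[OF e] unfolding fk automorphisms_def by fastforce+
      then show "tail G (?k e) = ?f (tail G e)" "?k (arev e) = arev (?k e)"
        using f'[of "tail G (?k e)"] k''[of "arev (?k e)"] k'[OF e] by auto
    qed
    fix b assume b: "b \<in> automorphisms G arev"
    have "a \<otimes>\<^bsub>?V \<times>\<times> ?A\<^esub> b = (compose (verts G) (fst a) (fst b), compose (arcs G) (snd a) (snd b))"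
      unfolding mult_DirProd' using B[OF a] B[OF b] by (simp add: BijGroup_mult)
    also have "\<dots> \<in> automorphisms G arev"
    proof (rule automorphismsI)
      show "compose (verts G) (fst a) (fst b) \<in> Bij (verts G)" "compose (arcs G) (snd a) (snd b) \<in> Bij (arcs G)"
        using B[OF a] B[OF b] by (auto intro: compose_Bij)
      fix e assume e: "e \<in> arcs G"
      have sb: "snd b e \<in> arcs G" by (rule automorphismsD(3)[OF b e])
      show "tail G (compose (arcs G) (snd a) (snd b) e) = compose (verts G) (fst a) (fst b) (tail G e)"
        using automorphismsD(4)[OF a sb] automorphismsD(4)[OF b e] e
        by (simp add: compose_eq)
      show "compose (arcs G) (snd a) (snd b) (arev e) = arev (compose (arcs G) (snd a) (snd b) e)"
        using automorphismsD(6)[OF a sb] automorphismsD(6)[OF b e] e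
        by (simp add: compose_eq)
    qed
    finally show "a \<otimes>\<^bsub>?V \<times>\<times> ?A\<^esub> b \<in> automorphisms G arev" .
  qed
qed

lemma group_Aut: "group (Aut G arev)"
  unfolding Aut_def
  by (intro group.subgroup_imp_group automorphisms_subgroup DirProd_group group_BijGroup)

lemma carrier_Aut: "carrier (Aut G arev) = automorphisms G arev"
  by (simp add: Aut_def)

lemma mult_Aut:
  assumes "a \<in> automorphisms G arev" "b \<in> automorphisms G arev"
  shows "a \<otimes>\<^bsub>Aut G arev\<^esub> b = (compose (verts G) (fst a) (fst b), compose (arcs G) (snd a) (snd b))"
  using assms by (simp add: Aut_def mult_DirProd' BijGroup_mult automorphisms_def mem_Times_iff)

end

lemma orbit_eq_image: "Group_Action.orbit (G\<lparr>carrier := K\<rparr>) \<phi> x = (\<lambda>g. \<phi> g x) ` K"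
  by (simp add: Group_Action.orbit_def Setcompr_eq_image)

text \<open>
  The last claim holds because an arc at \<open>u\<close> is determined by its \<open>\<Gamma>\<close>-orbit, \<open>\<Gamma>\<close> being free.
\<close>

lemma free_uniform_lattice_action:
  assumes "bidirected_tree T arev" "subgroup H (Aut T arev)" "free_uniform_lattice T arev \<Gamma>" "\<Gamma> \<subseteq> H"
    and act: "tree_action T arev (Aut T arev\<lparr>carrier := H\<rparr>) fst snd"
  shows "subgroup \<Gamma> (Aut T arev\<lparr>carrier := H\<rparr>)"
    and "acting_group.semiregular (Aut T arev\<lparr>carrier := H\<rparr>) (verts T) fst \<Gamma>"
    and "verts (quotient_graph T arev \<Gamma>) = acting_group.orbit_of fst \<Gamma> ` verts T"
    and "finite (acting_group.orbit_of fst \<Gamma> ` verts T)"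
    and "u \<in> verts T \<Longrightarrow> finite (out_arcs T u) \<and> out_degree T u \<le> card (arcs (quotient_graph T arev \<Gamma>))"
proof -
  interpret tree_action T arev "Aut T arev\<lparr>carrier := H\<rparr>" fst snd by (rule act)
  interpret A: group "Aut T arev" by (rule group_Aut)
  have sub: "subgroup \<Gamma> (Aut T arev)" and free: "acts_freely T arev \<Gamma>"
    and fin: "fin_digraph (quotient_graph T arev \<Gamma>)"
    using assms(3) by (auto simp: free_uniform_lattice_def)
  show "subgroup \<Gamma> (Aut T arev\<lparr>carrier := H\<rparr>)"
    using A.subgroup_incl[OF sub assms(2,4)] .
  have one: "g = \<one>\<^bsub>Aut T arev\<^esub>" if "g \<in> \<Gamma>" "v \<in> verts T" "fst g v = v" for g v
    using free that unfolding acts_freely_def by blast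
  then show "semiregular \<Gamma>" by (simp add: semiregular_def)
  show orb: "verts (quotient_graph T arev \<Gamma>) = orbit_of \<Gamma> ` verts T"
    by (auto simp: quotient_graph_def orbits_def orbit_eq_image orbit_of_def)
  show "finite (orbit_of \<Gamma> ` verts T)"
    using fin_digraph.finite_verts[OF fin] unfolding orb .
  assume u: "u \<in> verts T"
  let ?o = "\<lambda>e. Group_Action.orbit (Aut T arev\<lparr>carrier := \<Gamma>\<rparr>) snd e"
  have inj: "inj_on ?o (out_arcs T u)"
  proof (rule inj_onI)
    fix e e' assume e: "e \<in> out_arcs T u" "e' \<in> out_arcs T u" and eq: "?o e = ?o e'"
    have "e' \<in> ?o e'"
    proof -
      have "\<one>\<^bsub>Aut T arev\<^esub> \<in> \<Gamma>" using sub by (rule subgroup.one_closed)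
      moreover have "snd \<one>\<^bsub>Aut T arev\<^esub> e' = e'" using arc_one[of e'] e(2) by simp
      ultimately show ?thesis unfolding orbit_eq_image by (intro image_eqI[of _ _ "\<one>\<^bsub>Aut T arev\<^esub>"]) auto
    qed
    then have "e' \<in> (\<lambda>g. snd g e) ` \<Gamma>" unfolding eq[symmetric] by (simp only: orbit_eq_image)
    then obtain g where g: "g \<in> \<Gamma>" "e' = snd g e" by (elim imageE)
    have "fst g u = u" using tail_arc[of g e] g e assms(4) by auto
    then have "g = \<one>\<^bsub>Aut T arev\<^esub>" using one g u by blast
    then show "e = e'" using g(2) arc_one[of e] e(1) by simp
  qed
  have sub_arcs: "?o ` out_arcs T u \<subseteq> arcs (quotient_graph T arev \<Gamma>)"
    by (auto simp: quotient_graph_def orbits_def)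
  have finA: "finite (arcs (quotient_graph T arev \<Gamma>))" by (rule fin_digraph.finite_arcs[OF fin])
  show "finite (out_arcs T u) \<and> out_degree T u \<le> card (arcs (quotient_graph T arev \<Gamma>))"
    using inj_on_finite[OF inj sub_arcs finA] card_inj_on_le[OF inj sub_arcs finA]
    by (simp add: out_degree_def)
qed

lemma tree_action_Aut:
  assumes "bidirected_tree T arev" and H: "subgroup H (Aut T arev)"
  shows "tree_action T arev (Aut T arev\<lparr>carrier := H\<rparr>) fst snd"
proof -
  interpret B: bidirected_digraph T arev using assms(1) by (simp add: bidirected_tree_def)
  interpret A: group "Aut T arev" by (rule B.group_Aut)
  interpret AH: group "Aut T arev\<lparr>carrier := H\<rparr>" by (rule A.subgroup_imp_group[OF H])
  have HA: "h \<in> automorphisms T arev" if "h \<in> H" for h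
    using subgroup.subset[OF H] that by (auto simp: B.carrier_Aut)
  show ?thesis
  proof (intro tree_action.intro bidirected_tree_graph.intro bidirected_tree_graph_axioms.intro
      acting_group.intro group_action.intro tree_action_axioms.intro
      B.bidirected_digraph_axioms AH.group_axioms)
    show "connected T" using assms(1) by (simp add: bidirected_tree_def)
    show "\<not> (\<exists>p. pre_digraph.cycle T p \<and> no_backtracking arev p)"
      using assms(1) by (simp add: bidirected_tree_def)
    show "group_hom (Aut T arev\<lparr>carrier := H\<rparr>) (BijGroup (verts T)) fst"
    proof (intro group_hom.intro group_hom_axioms.intro AH.group_axioms group_BijGroup homI)
      fix a b assume a: "a \<in> carrier (Aut T arev\<lparr>carrier := H\<rparr>)" and b: "b \<in> carrier (Aut T arev\<lparr>carrier := H\<rparr>)"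
      show "fst a \<in> carrier (BijGroup (verts T))"
        using B.automorphismsD(1)[OF HA] a by (simp add: carrier_BijGroup)
      show "fst (a \<otimes>\<^bsub>Aut T arev\<lparr>carrier := H\<rparr>\<^esub> b) = fst a \<otimes>\<^bsub>BijGroup (verts T)\<^esub> fst b"
        using a b HA B.automorphismsD(1)[OF HA] by (simp add: B.mult_Aut BijGroup_mult)
    qed
  qed (use B.automorphismsD HA in auto)
qed

section \<open>Commensurability of lattices\<close>

theorem theorem6p4:
  fixes T :: "('v, 'e) pre_digraph" and arev :: "'e \<Rightarrow> 'e"
    and H \<Gamma>\<^sub>1 \<Gamma>\<^sub>2 :: "('v, 'e) graph_map set"
    and R V d :: nat
  assumes "bidirected_tree T arev"
    and "subgroup H (Aut T arev)"
    and "free_uniform_lattice T arev \<Gamma>\<^sub>1" and "\<Gamma>\<^sub>1 \<subseteq> H"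
    and "free_uniform_lattice T arev \<Gamma>\<^sub>2" and "\<Gamma>\<^sub>2 \<subseteq> H"
    and "R \<ge> 1"
    and "V = card (verts (quotient_graph T arev \<Gamma>\<^sub>1) <+> verts (quotient_graph T arev \<Gamma>\<^sub>2))"
    and "d = Max (out_degree T ` verts T)"
  shows "\<exists>g \<in> symmetry_restricted_closure T arev R H.
           commensurable (Aut T arev) (conjugate_subgroup (Aut T arev) g \<Gamma>\<^sub>1) \<Gamma>\<^sub>2 \<and>
           real (subgroup_index (Aut T arev) (conjugate_subgroup (Aut T arev) g \<Gamma>\<^sub>1)
                   (conjugate_subgroup (Aut T arev) g \<Gamma>\<^sub>1 \<inter> \<Gamma>\<^sub>2))
             \<le> fact d ^ (4 * d ^ (R - 1)) * real V ^ 2 * exp (2 * sqrt (real V * ln (real V)))"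
proof -
  let ?A = "Aut T arev" and ?G = "Aut T arev\<lparr>carrier := H\<rparr>"
  have act: "tree_action T arev ?G fst snd" by (rule tree_action_Aut[OF assms(1,2)])
  interpret tree_action T arev ?G fst snd by (rule act)
  interpret A: group ?A by (rule group_Aut)
  note L1 = free_uniform_lattice_action[OF assms(1,2,3,4) act] and L2 = free_uniform_lattice_action[OF assms(1,2,5,6) act]
  have H_aut: "h \<in> automorphisms T arev" if "h \<in> H" for h
    using subgroup.subset[OF assms(2)] that by (auto simp: carrier_Aut)
  have deg: "finite (out_arcs T u) \<and> out_degree T u \<le> d" if "u \<in> verts T" for u
  proof -
    have "finite (out_degree T ` verts T)"
      using L1(5) by (auto simp: finite_nat_set_iff_bounded_le)
    then show ?thesis using L1(5)[OF that] that assms(9) by simp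
  qed
  have V: "V = card (orbit_of \<Gamma>\<^sub>1 ` verts T) + card (orbit_of \<Gamma>\<^sub>2 ` verts T)"
    using L1(4) L2(4) unfolding assms(8) L1(3) L2(3) by (rule card_Plus)
  let ?bound = "fact d ^ (4 * d ^ (R - 1)) * real V ^ 2 * exp (2 * sqrt (real V * ln (real V)))"
  obtain w where w: "gluing T arev ?G fst snd \<Gamma>\<^sub>1 \<Gamma>\<^sub>2 R w"
    and bound: "\<And>v. v \<in> verts T \<Longrightarrow> real (num_classes \<Gamma>\<^sub>2 (ball_verts R v) * w v) \<le> ?bound"
    using ex_gluing_weight[OF L1(1,2,4) L2(1,2,4) assms(7) deg V] by blast
  obtain s where s: "local_section T arev ?G fst snd \<Gamma>\<^sub>1 \<Gamma>\<^sub>2 R w s"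
    using gluing.ex_local_section[OF w] by blast
  interpret S: local_section T arev ?G fst snd \<Gamma>\<^sub>1 \<Gamma>\<^sub>2 R w s by (rule s)
  \<comment> \<open>The conjugating element: the automorphism defined by the section \<open>s\<close> of glued states.\<close>
  define g where "g = (S.vert_map, S.arc_map)"
  have g: "g \<in> automorphisms T arev"
    unfolding g_def
  proof (rule automorphismsI)
    show "S.vert_map \<in> Bij (verts T)" "S.arc_map \<in> Bij (arcs T)"
      using S.maps_bij by (auto simp: Bij_def S.vert_map_def S.arc_map_def)
  qed (simp_all add: S.tail_arc_map S.arc_map_arev)
  have gA: "g \<in> carrier ?A" using g by (simp add: carrier_Aut)
  have closure: "g \<in> symmetry_restricted_closure T arev R H"
  proof -
    have ball: "verts (graph_ball T R v) = ball_verts R v" for v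
      by (simp add: graph_ball_def ball_verts_def)
    have "\<exists>h\<in>H. (\<forall>u\<in>verts (graph_ball T R v). fst h u = fst g u) \<and>
        (\<forall>e\<in>arcs (graph_ball T R v). snd h e = snd g e)" if v: "v \<in> verts T" for v
    proof (intro bexI conjI ballI)
      show "S.lift v \<in> H" using S.lift(1)[OF v] by simp
      show "fst (S.lift v) u = fst g u" if "u \<in> verts (graph_ball T R v)" for u
        using S.vert_map_local[of u v] that unfolding ball g_def by simp
      show "snd (S.lift v) e = snd g e" if "e \<in> arcs (graph_ball T R v)" for e
        using S.arc_map_local[OF _ v, of e] that
        by (simp add: g_def graph_ball_def ball_verts_def)
    qed
    then show ?thesis using gA by (simp add: symmetry_restricted_closure_def)
  qed
  have \<Gamma>\<^sub>1: "subgroup \<Gamma>\<^sub>1 ?A" and \<Gamma>\<^sub>2: "subgroup \<Gamma>\<^sub>2 ?A"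
    using assms(3,5) by (simp_all add: free_uniform_lattice_def)
  interpret \<Gamma>\<^sub>1: subgroup \<Gamma>\<^sub>1 ?A by (rule \<Gamma>\<^sub>1)
  interpret \<Gamma>\<^sub>2: subgroup \<Gamma>\<^sub>2 ?A by (rule \<Gamma>\<^sub>2)
  have inv_H: "inv\<^bsub>?G\<^esub> h = inv\<^bsub>?A\<^esub> h" if "h \<in> H" for h
    using A.m_inv_consistent[OF assms(2) that] .
  \<comment> \<open>Equality on vertices suffices, because arcs are determined by their ends.\<close>
  have intertwine: "g \<otimes>\<^bsub>?A\<^esub> \<gamma> \<otimes>\<^bsub>?A\<^esub> inv\<^bsub>?A\<^esub> g = \<delta>"
    if "\<gamma> \<in> \<Gamma>\<^sub>1" "\<delta> \<in> \<Gamma>\<^sub>2" and eq: "\<forall>u\<in>verts T. S.vert_map (fst \<gamma> u) = fst \<delta> (S.vert_map u)" for \<gamma> \<delta>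
  proof -
    have a: "\<gamma> \<in> automorphisms T arev" "\<delta> \<in> automorphisms T arev"
      using that(1,2) assms(4,6) by (blast intro: H_aut)+
    have "fst g (fst \<gamma> u) = fst \<delta> (fst g u)" if "u \<in> verts T" for u
      using eq that by (simp add: g_def)
    then have fst_eq: "compose (verts T) (fst g) (fst \<gamma>) = compose (verts T) (fst \<delta>) (fst g)"
      by (auto simp: compose_def restrict_eq_iff)
    have "snd g (snd \<gamma> e) = snd \<delta> (snd g e)" if e: "e \<in> arcs T" for e
      using \<open>\<And>u. u \<in> verts T \<Longrightarrow> fst g (fst \<gamma> u) = fst \<delta> (fst g u)\<close> e
        automorphismsD(3-5)[OF g] automorphismsD(3-5)[OF a(1)] automorphismsD(3-5)[OF a(2)]
      by (intro arc_eqI) simp_all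
    then have "compose (arcs T) (snd g) (snd \<gamma>) = compose (arcs T) (snd \<delta>) (snd g)"
      by (auto simp: compose_def restrict_eq_iff)
    then have "g \<otimes>\<^bsub>?A\<^esub> \<gamma> = \<delta> \<otimes>\<^bsub>?A\<^esub> g"
      using fst_eq by (simp add: mult_Aut[OF g a(1)] mult_Aut[OF a(2) g])
    then show ?thesis using gA \<Gamma>\<^sub>2.mem_carrier[OF that(2)] by (simp add: A.m_assoc)
  qed
  let ?K = "conjugate_subgroup ?A g \<Gamma>\<^sub>1"
  have K_eq: "?K = (\<lambda>\<gamma>. g \<otimes>\<^bsub>?A\<^esub> \<gamma> \<otimes>\<^bsub>?A\<^esub> inv\<^bsub>?A\<^esub> g) ` \<Gamma>\<^sub>1"
    by (rule A.conjugate_subgroup_eq[OF gA \<Gamma>\<^sub>1.subset])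
  have K: "subgroup ?K ?A" by (rule A.subgroup_conjugate[OF gA \<Gamma>\<^sub>1])
  interpret K: subgroup ?K ?A by (rule K)
  have KL: "subgroup (?K \<inter> \<Gamma>\<^sub>2) ?A" by (rule A.subgroups_Inter_pair[OF K \<Gamma>\<^sub>2])
  obtain v where v: "v \<in> verts T" using verts_nonempty by blast
  have pos: "\<forall>u\<in>verts T. num_classes \<Gamma>\<^sub>2 (ball_verts R u) > 0"
    by (rule ballI) (rule num_classes_ball_pos[OF L2(1,2,4) assms(7) deg])
  obtain \<kappa> and F :: "('v \<times> ('v \<Rightarrow> 'v) set \<times> nat) set" where
    F: "finite F" "card F = num_classes \<Gamma>\<^sub>2 (ball_verts R v) * w v" "\<forall>\<gamma>\<in>\<Gamma>\<^sub>1. \<kappa> \<gamma> \<in> F" and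
    \<kappa>: "\<forall>\<gamma>\<in>\<Gamma>\<^sub>1. \<forall>\<gamma>'\<in>\<Gamma>\<^sub>1. \<kappa> \<gamma> = \<kappa> \<gamma>' \<longrightarrow>
      (\<exists>\<delta>\<in>\<Gamma>\<^sub>2. \<forall>u\<in>verts T. S.vert_map (fst (\<gamma>' \<otimes>\<^bsub>?G\<^esub> inv\<^bsub>?G\<^esub> \<gamma>) u) = fst \<delta> (S.vert_map u))"
    using S.conjugates_in_finite_classes\<^sub>1[OF v bspec[OF pos v]] by (elim exE conjE) (rule that)
  have unconj: "\<exists>\<gamma>\<in>\<Gamma>\<^sub>1. k = g \<otimes>\<^bsub>?A\<^esub> \<gamma> \<otimes>\<^bsub>?A\<^esub> inv\<^bsub>?A\<^esub> g \<and> inv\<^bsub>?A\<^esub> g \<otimes>\<^bsub>?A\<^esub> k \<otimes>\<^bsub>?A\<^esub> g = \<gamma>" if "k \<in> ?K" for k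
  proof -
    obtain \<gamma> where \<gamma>: "\<gamma> \<in> \<Gamma>\<^sub>1" "k = g \<otimes>\<^bsub>?A\<^esub> \<gamma> \<otimes>\<^bsub>?A\<^esub> inv\<^bsub>?A\<^esub> g" using \<open>k \<in> ?K\<close> unfolding K_eq by blast
    have "inv\<^bsub>?A\<^esub> g \<otimes>\<^bsub>?A\<^esub> (g \<otimes>\<^bsub>?A\<^esub> \<gamma>) = \<gamma>" using \<gamma>(1) gA by (simp flip: A.m_assoc)
    then have "inv\<^bsub>?A\<^esub> g \<otimes>\<^bsub>?A\<^esub> k \<otimes>\<^bsub>?A\<^esub> g = \<gamma>" using \<gamma> gA by (simp add: A.m_assoc)
    then show ?thesis using \<gamma> by blast
  qed
  have index\<^sub>1: "finite (rcosets\<^bsub>?A\<lparr>carrier := ?K\<rparr>\<^esub> (?K \<inter> \<Gamma>\<^sub>2))"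
    "card (rcosets\<^bsub>?A\<lparr>carrier := ?K\<rparr>\<^esub> (?K \<inter> \<Gamma>\<^sub>2)) \<le> card F"
  proof -
    let ?\<mu> = "\<lambda>k. \<kappa> (inv\<^bsub>?A\<^esub> g \<otimes>\<^bsub>?A\<^esub> k \<otimes>\<^bsub>?A\<^esub> g)"
    have in_F: "?\<mu> k \<in> F" if "k \<in> ?K" for k using unconj[OF that] F(3) by auto
    have same: "k' \<otimes>\<^bsub>?A\<^esub> inv\<^bsub>?A\<^esub> k \<in> ?K \<inter> \<Gamma>\<^sub>2" if k: "k \<in> ?K" "k' \<in> ?K" "?\<mu> k = ?\<mu> k'" for k k'
    proof -
      obtain \<gamma> where \<gamma>: "\<gamma> \<in> \<Gamma>\<^sub>1" "k = g \<otimes>\<^bsub>?A\<^esub> \<gamma> \<otimes>\<^bsub>?A\<^esub> inv\<^bsub>?A\<^esub> g" "inv\<^bsub>?A\<^esub> g \<otimes>\<^bsub>?A\<^esub> k \<otimes>\<^bsub>?A\<^esub> g = \<gamma>"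
        using unconj[OF k(1)] by blast
      obtain \<gamma>' where \<gamma>': "\<gamma>' \<in> \<Gamma>\<^sub>1" "k' = g \<otimes>\<^bsub>?A\<^esub> \<gamma>' \<otimes>\<^bsub>?A\<^esub> inv\<^bsub>?A\<^esub> g" "inv\<^bsub>?A\<^esub> g \<otimes>\<^bsub>?A\<^esub> k' \<otimes>\<^bsub>?A\<^esub> g = \<gamma>'"
        using unconj[OF k(2)] by blast
      have "\<kappa> \<gamma> = \<kappa> \<gamma>'" using k(3) \<gamma>(3) \<gamma>'(3) by simp
      then obtain \<delta> where \<delta>: "\<delta> \<in> \<Gamma>\<^sub>2"
        "\<forall>u\<in>verts T. S.vert_map (fst (\<gamma>' \<otimes>\<^bsub>?G\<^esub> inv\<^bsub>?G\<^esub> \<gamma>) u) = fst \<delta> (S.vert_map u)"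
        using \<kappa> \<gamma>(1) \<gamma>'(1) by blast
      have "\<gamma> \<in> H" using \<gamma>(1) assms(4) by blast
      then have "\<forall>u\<in>verts T. S.vert_map (fst (\<gamma>' \<otimes>\<^bsub>?A\<^esub> inv\<^bsub>?A\<^esub> \<gamma>) u) = fst \<delta> (S.vert_map u)"
        using \<delta>(2) by (simp add: inv_H)
      then have "g \<otimes>\<^bsub>?A\<^esub> (\<gamma>' \<otimes>\<^bsub>?A\<^esub> inv\<^bsub>?A\<^esub> \<gamma>) \<otimes>\<^bsub>?A\<^esub> inv\<^bsub>?A\<^esub> g = \<delta>"
        using \<gamma>(1) \<gamma>'(1) \<delta>(1) by (intro intertwine) auto
      moreover have "k' \<otimes>\<^bsub>?A\<^esub> inv\<^bsub>?A\<^esub> k = g \<otimes>\<^bsub>?A\<^esub> (\<gamma>' \<otimes>\<^bsub>?A\<^esub> inv\<^bsub>?A\<^esub> \<gamma>) \<otimes>\<^bsub>?A\<^esub> inv\<^bsub>?A\<^esub> g"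
      proof -
        have "inv\<^bsub>?A\<^esub> g \<otimes>\<^bsub>?A\<^esub> (g \<otimes>\<^bsub>?A\<^esub> (inv\<^bsub>?A\<^esub> \<gamma> \<otimes>\<^bsub>?A\<^esub> inv\<^bsub>?A\<^esub> g)) = inv\<^bsub>?A\<^esub> \<gamma> \<otimes>\<^bsub>?A\<^esub> inv\<^bsub>?A\<^esub> g"
          using \<gamma>(1) gA by (simp flip: A.m_assoc)
        then show ?thesis using \<gamma>(1,2) \<gamma>'(1,2) gA by (simp add: A.inv_mult_group A.m_assoc)
      qed
      ultimately have "k' \<otimes>\<^bsub>?A\<^esub> inv\<^bsub>?A\<^esub> k \<in> \<Gamma>\<^sub>2" using \<delta>(1) by simp
      then show ?thesis using k(1,2) by simp
    qed
    show "finite (rcosets\<^bsub>?A\<lparr>carrier := ?K\<rparr>\<^esub> (?K \<inter> \<Gamma>\<^sub>2))"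
      by (rule A.rcosets_le_classes(1)[OF KL K.subset F(1) in_F same])
    show "card (rcosets\<^bsub>?A\<lparr>carrier := ?K\<rparr>\<^esub> (?K \<inter> \<Gamma>\<^sub>2)) \<le> card F"
      by (rule A.rcosets_le_classes(2)[OF KL K.subset F(1) in_F same])
  qed
  have index\<^sub>2: "finite (rcosets\<^bsub>?A\<lparr>carrier := \<Gamma>\<^sub>2\<rparr>\<^esub> (?K \<inter> \<Gamma>\<^sub>2))"
  proof -
    obtain \<mu> and F' :: "('v \<times> ('v \<Rightarrow> 'v) set \<times> nat) set" where
      F': "finite F'" "\<forall>\<delta>\<in>\<Gamma>\<^sub>2. \<mu> \<delta> \<in> F'" and
      \<mu>: "\<forall>\<delta>\<in>\<Gamma>\<^sub>2. \<forall>\<delta>'\<in>\<Gamma>\<^sub>2. \<mu> \<delta> = \<mu> \<delta>' \<longrightarrow>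
        (\<exists>\<gamma>\<in>\<Gamma>\<^sub>1. \<forall>u\<in>verts T. S.vert_map (fst \<gamma> u) = fst (\<delta>' \<otimes>\<^bsub>?G\<^esub> inv\<^bsub>?G\<^esub> \<delta>) (S.vert_map u))"
      using S.conjugates_in_finite_classes\<^sub>2[OF L1(4) pos] by (elim exE conjE) (rule that)
    have same: "\<delta>' \<otimes>\<^bsub>?A\<^esub> inv\<^bsub>?A\<^esub> \<delta> \<in> ?K \<inter> \<Gamma>\<^sub>2" if \<delta>: "\<delta> \<in> \<Gamma>\<^sub>2" "\<delta>' \<in> \<Gamma>\<^sub>2" "\<mu> \<delta> = \<mu> \<delta>'" for \<delta> \<delta>'
    proof -
      obtain \<gamma> where \<gamma>: "\<gamma> \<in> \<Gamma>\<^sub>1"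
        "\<forall>u\<in>verts T. S.vert_map (fst \<gamma> u) = fst (\<delta>' \<otimes>\<^bsub>?G\<^esub> inv\<^bsub>?G\<^esub> \<delta>) (S.vert_map u)"
        using \<mu> \<delta> by blast
      have "\<delta> \<in> H" using \<delta>(1) assms(6) by blast
      then have "\<forall>u\<in>verts T. S.vert_map (fst \<gamma> u) = fst (\<delta>' \<otimes>\<^bsub>?A\<^esub> inv\<^bsub>?A\<^esub> \<delta>) (S.vert_map u)"
        using \<gamma>(2) by (simp add: inv_H)
      then have "g \<otimes>\<^bsub>?A\<^esub> \<gamma> \<otimes>\<^bsub>?A\<^esub> inv\<^bsub>?A\<^esub> g = \<delta>' \<otimes>\<^bsub>?A\<^esub> inv\<^bsub>?A\<^esub> \<delta>"
        using \<gamma>(1) \<delta> by (intro intertwine) auto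
      then have "\<delta>' \<otimes>\<^bsub>?A\<^esub> inv\<^bsub>?A\<^esub> \<delta> \<in> ?K" unfolding K_eq by (intro image_eqI[OF sym \<gamma>(1)])
      then show ?thesis using \<delta>(1,2) by simp
    qed
    show ?thesis
      by (rule A.rcosets_le_classes(1)[OF KL \<Gamma>\<^sub>2.subset F'(1) _ same]) (use F'(2) in auto)
  qed
  have "real (subgroup_index ?A ?K (?K \<inter> \<Gamma>\<^sub>2)) \<le> real (card F)"
    using index\<^sub>1(2) by (simp add: subgroup_index_def)
  also have "\<dots> \<le> ?bound" using bound[OF v] F(2) by simp
  finally have "real (subgroup_index ?A ?K (?K \<inter> \<Gamma>\<^sub>2)) \<le> ?bound" .
  moreover have "commensurable ?A ?K \<Gamma>\<^sub>2"
    using index\<^sub>1(1) index\<^sub>2 by (simp add: commensurable_def)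
  ultimately show ?thesis using closure by (intro bexI[of _ g] conjI)
qed

end
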